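(* Let $A$ be a (possibly unbounded) normal operator in a complex Hilbert space $X$. Every weak solution of the equation $y'(t)=Ay(t)$, $t\in\mathbb{R}$, is strongly infinite differentiable on $\mathbb{R}$ (i.e., belongs to $C^\infty(\mathbb{R},X)$) if and only if there exist $b_+>0$ and $b_->0$ such that the set $\sigma(A)\setminus \mathscr{L}_{b_-,b_+}$ is bounded, where $\sigma(A)$ is the spectrum of $A$ and $$\mathscr{L}_{b_-,b_+}:=\left\{\lambda\in\mathbb{C}\ \middle|\ \operatorname{Re}\lambda\le\min\left(0,-b_-\ln|\operatorname{Im}\lambda|\right)\ \text{or}\ \operatorname{Re}\lambda\ge\max\left(0,b_+\ln|\operatorname{Im}\lambda|\right)\right\}.$$
   Context: Weak solution: a strongly (i.e., norm) continuous function $y:\mathbb{R}\to X$ is a weak solution of $y'(t)=Ay(t)$, $t\in\mathbb{R}$, with a densely defined closed linear operator $A$, if for every $g^*\in D(A^* )$, $\frac{d}{dt}\langle y(t),g^*\rangle=\langle y(t),A^*g^*\rangle$ for all $t\in\mathbb{R}$, where $A^*$ is the adjoint of $A$, $D(\cdot)$ is the domain of an operator, and $\langle\cdot,\cdot\rangle$ is the pairing between $X$ and its dual (in the Hilbert space setting, equivalently, the inner product together with the Hilbert space adjoint). It need not be strongly differentiable. Strong differentiability means differentiability in the norm of $X$. Convention: $\ln 0=-\infty$, so that every real $\lambda$ belongs to $\mathscr{L}_{b_-,b_+}$. *)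

theory Defs
  imports "HOL-Analysis.Analysis"
begin

section \<open>Complex Hilbert spaces\<close>

text \<open>The inner product is linear in the first argument, as in the pairing of a vector
  with a functional.  Definiteness need not be listed among the axioms: it follows from
  \<open>norm_eq_sqrt_cinner\<close> and the norm axioms.\<close>

class complex_inner_space = real_normed_vector +
  fixes scaleC :: "complex \<Rightarrow> 'a \<Rightarrow> 'a" (infixr "*\<^sub>C" 75)
    and cinner :: "'a \<Rightarrow> 'a \<Rightarrow> complex"
  assumes scaleC_add_right: "a *\<^sub>C (x + y) = a *\<^sub>C x + a *\<^sub>C y"
    and scaleC_add_left: "(a + b) *\<^sub>C x = a *\<^sub>C x + b *\<^sub>C x"
    and scaleC_scaleC: "a *\<^sub>C (b *\<^sub>C x) = (a * b) *\<^sub>C x"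
    and scaleC_of_real: "complex_of_real r *\<^sub>C x = r *\<^sub>R x"
    and cinner_commute: "cinner x y = cnj (cinner y x)"
    and cinner_add_left: "cinner (x + y) z = cinner x z + cinner y z"
    and cinner_scaleC_left: "cinner (a *\<^sub>C x) y = a * cinner x y"
    and cinner_self_nonneg: "0 \<le> Re (cinner x x)"
    and norm_eq_sqrt_cinner: "norm x = sqrt (Re (cinner x x))"

class complex_hilbert_space = complex_inner_space + complete_space

subclass (in complex_hilbert_space) banach ..

instantiation complex :: complex_hilbert_space
begin

definition "scaleC_complex a (x::complex) = a * x"
definition "cinner_complex x (y::complex) = x * cnj y"

instance
  by standard
    (auto simp: scaleC_complex_def cinner_complex_def algebra_simps scaleR_conv_of_real
       cmod_def power2_eq_square)

end


section \<open>Unbounded operators\<close>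

text \<open>An operator is a pair of a domain \<open>D\<close> and a function \<open>A\<close>; the values of \<open>A\<close> outside
  \<open>D\<close> are irrelevant in all notions below.\<close>

definition linear_operator :: "'a::complex_inner_space set \<Rightarrow> ('a \<Rightarrow> 'a) \<Rightarrow> bool" where
  "linear_operator D A \<longleftrightarrow>
     0 \<in> D \<and> (\<forall>x\<in>D. \<forall>y\<in>D. x + y \<in> D \<and> A (x + y) = A x + A y) \<and>
     (\<forall>c. \<forall>x\<in>D. c *\<^sub>C x \<in> D \<and> A (c *\<^sub>C x) = c *\<^sub>C A x)"

definition densely_defined :: "'a::complex_inner_space set \<Rightarrow> bool" where
  "densely_defined D \<longleftrightarrow> closure D = UNIV"

definition closed_operator :: "'a::complex_inner_space set \<Rightarrow> ('a \<Rightarrow> 'a) \<Rightarrow> bool" where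
  "closed_operator D A \<longleftrightarrow> closed {(x, A x) | x. x \<in> D}"

definition adjoint_dom :: "'a::complex_inner_space set \<Rightarrow> ('a \<Rightarrow> 'a) \<Rightarrow> 'a set" where
  "adjoint_dom D A = {g. \<exists>h. \<forall>f\<in>D. cinner (A f) g = cinner f h}"

text \<open>The value described is unique when \<open>D\<close> is dense and \<open>g \<in> adjoint_dom D A\<close>.\<close>

definition adjoint_op :: "'a::complex_inner_space set \<Rightarrow> ('a \<Rightarrow> 'a) \<Rightarrow> 'a \<Rightarrow> 'a" where
  "adjoint_op D A g = (THE h. \<forall>f\<in>D. cinner (A f) g = cinner f h)"

text \<open>The natural domain of the composition that applies \<open>A\<close> (with domain \<open>D\<close>) first and then
  an operator with domain \<open>E\<close>.\<close>

definition comp_dom :: "'a set \<Rightarrow> ('a \<Rightarrow> 'a) \<Rightarrow> 'a set \<Rightarrow> 'a set" where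
  "comp_dom D A E = {x \<in> D. A x \<in> E}"

text \<open>Normality is \<open>A\<^sup>* A = A A\<^sup>*\<close> as unbounded operators, including equality of the domains.\<close>

definition normal_operator :: "'a::complex_hilbert_space set \<Rightarrow> ('a \<Rightarrow> 'a) \<Rightarrow> bool" where
  "normal_operator D A \<longleftrightarrow>
     linear_operator D A \<and> densely_defined D \<and> closed_operator D A \<and>
     comp_dom D A (adjoint_dom D A) = comp_dom (adjoint_dom D A) (adjoint_op D A) D \<and>
     (\<forall>x \<in> comp_dom D A (adjoint_dom D A). adjoint_op D A (A x) = A (adjoint_op D A x))"

definition resolvent_set :: "'a::complex_inner_space set \<Rightarrow> ('a \<Rightarrow> 'a) \<Rightarrow> complex set" where
  "resolvent_set D A =
     {z. bij_betw (\<lambda>x. A x - z *\<^sub>C x) D UNIV \<and>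
         bounded_linear (inv_into D (\<lambda>x. A x - z *\<^sub>C x))}"

definition spectrum :: "'a::complex_inner_space set \<Rightarrow> ('a \<Rightarrow> 'a) \<Rightarrow> complex set" where
  "spectrum D A = - resolvent_set D A"


section \<open>Weak solutions and strong smoothness\<close>

definition weak_solution ::
    "'a::complex_hilbert_space set \<Rightarrow> ('a \<Rightarrow> 'a) \<Rightarrow> (real \<Rightarrow> 'a) \<Rightarrow> bool" where
  "weak_solution D A y \<longleftrightarrow>
     continuous_on UNIV y \<and>
     (\<forall>g \<in> adjoint_dom D A. \<forall>t.
        ((\<lambda>s. cinner (y s) g) has_vector_derivative cinner (y t) (adjoint_op D A g)) (at t))"

definition strong_deriv :: "(real \<Rightarrow> 'a::real_normed_vector) \<Rightarrow> real \<Rightarrow> 'a" where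
  "strong_deriv y t = vector_derivative y (at t)"

definition strongly_smooth :: "(real \<Rightarrow> 'a::real_normed_vector) \<Rightarrow> bool" where
  "strongly_smooth y \<longleftrightarrow> (\<forall>n t. (strong_deriv ^^ n) y differentiable (at t))"


section \<open>The spectral region\<close>

text \<open>The library has \<open>ln 0 = 0\<close>, whereas the region uses the convention \<open>ln 0 = -\<infinity>\<close>.\<close>

definition ext_ln :: "real \<Rightarrow> ereal" where
  "ext_ln x = (if x = 0 then -\<infinity> else ereal (ln x))"

definition log_region :: "real \<Rightarrow> real \<Rightarrow> complex set" where
  "log_region bm bp =
     {z. ereal (Re z) \<le> min 0 (- ereal bm * ext_ln \<bar>Im z\<bar>) \<or>
         max 0 (ereal bp * ext_ln \<bar>Im z\<bar>) \<le> ereal (Re z)}"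

lemma of_real_in_log_region:
  assumes "bm > 0" "bp > 0"
  shows "complex_of_real r \<in> log_region bm bp"
  using assms by (auto simp: log_region_def ext_ln_def)

end

theory Submission
  imports Defs
begin

text \<open>
  Both sides are equivalent to an exponential growth bound on the spectrum: there are \<open>C\<close> and \<open>\<tau>\<close> with
  \<open>|w| \<le> C exp (\<tau> |Re w|)\<close> for all \<open>w \<in> \<sigma>(A)\<close>.  For the logarithmic region this is elementary
  (\<open>log_region_exponential\<close>).

  The spectral theorem enters only in an approximate form: for every \<open>d > 0\<close> the space is an
  orthogonal sum of countably many reducing subspaces, with projections \<open>P\<^sub>k\<close>, on which \<open>A\<close> differs
  from a scalar \<open>z\<^sub>k\<close> by at most \<open>d\<close> in norm (\<open>scalar_resolution_exists\<close>).  To obtain it, the bounded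
  operator \<open>T = (1 + A\<^sup>* A)\<^sup>-\<^sup>1\<close> is sliced by its spectral projections into blocks where \<open>A\<close> is bounded, and
  each block is sliced according to the real and imaginary parts of \<open>A\<close>.  Spectral projections of a
  bounded selfadjoint operator come from its absolute value, the limit of a square root iteration.
  The scalars \<open>z\<^sub>k\<close> of the nonzero blocks follow the spectrum up to \<open>2 d\<close>, and conversely
  (\<open>spectrum_near_block\<close>, \<open>block_near_spectrum\<close>).

  If the growth bound holds, let \<open>y\<close> be a weak solution.  Its component \<open>P\<^sub>k y\<close> solves a linear equation
  whose generator is within \<open>d = 1\<close> of the scalar \<open>z\<^sub>k\<close>, so its norm grows or decays like
  \<open>exp (t Re z\<^sub>k)\<close> up to \<open>exp |t|\<close>.  Therefore \<open>\<parallel>A P\<^sub>k y(t)\<parallel>\<close>, which is about \<open>|z\<^sub>k| \<parallel>P\<^sub>k y(t)\<parallel>\<close>, is at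
  most a constant times the norm of \<open>P\<^sub>k y\<close> at \<open>t + \<tau>\<close> or at \<open>t - \<tau>\<close>, with a constant free of \<open>k\<close>.
  Summing the squares puts \<open>y(t)\<close> into the domain with a bound on \<open>A y(t)\<close>; applied to increments of
  \<open>y\<close>, the bound makes \<open>A y\<close> continuous.  So \<open>y' = A y\<close> strongly, and \<open>A y\<close> is a solution of the same
  kind: by induction \<open>y\<close> is smooth (\<open>smooth_if_spectrum_growth\<close>).

  If the growth bound fails, there are distinct blocks with \<open>|z\<^sub>n| \<ge> 2\<^sup>n exp (n |Re z\<^sub>n|)\<close>.  With unit
  vectors \<open>e\<^sub>n\<close> in these blocks, \<open>y(t) = \<Sum> e\<^bsup>t A\<^esup> e\<^sub>n / |z\<^sub>n|\<close> converges locally uniformly and is a weak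
  solution, but it is not even differentiable at \<open>0\<close>: the block components of the derivative would be
  \<open>A e\<^sub>n / |z\<^sub>n|\<close>, which have norm close to \<open>1\<close> (\<open>spectrum_growth_if_smooth\<close>).
\<close>

section \<open>Inner product and orthogonal projection\<close>

lemma cinner_add_right: "cinner x (y + z) = cinner x y + cinner x (z::'a::complex_inner_space)"
  by (metis cinner_add_left cinner_commute complex_cnj_add)

lemma cinner_scaleC_right: "cinner x (c *\<^sub>C y) = cnj c * cinner x (y::'a::complex_inner_space)"
  by (metis cinner_scaleC_left cinner_commute complex_cnj_mult)

lemma scaleC_minus1: "(-1) *\<^sub>C x = - (x::'a::complex_inner_space)"
  using scaleC_of_real[of "-1" x] by simp

lemma scaleC_one [simp]: "1 *\<^sub>C x = (x::'a::complex_inner_space)"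
  using scaleC_of_real[of 1 x] by simp

lemma cinner_scaleR_left: "cinner (r *\<^sub>R x) y = of_real r * cinner x (y::'a::complex_inner_space)"
  by (metis cinner_scaleC_left scaleC_of_real)

lemma cinner_scaleR_right: "cinner x (r *\<^sub>R y) = of_real r * cinner x (y::'a::complex_inner_space)"
  by (metis cinner_scaleC_right complex_cnj_complex_of_real scaleC_of_real)

lemma cinner_zero_left [simp]: "cinner 0 (y::'a::complex_inner_space) = 0"
  using cinner_scaleR_left[of 0 0 y] by simp

lemma cinner_zero_right [simp]: "cinner (y::'a::complex_inner_space) 0 = 0"
  using cinner_scaleR_right[of y 0 0] by simp

lemma cinner_minus_left: "cinner (- x) y = - cinner x (y::'a::complex_inner_space)"
  using cinner_scaleR_left[of "-1" x y] by simp

lemma cinner_minus_right: "cinner x (- y) = - cinner x (y::'a::complex_inner_space)"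
  using cinner_scaleR_right[of x "-1" y] by simp

lemma cinner_diff_left: "cinner (x - y) z = cinner x z - cinner y (z::'a::complex_inner_space)"
  using cinner_add_left[of x "- y" z] by (simp add: cinner_minus_left)

lemma cinner_diff_right: "cinner x (y - z) = cinner x y - cinner x (z::'a::complex_inner_space)"
  using cinner_add_right[of x y "- z"] by (simp add: cinner_minus_right)

lemmas cinner_simps = cinner_add_left cinner_add_right cinner_diff_left cinner_diff_right
  cinner_minus_left cinner_minus_right cinner_scaleC_left cinner_scaleC_right
  cinner_scaleR_left cinner_scaleR_right

lemma cinner_sum_left: "cinner (sum f S) y = (\<Sum>i\<in>S. cinner (f i) (y::'a::complex_inner_space))"
  by (induction S rule: infinite_finite_induct) (simp_all add: cinner_add_left)

lemma Re_cinner_self: "Re (cinner x x) = (norm (x::'a::complex_inner_space))\<^sup>2"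
  by (simp add: norm_eq_sqrt_cinner cinner_self_nonneg)

lemma cinner_self: "cinner x x = complex_of_real ((norm (x::'a::complex_inner_space))\<^sup>2)"
  using cinner_commute[of x x] by (simp add: complex_eq_iff Re_cinner_self)

lemma Re_cinner_commute: "Re (cinner x y) = Re (cinner y (x::'a::complex_inner_space))"
  by (metis cinner_commute complex_cnj(1) complex.collapse complex.sel(1))

lemma norm_add_sq: "(norm (x + y))\<^sup>2 = (norm x)\<^sup>2 + 2 * Re (cinner x y) + (norm (y::'a::complex_inner_space))\<^sup>2"
  using Re_cinner_self[of "x + y"] Re_cinner_commute[of x y]
  by (simp add: cinner_simps Re_cinner_self)

lemma norm_diff_sq: "(norm (x - y))\<^sup>2 = (norm x)\<^sup>2 - 2 * Re (cinner x y) + (norm (y::'a::complex_inner_space))\<^sup>2"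
  using norm_add_sq[of x "- y"] by (simp add: cinner_simps)

lemma norm_scaleC: "norm (c *\<^sub>C x) = norm c * norm (x::'a::complex_inner_space)"
proof -
  have "(norm (c *\<^sub>C x))\<^sup>2 = Re (c * cnj c * cinner x x)"
    unfolding Re_cinner_self[symmetric] by (simp only: cinner_simps ac_simps)
  also have "\<dots> = (norm c * norm x)\<^sup>2"
    by (simp add: complex_norm_square[symmetric] cinner_self power_mult_distrib flip: of_real_power of_real_mult)
  finally show ?thesis by (simp add: power2_eq_iff_nonneg)
qed

lemma scaleC_zero_right [simp]: "c *\<^sub>C (0::'a::complex_inner_space) = 0"
  using norm_scaleC[of c "0::'a"] by simp

lemma scaleC_minus_left: "(- c) *\<^sub>C x = - (c *\<^sub>C (x::'a::complex_inner_space))"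
  using scaleC_scaleC[of "-1" c x] by (simp add: scaleC_minus1)

lemma scaleC_minus_right: "c *\<^sub>C (- x) = - (c *\<^sub>C (x::'a::complex_inner_space))"
  using scaleC_scaleC[of c "-1" x] by (simp add: scaleC_minus1 scaleC_minus_left)

lemma scaleC_diff_right: "c *\<^sub>C (x - y) = c *\<^sub>C x - c *\<^sub>C (y::'a::complex_inner_space)"
  using scaleC_add_right[of c x "- y"] by (simp add: scaleC_minus_right)

lemma scaleC_diff_left: "(c - d) *\<^sub>C x = c *\<^sub>C x - d *\<^sub>C (x::'a::complex_inner_space)"
  using scaleC_add_left[of c "- d" x] by (simp add: scaleC_minus_left)

lemma scaleC_scaleR: "c *\<^sub>C (r *\<^sub>R x) = r *\<^sub>R (c *\<^sub>C (x::'a::complex_inner_space))"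
  by (metis mult.commute scaleC_of_real scaleC_scaleC)

lemma bounded_linear_scaleC: "bounded_linear ((*\<^sub>C) c :: 'a::complex_inner_space \<Rightarrow> 'a)"
  by (rule bounded_linear_intro[where K = "norm c"])
     (simp_all add: scaleC_add_right scaleC_scaleR norm_scaleC mult.commute)

text \<open>Expanding the square on both sides of the triangle inequality gives the real part of the
  Cauchy--Schwarz inequality; rotating one argument by a phase gives the rest.\<close>

lemma Re_cinner_le: "Re (cinner x y) \<le> norm x * norm (y::'a::complex_inner_space)"
proof -
  have "(norm (x + y))\<^sup>2 \<le> (norm x + norm y)\<^sup>2"
    by (simp add: norm_triangle_ineq power_mono)
  then show ?thesis by (simp add: norm_add_sq power2_sum)
qed

lemma norm_cinner_le: "norm (cinner x y) \<le> norm x * norm (y::'a::complex_inner_space)"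
proof (cases "cinner x y = 0")
  case False
  define c where "c = cnj (sgn (cinner x y))"
  have c: "norm c = 1" using False by (simp add: c_def norm_sgn)
  have "c * cinner x y = of_real (norm (cinner x y))"
    using False unfolding c_def sgn_div_norm
    by (simp add: complex_norm_square[symmetric] scaleR_conv_of_real field_simps power2_eq_square
        flip: of_real_mult)
  then have "norm (cinner x y) = Re (cinner (c *\<^sub>C x) y)" by (simp add: cinner_simps)
  also have "\<dots> \<le> norm x * norm y" using Re_cinner_le[of "c *\<^sub>C x" y] by (simp add: norm_scaleC c)
  finally show ?thesis .
qed simp

lemma bounded_bilinear_cinner: "bounded_bilinear (cinner :: 'a::complex_inner_space \<Rightarrow> 'a \<Rightarrow> complex)"
  by (rule bounded_bilinear.intro)
     (auto simp: cinner_simps scaleR_conv_of_real norm_cinner_le intro!: exI[of _ 1])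

lemmas tendsto_cinner = bounded_bilinear.tendsto[OF bounded_bilinear_cinner]
lemmas continuous_on_cinner = bounded_bilinear.continuous_on[OF bounded_bilinear_cinner]
lemmas has_vector_derivative_cinner = bounded_bilinear.has_vector_derivative[OF bounded_bilinear_cinner]
lemmas bounded_linear_cinner_left = bounded_bilinear.bounded_linear_left[OF bounded_bilinear_cinner]

lemma eq_if_cinner_eq:
  assumes "\<And>g. cinner x g = cinner y (g::'a::complex_inner_space)" shows "x = y"
proof -
  have "cinner (x - y) (x - y) = 0" using assms by (simp add: cinner_diff_left)
  then show ?thesis using Re_cinner_self[of "x - y"] by simp
qed

lemma zero_if_orthogonal_dense:
  assumes "closure S = UNIV" and "\<And>f. f \<in> S \<Longrightarrow> cinner x f = 0"
  shows "x = (0::'a::complex_inner_space)"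
proof -
  obtain s where s: "\<And>n. s n \<in> S" "s \<longlonglongrightarrow> x"
    using assms(1) closure_sequential[of x S] by auto
  have "(\<lambda>n. cinner x (s n)) \<longlonglongrightarrow> cinner x x" by (intro tendsto_cinner tendsto_const s)
  then have "cinner x x = 0" using assms(2) s(1) by (simp add: LIMSEQ_const_iff)
  then show ?thesis using Re_cinner_self[of x] by simp
qed

text \<open>The bound on \<open>|\<langle>q, g\<rangle>|\<close> for \<open>g\<close> in a dense set passes to \<open>g = q\<close>.\<close>

lemma norm_le_if_cinner_le_dense:
  assumes S: "closure S = UNIV" and le: "\<And>g. g \<in> S \<Longrightarrow> norm (cinner q g) \<le> c * norm g"
  shows "norm (q::'a::complex_inner_space) \<le> c \<or> q = 0"
proof -
  obtain s where s: "\<And>n. s n \<in> S" "s \<longlonglongrightarrow> q"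
    using S closure_sequential[of q S] by auto
  have "norm (cinner q q) \<le> c * norm q"
  proof (rule LIMSEQ_le)
    show "(\<lambda>n. norm (cinner q (s n))) \<longlonglongrightarrow> norm (cinner q q)"
      by (intro tendsto_norm tendsto_cinner tendsto_const s)
    show "(\<lambda>n. c * norm (s n)) \<longlonglongrightarrow> c * norm q" by (intro tendsto_intros s)
    show "\<exists>N. \<forall>n\<ge>N. norm (cinner q (s n)) \<le> c * norm (s n)" using le s(1) by blast
  qed
  then have "norm q * norm q \<le> c * norm q" by (simp add: cinner_self power2_eq_square norm_mult)
  then show ?thesis by auto
qed

text \<open>The argument needs only the polarised square of the norm, so \<open>ip\<close> may be the real part of the
  inner product of the space or of its product with itself; the latter serves for graphs of operators.\<close>

lemma orthogonal_projection_exists: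
  fixes ip :: "'b::{complete_space,real_normed_vector} \<Rightarrow> 'b \<Rightarrow> real"
  assumes ip: "\<And>x y. (norm (x + y))\<^sup>2 = (norm x)\<^sup>2 + 2 * ip x y + (norm y)\<^sup>2"
    and scale: "\<And>r x y. ip x (r *\<^sub>R y) = r * ip x y"
    and G: "subspace G" "closed G"
  shows "\<exists>g\<in>G. \<forall>v\<in>G. ip (p - g) v = 0"
proof -
  have diff: "(norm (x - y))\<^sup>2 = (norm x)\<^sup>2 - 2 * ip x y + (norm y)\<^sup>2" for x y
    using ip[of x "- y"] scale[of x "-1" y] by simp
  have par: "(norm (x + y))\<^sup>2 + (norm (x - y))\<^sup>2 = 2 * (norm x)\<^sup>2 + 2 * (norm y)\<^sup>2" for x y :: 'b
    using ip[of x y] diff[of x y] by linarith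
  define d where "d = infdist p G"
  have ne: "G \<noteq> {}" using G(1) subspace_0 by blast
  have d0: "0 \<le> d" by (simp add: d_def infdist_nonneg)
  have dle: "d \<le> norm (p - v)" if "v \<in> G" for v
    using infdist_le[OF that, of p] by (simp add: d_def dist_norm)
  have "\<exists>g\<in>G. norm (p - g) < d + 1 / Suc n" for n :: nat
  proof (rule ccontr)
    assume "\<not> ?thesis"
    then have "\<And>g. g \<in> G \<Longrightarrow> d + 1 / Suc n \<le> dist p g" by (auto simp: dist_norm not_less)
    then have "d + 1 / Suc n \<le> infdist p G"
      unfolding infdist_notempty[OF ne] by (intro cINF_greatest ne) auto
    then show False by (simp add: d_def)
  qed
  then obtain g where g: "\<And>n. g n \<in> G" "\<And>n::nat. norm (p - g n) < d + 1 / Suc n" by metis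
  \<comment> \<open>The midpoint of two near-minimisers is in \<open>G\<close>, so the parallelogram law forces them together.\<close>
  have close: "(norm (g m - g n))\<^sup>2 \<le> 2 * (norm (p - g m))\<^sup>2 + 2 * (norm (p - g n))\<^sup>2 - 4 * d\<^sup>2" for m n
  proof -
    have "(1/2) *\<^sub>R (g m + g n) \<in> G" using G(1) g(1) by (simp add: subspace_add subspace_scale)
    then have "d \<le> norm (p - (1/2) *\<^sub>R (g m + g n))" by (rule dle)
    also have "p - (1/2) *\<^sub>R (g m + g n) = (1/2) *\<^sub>R ((p - g m) + (p - g n))"
      by (simp add: algebra_simps flip: scaleR_2)
    finally have "2 * d \<le> norm ((p - g m) + (p - g n))" by simp
    then have "(2 * d)\<^sup>2 \<le> (norm ((p - g m) + (p - g n)))\<^sup>2" using d0 by (intro power_mono) auto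
    moreover have "(p - g m) - (p - g n) = - (g m - g n)" by simp
    ultimately show ?thesis
      using par[of "p - g m" "p - g n"] by (simp add: norm_minus_commute power_mult_distrib)
  qed
  have lim: "(\<lambda>n. norm (p - g n)) \<longlonglongrightarrow> d"
  proof (rule tendsto_sandwich[of "\<lambda>_. d" _ _ "\<lambda>n::nat. d + 1 / Suc n"])
    show "(\<lambda>n::nat. d + 1 / Suc n) \<longlonglongrightarrow> d"
      using tendsto_add[OF tendsto_const[of d] LIMSEQ_inverse_real_of_nat] by (simp add: inverse_eq_divide)
  qed (use g(1) dle less_imp_le[OF g(2)] in \<open>auto intro!: always_eventually\<close>)
  have "Cauchy g"
  proof (rule metric_CauchyI)
    fix e :: real assume e: "0 < e"
    have "(\<lambda>n. (norm (p - g n))\<^sup>2) \<longlonglongrightarrow> d\<^sup>2" by (intro tendsto_intros lim)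
    then have "\<forall>\<^sub>F n in sequentially. (norm (p - g n))\<^sup>2 < d\<^sup>2 + e\<^sup>2 / 4"
      by (rule order_tendstoD) (use e in auto)
    then obtain N where N: "\<And>n. n \<ge> N \<Longrightarrow> (norm (p - g n))\<^sup>2 < d\<^sup>2 + e\<^sup>2 / 4"
      by (auto simp: eventually_sequentially)
    have "dist (g m) (g n) < e" if "m \<ge> N" "n \<ge> N" for m n
    proof -
      have "(norm (g m - g n))\<^sup>2 < e\<^sup>2" using close[of m n] N[OF that(1)] N[OF that(2)] by linarith
      then show ?thesis unfolding dist_norm using e by (simp add: power_less_imp_less_base)
    qed
    then show "\<exists>N. \<forall>m\<ge>N. \<forall>n\<ge>N. dist (g m) (g n) < e" by blast
  qed
  then obtain u where u: "g \<longlonglongrightarrow> u" using Cauchy_convergent_iff convergent_def by blast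
  have uG: "u \<in> G" using G(2) g(1) u closed_sequentially by blast
  have nu: "norm (p - u) = d"
    by (rule LIMSEQ_unique[OF _ lim]) (intro tendsto_intros u)
  have "ip (p - u) v = 0" if "v \<in> G" for v
  proof (rule ccontr)
    assume nz: "ip (p - u) v \<noteq> 0"
    define a where "a = ip (p - u) v"
    define s where "s = a / ((norm v)\<^sup>2 + 1)"
    have pos: "0 < (norm v)\<^sup>2 + 1" by (simp add: add_nonneg_pos)
    have "u + s *\<^sub>R v \<in> G" using uG that G(1) by (simp add: subspace_add subspace_scale)
    then have "d \<le> norm ((p - u) - s *\<^sub>R v)" using dle by (simp add: diff_diff_eq)
    then have "d\<^sup>2 \<le> (norm ((p - u) - s *\<^sub>R v))\<^sup>2" using d0 by (intro power_mono)
    then have "2 * s * a \<le> s\<^sup>2 * (norm v)\<^sup>2"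
      by (simp add: diff scale nu a_def power_mult_distrib)
    also have "\<dots> \<le> s\<^sup>2 * ((norm v)\<^sup>2 + 1)" by (simp add: mult_left_mono)
    also have "\<dots> = s * a"
    proof -
      have "s * ((norm v)\<^sup>2 + 1) = a" using pos by (simp add: s_def)
      then show ?thesis by (metis mult.assoc power2_eq_square)
    qed
    finally have "2 * s * a \<le> s * a" .
    then have "s * a \<le> 0" by linarith
    moreover have "0 < a * a" using nz by (simp add: a_def zero_less_mult_iff) linarith
    then have "0 < s * a" using pos by (simp add: s_def)
    ultimately show False by simp
  qed
  then show ?thesis using uG by blast
qed

lemma projection_on_subspace:
  fixes G :: "'a::complex_hilbert_space set"
  assumes "subspace G" "closed G" and C: "\<And>c x. x \<in> G \<Longrightarrow> c *\<^sub>C x \<in> G"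
  shows "\<exists>g\<in>G. \<forall>v\<in>G. cinner (p - g) v = 0"
proof -
  obtain g where g: "g \<in> G" "\<And>v. v \<in> G \<Longrightarrow> Re (cinner (p - g) v) = 0"
    using orthogonal_projection_exists[of "\<lambda>x y. Re (cinner x y)" G p] assms
    by (auto simp: norm_add_sq cinner_simps)
  have "cinner (p - g) v = 0" if "v \<in> G" for v
    using g(2)[OF that] g(2)[OF C[OF that, of \<i>]] by (simp add: cinner_scaleC_right complex_eq_iff)
  then show ?thesis using g(1) by blast
qed

lemma projection_on_subspace_pair:
  fixes G :: "('a::complex_hilbert_space \<times> 'a) set"
  assumes "subspace G" "closed G"
  shows "\<exists>u k. (u, k) \<in> G \<and> (\<forall>(v, l)\<in>G. Re (cinner (x - u) v + cinner (h - k) l) = 0)"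
proof -
  have sq: "(norm p)\<^sup>2 = (norm (fst p))\<^sup>2 + (norm (snd p))\<^sup>2" for p :: "'a \<times> 'a"
    by (simp add: norm_prod_def)
  have "(norm (p + q))\<^sup>2 = (norm p)\<^sup>2 + 2 * (Re (cinner (fst p) (fst q)) + Re (cinner (snd p) (snd q))) + (norm q)\<^sup>2"
    for p q :: "'a \<times> 'a"
    by (simp add: sq norm_add_sq)
  from orthogonal_projection_exists[OF this _ assms, of "(x, h)"]
  obtain g where "g \<in> G" "\<And>v. v \<in> G \<Longrightarrow>
      Re (cinner (fst ((x, h) - g)) (fst v)) + Re (cinner (snd ((x, h) - g)) (snd v)) = 0"
    by (auto simp: cinner_simps algebra_simps)
  then show ?thesis by (intro exI[of _ "fst g"] exI[of _ "snd g"]) force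
qed

section \<open>Adjoints and normal operators\<close>

lemma subspace_closure:
  fixes S :: "'b::real_normed_vector set"
  assumes S: "subspace S" shows "subspace (closure S)"
  unfolding subspace_def
proof (intro conjI ballI allI)
  show "0 \<in> closure S" using subspace_0[OF S] closure_subset by blast
next
  fix x y assume "x \<in> closure S" "y \<in> closure S"
  then obtain a b where "\<forall>n. a n \<in> S" "a \<longlonglongrightarrow> x" "\<forall>n. b n \<in> S" "b \<longlonglongrightarrow> y"
    unfolding closure_sequential by blast
  then show "x + y \<in> closure S"
    unfolding closure_sequential
    by (intro exI[of _ "\<lambda>n. a n + b n"]) (simp add: subspace_add[OF S] tendsto_add)
next
  fix c x assume "x \<in> closure S"
  then obtain a where "\<forall>n. a n \<in> S" "a \<longlonglongrightarrow> x" unfolding closure_sequential by blast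
  then show "c *\<^sub>R x \<in> closure S"
    unfolding closure_sequential
    by (intro exI[of _ "\<lambda>n. c *\<^sub>R a n"]) (simp add: subspace_scale[OF S] tendsto_scaleR)
qed

text \<open>Each operator is the full adjoint of the other.  For a closed densely defined \<open>A\<close> this holds with
  \<open>B = A\<^sup>*\<close>; the relation carries linearity and closedness with it, and its symmetry allows the roles of
  \<open>A\<close> and \<open>A\<^sup>*\<close> to be exchanged.\<close>

definition mutual_adjoint ::
    "'a::complex_hilbert_space set \<Rightarrow> ('a \<Rightarrow> 'a) \<Rightarrow> 'a set \<Rightarrow> ('a \<Rightarrow> 'a) \<Rightarrow> bool" where
  "mutual_adjoint D A E B \<longleftrightarrow>
     (\<forall>g h. g \<in> E \<and> B g = h \<longleftrightarrow> (\<forall>f\<in>D. cinner (A f) g = cinner f h)) \<and>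
     (\<forall>f h. f \<in> D \<and> A f = h \<longleftrightarrow> (\<forall>g\<in>E. cinner (B g) f = cinner g h))"

lemma mutual_adjoint_sym: "mutual_adjoint D A E B \<Longrightarrow> mutual_adjoint E B D A"
  by (auto simp: mutual_adjoint_def)

lemma mutual_adjoint_cinner:
  "mutual_adjoint D A E B \<Longrightarrow> f \<in> D \<Longrightarrow> g \<in> E \<Longrightarrow> cinner (A f) g = cinner f (B g)"
  unfolding mutual_adjoint_def by blast

lemma mutual_adjoint_cinner':
  "mutual_adjoint D A E B \<Longrightarrow> f \<in> D \<Longrightarrow> g \<in> E \<Longrightarrow> cinner (B g) f = cinner g (A f)"
  unfolding mutual_adjoint_def by blast

lemma mutual_adjointD:
  assumes "mutual_adjoint D A E B" and "\<And>g. g \<in> E \<Longrightarrow> cinner (B g) f = cinner g h"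
  shows "f \<in> D" "A f = h"
  using assms unfolding mutual_adjoint_def by blast+

lemma mutual_adjointD':
  assumes "mutual_adjoint D A E B" and "\<And>f. f \<in> D \<Longrightarrow> cinner (A f) g = cinner f h"
  shows "g \<in> E" "B g = h"
  using assms unfolding mutual_adjoint_def by blast+

lemma mutual_adjoint_linear:
  assumes m: "mutual_adjoint D A E B" shows "linear_operator D A"
proof -
  note r = mutual_adjoint_cinner'[OF m]
  have "x + y \<in> D \<and> A (x + y) = A x + A y" if "x \<in> D" "y \<in> D" for x y
    using mutual_adjointD[OF m, of "x + y" "A x + A y"] that by (simp add: cinner_simps r)
  moreover have "c *\<^sub>C x \<in> D \<and> A (c *\<^sub>C x) = c *\<^sub>C A x" if "x \<in> D" for c x
    using mutual_adjointD[OF m, of "c *\<^sub>C x" "c *\<^sub>C A x"] that by (simp add: cinner_simps r)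
  moreover have "0 \<in> D" using mutual_adjointD[OF m, of 0 0] by simp
  ultimately show ?thesis by (auto simp: linear_operator_def)
qed

lemma linear_operatorD:
  assumes "linear_operator D A"
  shows "0 \<in> D" "\<And>x y. x \<in> D \<Longrightarrow> y \<in> D \<Longrightarrow> x + y \<in> D"
    "\<And>x y. x \<in> D \<Longrightarrow> y \<in> D \<Longrightarrow> A (x + y) = A x + A y"
    "\<And>c x. x \<in> D \<Longrightarrow> c *\<^sub>C x \<in> D" "\<And>c x. x \<in> D \<Longrightarrow> A (c *\<^sub>C x) = c *\<^sub>C A x"
    "\<And>r x. x \<in> D \<Longrightarrow> r *\<^sub>R x \<in> D" "\<And>r x. x \<in> D \<Longrightarrow> A (r *\<^sub>R x) = r *\<^sub>R A x"
    "\<And>x. x \<in> D \<Longrightarrow> - x \<in> D" "\<And>x. x \<in> D \<Longrightarrow> A (- x) = - A x"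
    "\<And>x y. x \<in> D \<Longrightarrow> y \<in> D \<Longrightarrow> x - y \<in> D"
    "\<And>x y. x \<in> D \<Longrightarrow> y \<in> D \<Longrightarrow> A (x - y) = A x - A y"
    "A 0 = 0"
proof -
  note l = assms[unfolded linear_operator_def]
  show z: "0 \<in> D" and a: "x \<in> D \<Longrightarrow> y \<in> D \<Longrightarrow> x + y \<in> D"
    and A: "x \<in> D \<Longrightarrow> y \<in> D \<Longrightarrow> A (x + y) = A x + A y"
    and c: "x \<in> D \<Longrightarrow> c *\<^sub>C x \<in> D" and C: "x \<in> D \<Longrightarrow> A (c *\<^sub>C x) = c *\<^sub>C A x" for x y c
    using l by auto
  show "x \<in> D \<Longrightarrow> r *\<^sub>R x \<in> D" and "x \<in> D \<Longrightarrow> A (r *\<^sub>R x) = r *\<^sub>R A x" for r x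
    using c[of x "complex_of_real r"] C[of x "complex_of_real r"] by (simp_all add: scaleC_of_real)
  show m: "x \<in> D \<Longrightarrow> - x \<in> D" and M: "x \<in> D \<Longrightarrow> A (- x) = - A x" for x
    using c[of x "-1"] C[of x "-1"] by (simp_all add: scaleC_minus1)
  show "x \<in> D \<Longrightarrow> y \<in> D \<Longrightarrow> x - y \<in> D" and "x \<in> D \<Longrightarrow> y \<in> D \<Longrightarrow> A (x - y) = A x - A y" for x y
    using a[of x "- y"] A[of x "- y"] m[of y] M[of y] by simp_all
  show "A 0 = 0" using A[OF z z] by simp
qed

lemma subspace_graph:
  assumes "linear_operator D A" shows "subspace {(u, A u) | u. u \<in> D}"
  unfolding subspace_def
  using linear_operatorD[OF assms] by (auto simp: zero_prod_def)

lemma mutual_adjoint_limit: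
  assumes m: "mutual_adjoint D A E B"
    and u: "\<And>n::nat. u n \<in> D" "u \<longlonglongrightarrow> x" "(\<lambda>n. A (u n)) \<longlonglongrightarrow> y"
  shows "x \<in> D" "A x = y"
proof -
  have "cinner (B g) x = cinner g y" if "g \<in> E" for g
  proof (rule LIMSEQ_unique)
    show "(\<lambda>n. cinner (B g) (u n)) \<longlonglongrightarrow> cinner (B g) x" by (intro tendsto_cinner tendsto_const u)
    show "(\<lambda>n. cinner (B g) (u n)) \<longlonglongrightarrow> cinner g y"
      using mutual_adjoint_cinner'[OF m u(1) that] by (simp, intro tendsto_cinner tendsto_const u)
  qed
  then show "x \<in> D" "A x = y" using mutual_adjointD[OF m, of x y] by blast+
qed

lemma mutual_adjoint_closed:
  assumes m: "mutual_adjoint D A E B" shows "closed {(u, A u) | u. u \<in> D}"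
  unfolding closed_sequential_limits
proof (intro allI impI, elim conjE)
  fix p l assume p: "\<forall>n. p n \<in> {(u, A u) |u. u \<in> D}" and l: "p \<longlonglongrightarrow> l"
  have *: "fst (p n) \<in> D" "A (fst (p n)) = snd (p n)" for n using p[rule_format, of n] by auto
  have "(\<lambda>n. fst (p n)) \<longlonglongrightarrow> fst l" "(\<lambda>n. snd (p n)) \<longlonglongrightarrow> snd l" by (intro tendsto_intros l)+
  from mutual_adjoint_limit[OF m *(1) this(1)] this(2) *(2)
  have "fst l \<in> D" "A (fst l) = snd l" by auto
  then show "l \<in> {(u, A u) |u. u \<in> D}" by (auto intro!: exI[of _ "fst l"])
qed

text \<open>A graph is a complex subspace, so real orthogonality to it is complex orthogonality.\<close>

lemma complex_orthogonal_graph: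
  assumes l: "linear_operator D A" and v: "v \<in> D"
    and Re: "\<And>v. v \<in> D \<Longrightarrow> Re (cinner p v + cinner q (A v)) = 0"
  shows "cinner p v + cinner q (A v) = 0"
  using Re[OF v] Re[OF linear_operatorD(4)[OF l v, of \<i>]] linear_operatorD(5)[OF l v, of \<i>]
  by (simp add: cinner_scaleC_right complex_eq_iff)

text \<open>Projecting \<open>(x, h)\<close> orthogonally onto the closed graph of \<open>A\<close>.\<close>

lemma graph_projection:
  fixes D :: "'a::complex_hilbert_space set"
  assumes l: "linear_operator D A" and c: "closed {(u, A u) | u. u \<in> D}"
  obtains u where "u \<in> D" "\<And>v. v \<in> D \<Longrightarrow> cinner (A v) (h - A u) = cinner v (u - x)"
proof -
  obtain u where u: "u \<in> D" and Re: "\<And>v. v \<in> D \<Longrightarrow> Re (cinner (x - u) v + cinner (h - A u) (A v)) = 0"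
    using projection_on_subspace_pair[OF subspace_graph[OF l] c, of x h] by blast
  have "cinner (A v) (h - A u) = cinner v (u - x)" if "v \<in> D" for v
  proof -
    have "cinner (h - A u) (A v) = cinner (u - x) v"
      using complex_orthogonal_graph[OF l that Re] by (simp add: cinner_simps algebra_simps)
    then show ?thesis by (metis cinner_commute)
  qed
  with u that show ?thesis by blast
qed

text \<open>The projection of \<open>(x, 0)\<close> onto the graph solves \<open>(1 + A\<^sup>* A) u = x\<close> (von Neumann).\<close>

lemma mutual_adjoint_solve:
  assumes m: "mutual_adjoint D A E B"
  obtains u where "u \<in> D" "A u \<in> E" "u + B (A u) = x"
proof -
  obtain u where u: "u \<in> D" "\<And>v. v \<in> D \<Longrightarrow> cinner (A v) (0 - A u) = cinner v (u - x)"
    using graph_projection[OF mutual_adjoint_linear[OF m] mutual_adjoint_closed[OF m]] by metis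
  have "cinner (A v) (A u) = cinner v (x - u)" if "v \<in> D" for v
    using u(2)[OF that] by (simp add: cinner_simps) (metis minus_diff_eq minus_equation_iff)
  from mutual_adjointD'[OF m this] u(1) that show ?thesis by (metis add.commute diff_add_cancel)
qed

text \<open>The domain of \<open>A\<^sup>* A\<close> is a core for \<open>A\<close>: a vector \<open>w\<close> whose point of the graph is orthogonal to the
  graph over that domain is orthogonal to all \<open>(1 + A\<^sup>* A) v\<close>, and these fill the space.\<close>

lemma mutual_adjoint_core:
  assumes m: "mutual_adjoint D A E B" and x: "x \<in> D"
  obtains u where "\<And>n::nat. u n \<in> D" "\<And>n. A (u n) \<in> E" "u \<longlonglongrightarrow> x" "(\<lambda>n. A (u n)) \<longlonglongrightarrow> A x"
proof -
  note l = linear_operatorD[OF mutual_adjoint_linear[OF m]]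
  note l' = linear_operatorD[OF mutual_adjoint_linear[OF mutual_adjoint_sym[OF m]]]
  define G0 where "G0 = {(u, A u) | u. u \<in> D \<and> A u \<in> E}"
  have "subspace G0" unfolding subspace_def G0_def using l l' by (auto simp: zero_prod_def)
  then have G: "subspace (closure G0)" by (rule subspace_closure)
  obtain u k where uk: "(u, k) \<in> closure G0"
      "\<forall>(v, l)\<in>closure G0. Re (cinner (x - u) v + cinner (A x - k) l) = 0"
    using projection_on_subspace_pair[OF G closed_closure, of x "A x"] by blast
  have "closure G0 \<subseteq> {(u, A u) | u. u \<in> D}"
    by (intro closure_minimal mutual_adjoint_closed[OF m]) (auto simp: G0_def)
  then have u: "u \<in> D" "k = A u" using uk(1) by auto
  obtain v where v: "v \<in> D" "A v \<in> E" "v + B (A v) = x - u" using mutual_adjoint_solve[OF m] .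
  have "(v, A v) \<in> closure G0" using v closure_subset[of G0] by (auto simp: G0_def)
  then have "Re (cinner (x - u) v + cinner (A x - A u) (A v)) = 0" using uk(2) u(2) by auto
  moreover have "cinner (A x - A u) (A v) = cinner (x - u) (B (A v))"
    using mutual_adjoint_cinner[OF m _ v(2), of "x - u"] x u l by simp
  ultimately have "Re (cinner (x - u) (x - u)) = 0" using v(3) by (metis cinner_add_right)
  then have "u = x" by (simp add: Re_cinner_self)
  then have "(x, A x) \<in> closure G0" using uk(1) u(2) by simp
  then obtain p where p: "\<And>n. p n \<in> G0" "p \<longlonglongrightarrow> (x, A x)"
    unfolding closure_sequential by blast
  have *: "fst (p n) \<in> D \<and> A (fst (p n)) = snd (p n) \<and> snd (p n) \<in> E" for n
    using p(1)[of n] by (auto simp: G0_def)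
  show ?thesis
    using that[of "\<lambda>n. fst (p n)"] * tendsto_fst[OF p(2)] tendsto_snd[OF p(2)] by auto
qed

text \<open>For a closed, densely defined \<open>A\<close> the relation \<open>A\<^sup>*\<^sup>* = A\<close> holds: a pair in the graph of
  \<open>A\<^sup>*\<^sup>*\<close> that is orthogonal to the graph of \<open>A\<close> vanishes.\<close>

lemma mutual_adjoint_adjoint:
  assumes l: "linear_operator D A" and d: "densely_defined D" and c: "closed_operator D A"
  shows "mutual_adjoint D A (adjoint_dom D A) (adjoint_op D A)"
proof -
  define E where "E = adjoint_dom D A"
  define B where "B = adjoint_op D A"
  have B_eqI: "B g = h" if "\<And>f. f \<in> D \<Longrightarrow> cinner (A f) g = cinner f h" for g h
    unfolding B_def adjoint_op_def
  proof (rule the_equality)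
    fix h' assume "\<forall>f\<in>D. cinner (A f) g = cinner f h'"
    then have "cinner (h' - h) f = 0" if "f \<in> D" for f
      using \<open>\<And>f. f \<in> D \<Longrightarrow> cinner (A f) g = cinner f h\<close> that
      by (metis cinner_commute cinner_diff_left eq_iff_diff_eq_0)
    then show "h' = h"
      using zero_if_orthogonal_dense[of D "h' - h"] d by (simp add: densely_defined_def)
  qed (use that in blast)
  have adj: "g \<in> E \<and> B g = h \<longleftrightarrow> (\<forall>f\<in>D. cinner (A f) g = cinner f h)" for g h
  proof
    assume "g \<in> E \<and> B g = h"
    then obtain h' where "\<And>f. f \<in> D \<Longrightarrow> cinner (A f) g = cinner f h'" "B g = h"
      by (auto simp: E_def adjoint_dom_def)
    then show "\<forall>f\<in>D. cinner (A f) g = cinner f h" using B_eqI by blast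
  next
    assume "\<forall>f\<in>D. cinner (A f) g = cinner f h"
    then show "g \<in> E \<and> B g = h" using B_eqI by (auto simp: E_def adjoint_dom_def)
  qed
  have pair: "cinner (B g) f = cinner g (A f)" if "f \<in> D" "g \<in> E" for f g
    using adj[of g "B g"] that by (metis cinner_commute)
  have max: "f \<in> D \<and> A f = h" if h: "\<And>g. g \<in> E \<Longrightarrow> cinner (B g) f = cinner g h" for f h
  proof -
    obtain u where u: "u \<in> D" "\<And>v. v \<in> D \<Longrightarrow> cinner (A v) (h - A u) = cinner v (u - f)"
      using graph_projection[OF l c[unfolded closed_operator_def]] by metis
    then have g: "h - A u \<in> E" "B (h - A u) = u - f" using adj[of "h - A u" "u - f"] by auto
    have "cinner (u - f) (f - u) = cinner (h - A u) (h - A u)"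
      using h[OF g(1)] pair[OF u(1) g(1)] g(2) by (simp add: cinner_diff_right)
    moreover have "cinner (u - f) (f - u) = - cinner (f - u) (f - u)"
      by (metis cinner_minus_left minus_diff_eq)
    ultimately have "Re (- cinner (f - u) (f - u)) = Re (cinner (h - A u) (h - A u))" by metis
    then have "(norm (f - u))\<^sup>2 + (norm (h - A u))\<^sup>2 = 0"
      unfolding Re_cinner_self uminus_complex.sel by linarith
    then show ?thesis using u(1) by (simp add: sum_power2_eq_zero_iff)
  qed
  have "f \<in> D \<and> A f = h \<longleftrightarrow> (\<forall>g\<in>E. cinner (B g) f = cinner g h)" for f h
    using pair max[of f h] by blast
  then show ?thesis using adj unfolding mutual_adjoint_def E_def B_def by blast
qed

text \<open>On \<open>D(A\<^sup>* A) = D(A A\<^sup>*)\<close> normality gives \<open>\<parallel>A x\<parallel> = \<parallel>A\<^sup>* x\<parallel>\<close>, and this domain is a core for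
  \<open>A\<close>; the closedness of \<open>A\<^sup>*\<close> then carries the inclusion over to all of \<open>D(A)\<close>.\<close>

lemma mutual_adjoint_normal_dom:
  assumes m: "mutual_adjoint D A E B"
    and dom: "\<And>x. x \<in> D \<and> A x \<in> E \<longleftrightarrow> x \<in> E \<and> B x \<in> D"
    and comm: "\<And>x. x \<in> D \<Longrightarrow> A x \<in> E \<Longrightarrow> B (A x) = A (B x)"
    and x: "x \<in> D"
  shows "x \<in> E \<and> norm (B x) = norm (A x)"
proof -
  note l = linear_operatorD[OF mutual_adjoint_linear[OF m]]
  note l' = linear_operatorD[OF mutual_adjoint_linear[OF mutual_adjoint_sym[OF m]]]
  have eq: "norm (B v) = norm (A v)" if v: "v \<in> D" "A v \<in> E" for v
  proof -
    have v': "v \<in> E" "B v \<in> D" using dom v by auto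
    have "cinner (A v) (A v) = cinner v (A (B v))"
      using mutual_adjoint_cinner[OF m v(1) v(2)] comm[OF v] by simp
    also have "\<dots> = cinner (B v) (B v)"
      using mutual_adjoint_cinner'[OF m v'(2) v'(1)] by simp
    finally show ?thesis by (simp add: norm_eq_sqrt_cinner)
  qed
  obtain u where u: "\<And>n::nat. u n \<in> D" "\<And>n. A (u n) \<in> E" "u \<longlonglongrightarrow> x" "(\<lambda>n. A (u n)) \<longlonglongrightarrow> A x"
    using mutual_adjoint_core[OF m x] by blast
  have uE: "u n \<in> E" for n using dom u(1,2) by blast
  have dist: "dist (B (u i)) (B (u j)) = dist (A (u i)) (A (u j))" for i j
  proof -
    have "B (u i) - B (u j) = B (u i - u j)" "A (u i) - A (u j) = A (u i - u j)"
      using l l' u(1) uE by simp_all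
    moreover have "norm (B (u i - u j)) = norm (A (u i - u j))"
      using l l' u(1,2) by (intro eq) auto
    ultimately show ?thesis by (simp add: dist_norm)
  qed
  have "Cauchy (\<lambda>n. A (u n))" using u(4) by (rule LIMSEQ_imp_Cauchy)
  then have "Cauchy (\<lambda>n. B (u n))" by (simp add: Cauchy_def dist)
  then obtain y where y: "(\<lambda>n. B (u n)) \<longlonglongrightarrow> y" using Cauchy_convergent_iff convergent_def by blast
  have "x \<in> E" "B x = y" using mutual_adjoint_limit[OF mutual_adjoint_sym[OF m] uE u(3) y] .
  moreover have "norm y = norm (A x)"
    by (rule LIMSEQ_unique[OF tendsto_norm[OF y]]) (use eq u(1,2) tendsto_norm[OF u(4)] in simp)
  ultimately show ?thesis by simp
qed

text \<open>A normal operator \<open>A\<close> together with its adjoint \<open>B\<close>, which has the same domain.\<close>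

locale normal_pair =
  fixes D :: "'a::complex_hilbert_space set" and A B :: "'a \<Rightarrow> 'a"
  assumes adj: "mutual_adjoint D A D B"
    and dom_iff: "x \<in> D \<Longrightarrow> A x \<in> D \<longleftrightarrow> B x \<in> D"
    and AB: "x \<in> D \<Longrightarrow> A x \<in> D \<Longrightarrow> A (B x) = B (A x)"

lemma normal_operator_pair:
  assumes "normal_operator D A"
  shows "normal_pair D A (adjoint_op D A)" "adjoint_dom D A = D"
proof -
  define E where "E = adjoint_dom D A"
  define B where "B = adjoint_op D A"
  note n = assms[unfolded normal_operator_def comp_dom_def, folded E_def B_def]
  have m: "mutual_adjoint D A E B"
    using mutual_adjoint_adjoint n unfolding E_def B_def by blast
  have dom: "x \<in> D \<and> A x \<in> E \<longleftrightarrow> x \<in> E \<and> B x \<in> D" for x using n by blast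
  have comm: "B (A x) = A (B x)" if "x \<in> D" "A x \<in> E" for x using n that by blast
  have "x \<in> E" if "x \<in> D" for x
    using mutual_adjoint_normal_dom[OF m dom comm that] by blast
  moreover have "x \<in> D" if "x \<in> E" for x
    using mutual_adjoint_normal_dom[OF mutual_adjoint_sym[OF m] dom[symmetric] comm[symmetric] that] dom
    by blast
  ultimately have ED: "E = D" by blast
  show "adjoint_dom D A = D" using ED by (simp add: E_def)
  have "normal_pair D A B"
    using m dom comm unfolding ED by unfold_locales auto
  then show "normal_pair D A (adjoint_op D A)" by (simp add: B_def)
qed

context normal_pair
begin

lemmas A_lin = linear_operatorD[OF mutual_adjoint_linear[OF adj]]
lemmas B_lin = linear_operatorD[OF mutual_adjoint_linear[OF mutual_adjoint_sym[OF adj]]]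
lemmas cinner_A = mutual_adjoint_cinner[OF adj]
lemmas cinner_B = mutual_adjoint_cinner'[OF adj]
lemmas in_D_if_A = mutual_adjointD[OF adj]
lemmas in_D_if_B = mutual_adjointD'[OF adj]
lemmas A_limit = mutual_adjoint_limit[OF adj]

lemma norm_B: "x \<in> D \<Longrightarrow> norm (B x) = norm (A x)"
  using mutual_adjoint_normal_dom[OF adj, of x] dom_iff AB by auto

lemma norm_A_minus_scalar:
  assumes "x \<in> D" shows "norm (B x - cnj z *\<^sub>C x) = norm (A x - z *\<^sub>C x)"
proof -
  have "Re (cinner (B x) (cnj z *\<^sub>C x)) = Re (cinner (A x) (z *\<^sub>C x))"
    using cinner_B[OF assms assms] cinner_commute[of x "A x"]
    by (simp add: cinner_simps)
  then have "(norm (B x - cnj z *\<^sub>C x))\<^sup>2 = (norm (A x - z *\<^sub>C x))\<^sup>2"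
    by (simp add: norm_diff_sq norm_B assms norm_scaleC)
  then show ?thesis by (simp add: power2_eq_iff_nonneg)
qed

end

section \<open>Spectral projections of bounded selfadjoint operators\<close>

definition adjoint_pair :: "('a::complex_inner_space \<Rightarrow> 'a) \<Rightarrow> ('a \<Rightarrow> 'a) \<Rightarrow> bool" where
  "adjoint_pair U U' \<longleftrightarrow> (\<forall>x y. cinner (U x) y = cinner x (U' y))"

lemma adjoint_pairD: "adjoint_pair U U' \<Longrightarrow> cinner (U x) y = cinner x (U' y)"
  by (simp add: adjoint_pair_def)

lemma adjoint_pair_sym: "adjoint_pair U U' \<Longrightarrow> adjoint_pair U' U"
  unfolding adjoint_pair_def by (metis cinner_commute)

lemma adjoint_pair_linear:
  assumes "adjoint_pair U U'"
  shows "U (x + y) = U x + U y" "U (x - y) = U x - U y" "U (c *\<^sub>C x) = c *\<^sub>C U x"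
    "U (r *\<^sub>R x) = r *\<^sub>R U x" "U (- x) = - U x" "U 0 = 0"
proof -
  note [simp] = adjoint_pairD[OF assms] cinner_simps
  show "U (x + y) = U x + U y" "U (x - y) = U x - U y" "U (c *\<^sub>C x) = c *\<^sub>C U x"
    "U (r *\<^sub>R x) = r *\<^sub>R U x" "U (- x) = - U x" "U 0 = 0"
    by (rule eq_if_cinner_eq; simp)+
qed

lemma adjoint_pair_compose:
  "adjoint_pair U U' \<Longrightarrow> adjoint_pair V V' \<Longrightarrow> adjoint_pair (\<lambda>x. U (V x)) (\<lambda>x. V' (U' x))"
  by (simp add: adjoint_pair_def)

lemma adjoint_pair_limit:
  assumes "\<And>n. adjoint_pair (Y n) (Y n)" and "\<And>x. (\<lambda>n::nat. Y n x) \<longlonglongrightarrow> Z x"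
  shows "adjoint_pair Z Z"
  unfolding adjoint_pair_def
proof (intro allI)
  fix x y
  have "(\<lambda>n. cinner (Y n x) y) \<longlonglongrightarrow> cinner (Z x) y" "(\<lambda>n. cinner x (Y n y)) \<longlonglongrightarrow> cinner x (Z y)"
    by (intro tendsto_cinner tendsto_const assms)+
  then show "cinner (Z x) y = cinner x (Z y)"
    unfolding adjoint_pairD[OF assms(1)] by (rule LIMSEQ_unique)
qed

text \<open>Evaluating the nonnegative form of \<open>K\<close> at \<open>x - K x / m\<close> is Cauchy--Schwarz for that form.\<close>

lemma norm_le_if_form_le:
  assumes K: "adjoint_pair K K" and m: "0 < m"
    and form: "\<And>x. 0 \<le> Re (cinner (K x) x)" "\<And>x. Re (cinner (K x) x) \<le> m * (norm x)\<^sup>2"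
  shows "norm (K x) \<le> m * norm x"
proof -
  note lin = adjoint_pair_linear[OF K]
  define s where "s = 1 / m"
  have sm: "s * m = 1" and s: "0 < s" using m by (simp_all add: s_def)
  have "0 \<le> Re (cinner (K (x - s *\<^sub>R K x)) (x - s *\<^sub>R K x))" by (rule form)
  also have "\<dots> = Re (cinner (K x) x) - 2 * s * (norm (K x))\<^sup>2 + s\<^sup>2 * Re (cinner (K (K x)) (K x))"
    using adjoint_pairD[OF K, of "K x" x]
    by (simp add: lin cinner_simps cinner_self power2_eq_square algebra_simps)
  also have "\<dots> \<le> m * (norm x)\<^sup>2 - 2 * s * (norm (K x))\<^sup>2 + s\<^sup>2 * (m * (norm (K x))\<^sup>2)"
    using form(2)[of x] form(2)[of "K x"] s by (intro add_mono diff_mono mult_left_mono) auto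
  also have "s\<^sup>2 * (m * (norm (K x))\<^sup>2) = s * (norm (K x))\<^sup>2"
    using sm by (simp add: power2_eq_square algebra_simps)
  finally have "s * (norm (K x))\<^sup>2 \<le> m * (norm x)\<^sup>2" by simp
  then have "m * (s * (norm (K x))\<^sup>2) \<le> m * (m * (norm x)\<^sup>2)" using m by (intro mult_left_mono) auto
  moreover have "m * (s * (norm (K x))\<^sup>2) = (norm (K x))\<^sup>2" using m by (simp add: s_def)
  ultimately have "(norm (K x))\<^sup>2 \<le> m * (m * (norm x)\<^sup>2)" by metis
  then have "(norm (K x))\<^sup>2 \<le> (m * norm x)\<^sup>2"
    by (simp add: power2_eq_square algebra_simps)
  then show ?thesis by (rule power2_le_imp_le) (use m in auto)
qed

text \<open>The absolute value \<open>|H| = (H\<^sup>2)\<^bsup>1/2\<^esup>\<close> of a selfadjoint contraction.  With \<open>C = 1 - H\<^sup>2\<close> the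
  operator \<open>Y = 1 - |H|\<close> is the fixed point of \<open>Y \<mapsto> (C + Y\<^sup>2) / 2\<close>.  The same iteration on numbers,
  \<open>y \<mapsto> (1 + y\<^sup>2) / 2\<close>, majorises it in norm and increases to \<open>1\<close>, so that the operator iteration
  converges, and everything commuting with \<open>H\<close> commutes with the limit.\<close>

lemma abs_operator_exists:
  fixes H :: "'a::complex_hilbert_space \<Rightarrow> 'a"
  assumes H: "adjoint_pair H H" and contr: "\<And>x. norm (H x) \<le> norm x"
  obtains R where "adjoint_pair R R" "\<And>x. 0 \<le> Re (cinner (R x) x)" "\<And>x. R (R x) = H (H x)"
    "\<And>U U' x. adjoint_pair U U' \<Longrightarrow> (\<And>x. U (H x) = H (U x)) \<Longrightarrow> U (R x) = R (U x)"
proof -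
  define C where "C x = x - H (H x)" for x
  define Y where "Y = rec_nat (\<lambda>x. 0) (\<lambda>_ Z x. (1/2) *\<^sub>R (C x + Z (Z x)))"
  define y where "y = rec_nat (0::real) (\<lambda>_ z. (1 + z\<^sup>2) / 2)"
  have Y0: "Y 0 x = 0" and YS: "Y (Suc n) x = (1/2) *\<^sub>R (C x + Y n (Y n x))" for n x
    by (simp_all add: Y_def)
  have y0: "y 0 = 0" and yS: "y (Suc n) = (1 + (y n)\<^sup>2) / 2" for n by (simp_all add: y_def)
  have y01: "0 \<le> y n \<and> y n \<le> 1" for n
    by (induction n) (auto simp: y0 yS power_le_one)
  have yinc: "y n \<le> y (Suc n)" for n
    using zero_le_power2[of "1 - y n"] by (simp add: yS power2_diff)
  have sa: "adjoint_pair (Y n) (Y n)" for n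
  proof (induction n)
    case (Suc n)
    then show ?case
      using H by (auto simp: adjoint_pair_def YS C_def cinner_simps)
  qed (simp add: adjoint_pair_def Y0)
  have comm: "U (Y n x) = Y n (U x)"
    if U: "adjoint_pair U U'" and UH: "\<And>x. U (H x) = H (U x)" for U U' n x
  proof (induction n arbitrary: x)
    case (Suc n)
    show ?case unfolding YS using adjoint_pair_linear[OF U] by (simp add: C_def UH Suc)
  qed (simp add: Y0 adjoint_pair_linear[OF U])
  have Cle: "norm (C x) \<le> norm x" for x
  proof -
    have "(norm (C x))\<^sup>2 = (norm x)\<^sup>2 - 2 * (norm (H x))\<^sup>2 + (norm (H (H x)))\<^sup>2"
      unfolding C_def norm_diff_sq adjoint_pairD[OF H, of x "H x", symmetric] Re_cinner_self ..
    also have "(norm (H (H x)))\<^sup>2 \<le> (norm (H x))\<^sup>2" using contr by (intro power_mono) auto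
    finally have "(norm (C x))\<^sup>2 \<le> (norm x)\<^sup>2" using zero_le_power2[of "norm (H x)"] by linarith
    then show ?thesis by (rule power2_le_imp_le) auto
  qed
  have Yle: "norm (Y n x) \<le> y n * norm x" for n x
  proof (induction n arbitrary: x)
    case (Suc n)
    have "norm (Y n (Y n x)) \<le> y n * (y n * norm x)"
      using Suc[of "Y n x"] Suc[of x] y01[of n] by (meson mult_left_mono order_trans)
    then have "norm (C x + Y n (Y n x)) \<le> norm x + y n * (y n * norm x)"
      using Cle[of x] norm_triangle_ineq[of "C x" "Y n (Y n x)"] by linarith
    moreover have "norm (Y (Suc n) x) = norm (C x + Y n (Y n x)) / 2" unfolding YS by simp
    ultimately show ?case by (simp add: yS power2_eq_square algebra_simps)
  qed (simp add: Y0 y0)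
  have step: "norm (Y (Suc n) x - Y n x) \<le> (y (Suc n) - y n) * norm x" for n x
  proof (induction n arbitrary: x)
    case 0
    show ?case using Cle[of x] by (simp add: YS Y0 yS y0)
  next
    case (Suc n)
    let ?a = "Y (Suc n)" and ?b = "Y n" and ?d = "y (Suc n) - y n"
    have d: "0 \<le> ?d" using yinc by simp
    have "Y (Suc (Suc n)) x - Y (Suc n) x = (1/2) *\<^sub>R (?a (?a x) - ?b (?b x))"
      unfolding YS[of "Suc n" x] YS[of n x] by (simp add: algebra_simps)
    also have "?a (?a x) - ?b (?b x) = ?a (?a x - ?b x) + (?a (?b x) - ?b (?b x))"
      using adjoint_pair_linear[OF sa] by simp
    finally have "norm (Y (Suc (Suc n)) x - Y (Suc n) x)
        \<le> (norm (?a (?a x - ?b x)) + norm (?a (?b x) - ?b (?b x))) / 2"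
      using norm_triangle_ineq[of "?a (?a x - ?b x)" "?a (?b x) - ?b (?b x)"] by simp
    also have "norm (?a (?a x - ?b x)) \<le> y (Suc n) * (?d * norm x)"
      using Yle[of "Suc n" "?a x - ?b x"] Suc[of x] y01[of "Suc n"] by (meson mult_left_mono order_trans)
    also have "norm (?a (?b x) - ?b (?b x)) \<le> ?d * (y n * norm x)"
      using Suc[of "?b x"] Yle[of n x] d by (meson mult_left_mono order_trans)
    also have "(y (Suc n) * (?d * norm x) + ?d * (y n * norm x)) / 2
        = ((y (Suc n))\<^sup>2 - (y n)\<^sup>2) / 2 * norm x"
      by (simp add: power2_eq_square algebra_simps)
    also have "((y (Suc n))\<^sup>2 - (y n)\<^sup>2) / 2 = y (Suc (Suc n)) - y (Suc n)"
      unfolding yS[of "Suc n"] by (subst (3) yS) (simp add: field_simps)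
    finally show ?case by (simp add: divide_right_mono)
  qed
  have far: "norm (Y (n + k) x - Y n x) \<le> (y (n + k) - y n) * norm x" for n k x
  proof (induction k)
    case (Suc k)
    have "norm (Y (Suc (n + k)) x - Y n x)
        \<le> norm (Y (Suc (n + k)) x - Y (n + k) x) + norm (Y (n + k) x - Y n x)"
      using norm_triangle_ineq[of "Y (Suc (n + k)) x - Y (n + k) x" "Y (n + k) x - Y n x"] by simp
    then show ?case using Suc step[of "n + k" x] by (simp add: algebra_simps)
  qed simp
  have "convergent y"
    using y01 yinc
    by (intro Bseq_monoseq_convergent BseqI'[where K = 1] incseq_imp_monoseq incseq_SucI) auto
  then have cy: "Cauchy y" by (simp add: Cauchy_convergent_iff)
  have "Cauchy (\<lambda>n. Y n x)" for x
  proof (rule metric_CauchyI)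
    fix e :: real assume e: "0 < e"
    then have "0 < e / (norm x + 1)" by (simp add: add_nonneg_pos)
    then obtain N where N: "\<And>m n. m \<ge> N \<Longrightarrow> n \<ge> N \<Longrightarrow> dist (y m) (y n) < e / (norm x + 1)"
      using metric_CauchyD[OF cy] by blast
    have *: "norm (Y m x - Y n x) < e" if "N \<le> n" "n \<le> m" for m n
    proof -
      have "norm (Y m x - Y n x) \<le> (y m - y n) * norm x"
        using far[of n "m - n" x] that(2) by simp
      also have "\<dots> \<le> dist (y m) (y n) * (norm x + 1)"
        by (intro mult_mono) (auto simp: dist_real_def)
      also have "\<dots> < e"
        using N[of m n] that by (simp add: pos_less_divide_eq add_nonneg_pos)
      finally show ?thesis .
    qed
    have "dist (Y m x) (Y n x) < e" if "m \<ge> N" "n \<ge> N" for m n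
      using *[of n m] *[of m n] that by (cases "n \<le> m") (auto simp: dist_norm norm_minus_commute)
    then show "\<exists>N. \<forall>m\<ge>N. \<forall>n\<ge>N. dist (Y m x) (Y n x) < e" by blast
  qed
  then have "\<exists>l. (\<lambda>n. Y n x) \<longlonglongrightarrow> l" for x using Cauchy_convergent_iff convergent_def by blast
  then obtain Z where Z: "\<And>x. (\<lambda>n. Y n x) \<longlonglongrightarrow> Z x" by metis
  have Ycontr: "norm (Y n x) \<le> norm x" for n x
    using Yle[of n x] mult_right_mono[of "y n" 1 "norm x"] y01[of n] by auto
  have saZ: "adjoint_pair Z Z" by (rule adjoint_pair_limit[OF sa Z])
  have Zle: "norm (Z x) \<le> norm x" for x
    by (rule LIMSEQ_le_const2[OF tendsto_norm[OF Z]]) (use Ycontr in blast)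
  have YY: "(\<lambda>n. Y n (Y n x)) \<longlonglongrightarrow> Z (Z x)" for x
  proof -
    have "(\<lambda>n. Y n (Y n x - Z x)) \<longlonglongrightarrow> 0"
      by (rule tendsto_0_le[where K = 1, OF LIM_zero[OF Z[of x]]]) (use Ycontr in auto)
    from tendsto_add[OF this Z[of "Z x"]] show ?thesis
      by (simp add: adjoint_pair_linear(2)[OF sa])
  qed
  have fixpt: "Z x = (1/2) *\<^sub>R (C x + Z (Z x))" for x
  proof (rule LIMSEQ_unique)
    show "(\<lambda>n. Y (Suc n) x) \<longlonglongrightarrow> Z x" by (rule LIMSEQ_Suc[OF Z])
    show "(\<lambda>n. Y (Suc n) x) \<longlonglongrightarrow> (1/2) *\<^sub>R (C x + Z (Z x))"
      unfolding YS by (intro tendsto_intros YY)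
  qed
  note linZ = adjoint_pair_linear[OF saZ]
  have commZ: "U (Z x) = Z (U x)"
    if U: "adjoint_pair U U'" and UH: "\<And>x. U (H x) = H (U x)" for U U' x
  proof (rule eq_if_cinner_eq)
    fix g
    show "cinner (U (Z x)) g = cinner (Z (U x)) g"
    proof (rule LIMSEQ_unique)
      show "(\<lambda>n. cinner (Y n (U x)) g) \<longlonglongrightarrow> cinner (Z (U x)) g"
        by (intro tendsto_cinner tendsto_const Z)
      have "(\<lambda>n. cinner (Y n x) (U' g)) \<longlonglongrightarrow> cinner (Z x) (U' g)"
        by (intro tendsto_cinner tendsto_const Z)
      then show "(\<lambda>n. cinner (Y n (U x)) g) \<longlonglongrightarrow> cinner (U (Z x)) g"
        by (simp add: adjoint_pairD[OF U] flip: comm[OF U UH])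
    qed
  qed
  show ?thesis
  proof (rule that[of "\<lambda>x. x - Z x"])
    show "adjoint_pair (\<lambda>x. x - Z x) (\<lambda>x. x - Z x)"
      using saZ by (simp add: adjoint_pair_def cinner_simps)
    show "0 \<le> Re (cinner (x - Z x) x)" for x
    proof -
      have "Re (cinner (Z x) x) \<le> norm (Z x) * norm x" by (rule Re_cinner_le)
      also have "\<dots> \<le> (norm x)\<^sup>2" using Zle[of x] by (simp add: power2_eq_square mult_right_mono)
      finally show ?thesis by (simp add: cinner_simps Re_cinner_self)
    qed
    show "x - Z x - Z (x - Z x) = H (H x)" for x
    proof -
      have "2 *\<^sub>R Z x = C x + Z (Z x)" by (subst fixpt) simp
      then have "Z x + Z x = x - H (H x) + Z (Z x)" by (simp add: C_def scaleR_2)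
      then show ?thesis by (simp add: linZ algebra_simps)
    qed
    show "U (x - Z x) = U x - Z (U x)"
      if "adjoint_pair U U'" "\<And>x. U (H x) = H (U x)" for U U' x
      using commZ[OF that] adjoint_pair_linear(2)[OF that(1)] by simp
  qed
qed

definition is_proj :: "('a::complex_inner_space \<Rightarrow> 'a) \<Rightarrow> bool" where
  "is_proj P \<longleftrightarrow> adjoint_pair P P \<and> (\<forall>x. P (P x) = P x)"

lemma is_projD: "is_proj P \<Longrightarrow> adjoint_pair P P" "is_proj P \<Longrightarrow> P (P x) = P x"
  by (simp_all add: is_proj_def)

lemmas is_proj_linear = adjoint_pair_linear[OF is_projD(1)]

lemma norm_proj_le: "is_proj P \<Longrightarrow> norm (P x) \<le> norm x"
proof -
  assume P: "is_proj P"
  have "(norm (P x))\<^sup>2 = Re (cinner x (P x))"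
    using adjoint_pairD[OF is_projD(1)[OF P], of x "P x"] is_projD(2)[OF P]
    by (simp flip: Re_cinner_self)
  also have "\<dots> \<le> norm x * norm (P x)" by (rule Re_cinner_le)
  finally show ?thesis by (cases "P x = 0") (simp_all add: power2_eq_square)
qed

lemma bounded_linear_proj: "is_proj P \<Longrightarrow> bounded_linear P"
  by (rule bounded_linear_intro[where K = 1]) (simp_all add: is_proj_linear norm_proj_le)

text \<open>If \<open>U\<close> commutes with the selfadjoint \<open>K\<close>, then so does \<open>U\<^sup>*\<close>, so that \<open>ker K\<close> reduces \<open>U\<close>.\<close>

lemma kernel_projection:
  fixes K :: "'a::complex_hilbert_space \<Rightarrow> 'a"
  assumes K: "adjoint_pair K K"
  obtains P where "is_proj P" "\<And>x. K (P x) = 0" "\<And>x. K x = 0 \<Longrightarrow> P x = x"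
    "\<And>U U' x. adjoint_pair U U' \<Longrightarrow> (\<And>x. U (K x) = K (U x)) \<Longrightarrow> U (P x) = P (U x)"
proof -
  note lin = adjoint_pair_linear[OF K]
  define G where "G = {x. K x = 0}"
  have "K x = 0 \<longleftrightarrow> (\<forall>y. cinner x (K y) = 0)" for x
    using eq_if_cinner_eq[of "K x" 0] adjoint_pairD[OF K, of x] by auto
  then have "G = (\<Inter>y. {x. cinner x (K y) = 0})" by (auto simp: G_def)
  then have clG: "closed G"
    by (simp add: closed_INT closed_Collect_eq continuous_on_cinner)
  moreover have "subspace G" by (auto simp: subspace_def G_def lin)
  ultimately have "\<exists>g\<in>G. \<forall>v\<in>G. cinner (p - g) v = 0" for p
    by (intro projection_on_subspace) (auto simp: G_def lin)
  then have "\<forall>p. \<exists>g. K g = 0 \<and> (\<forall>v. K v = 0 \<longrightarrow> cinner (p - g) v = 0)" by (auto simp: G_def)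
  from choice[OF this] obtain P where P: "\<And>p. K (P p) = 0" "\<And>p v. K v = 0 \<Longrightarrow> cinner (p - P p) v = 0"
    by blast
  have id: "P x = x" if "K x = 0" for x
  proof -
    have "cinner (x - P x) (x - P x) = 0" using P that by (simp add: lin)
    then show ?thesis using Re_cinner_self[of "x - P x"] by simp
  qed
  have "cinner (P x) y = cinner (P x) (P y)" "cinner x (P y) = cinner (P x) (P y)" for x y
  proof -
    show "cinner x (P y) = cinner (P x) (P y)" using P(2)[OF P(1)[of y], of x] by (simp add: cinner_simps)
    have "cinner y (P x) = cinner (P y) (P x)" using P(2)[OF P(1)[of x], of y] by (simp add: cinner_simps)
    then show "cinner (P x) y = cinner (P x) (P y)" by (metis cinner_commute)
  qed
  then have sa: "adjoint_pair P P" by (simp add: adjoint_pair_def)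
  then have proj: "is_proj P" using id P(1) by (simp add: is_proj_def)
  have "U (P x) = P (U x)" if U: "adjoint_pair U U'" and UK: "\<And>x. U (K x) = K (U x)" for U U' x
  proof -
    have "cinner (U' (K x)) y = cinner (K (U' x)) y" for x y
      using adjoint_pairD[OF adjoint_pair_sym[OF U]] adjoint_pairD[OF K] UK by metis
    then have U'K: "U' (K x) = K (U' x)" for x by (rule eq_if_cinner_eq)
    have inv: "P (U (P x)) = U (P x)" "P (U' (P x)) = U' (P x)" for x
      using id[of "U (P x)"] id[of "U' (P x)"] UK[of "P x"] U'K[of "P x"] P(1)
        adjoint_pair_linear(6)[OF U] adjoint_pair_linear(6)[OF adjoint_pair_sym[OF U]] by auto
    show ?thesis
    proof (rule eq_if_cinner_eq)
      fix y
      have "cinner (P (U x)) y = cinner x (U' (P y))"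
        by (simp add: adjoint_pairD[OF sa] adjoint_pairD[OF U])
      also have "\<dots> = cinner x (P (U' (P y)))" by (simp add: inv)
      also have "\<dots> = cinner (P (U (P x))) y"
        by (simp add: adjoint_pairD[OF U] adjoint_pairD[OF sa])
      finally show "cinner (U (P x)) y = cinner (P (U x)) y" by (simp add: inv)
    qed
  qed
  then show ?thesis using that proj P(1) id by blast
qed

text \<open>The spectral projection of \<open>H\<close> for \<open>(-\<infinity>, c]\<close>: with \<open>F\<close> a multiple of \<open>H - c\<close> that is a
  contraction, it projects onto the kernel of
  twice the positive part, \<open>|F| + F\<close>.  On that kernel \<open>F = - |F|\<close>; since \<open>(|F| + F) (|F| - F) = 0\<close>, its
  complement is annihilated by \<open>|F| - F\<close>.\<close>

lemma spectral_projection_exists: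
  fixes H :: "'a::complex_hilbert_space \<Rightarrow> 'a" and c :: real
  assumes H: "adjoint_pair H H" and bd: "\<And>x. norm (H x) \<le> L * norm x"
  obtains P where "is_proj P" "\<And>x. P x = x \<Longrightarrow> Re (cinner (H x) x) \<le> c * (norm x)\<^sup>2"
    "\<And>x. P x = 0 \<Longrightarrow> Re (cinner (H x) x) \<ge> c * (norm x)\<^sup>2"
    "\<And>U U' x. adjoint_pair U U' \<Longrightarrow> (\<And>x. U (H x) = H (U x)) \<Longrightarrow> U (P x) = P (U x)"
proof -
  define M where "M = \<bar>L\<bar> + \<bar>c\<bar> + 1"
  have M: "0 < M" by (simp add: M_def)
  define F where "F x = (1 / M) *\<^sub>R (H x - c *\<^sub>R x)" for x
  have sF: "adjoint_pair F F"
    using H by (simp add: adjoint_pair_def F_def cinner_simps)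
  have "norm (F x) \<le> norm x" for x
  proof -
    have "norm (H x) \<le> \<bar>L\<bar> * norm x" using bd[of x] by (meson abs_ge_self mult_right_mono norm_ge_zero order_trans)
    then have "norm (H x - c *\<^sub>R x) \<le> \<bar>L\<bar> * norm x + \<bar>c\<bar> * norm x"
      using norm_triangle_ineq4[of "H x" "c *\<^sub>R x"] by simp
    also have "\<dots> \<le> M * norm x" by (simp add: M_def algebra_simps)
    finally show ?thesis using M by (simp add: F_def pos_divide_le_eq mult.commute)
  qed
  then obtain R where R: "adjoint_pair R R" "\<And>x. 0 \<le> Re (cinner (R x) x)" "\<And>x. R (R x) = F (F x)"
    "\<And>U U' x. adjoint_pair U U' \<Longrightarrow> (\<And>x. U (F x) = F (U x)) \<Longrightarrow> U (R x) = R (U x)"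
    using abs_operator_exists[OF sF] by blast
  note linR = adjoint_pair_linear[OF R(1)] and linF = adjoint_pair_linear[OF sF]
  have FR: "F (R x) = R (F x)" for x using R(4)[OF sF] by blast
  define K where "K x = R x + F x" for x
  have sK: "adjoint_pair K K" using R(1) sF by (simp add: adjoint_pair_def K_def cinner_simps)
  obtain P where P: "is_proj P" "\<And>x. K (P x) = 0" "\<And>x. K x = 0 \<Longrightarrow> P x = x"
    "\<And>U U' x. adjoint_pair U U' \<Longrightarrow> (\<And>x. U (K x) = K (U x)) \<Longrightarrow> U (P x) = P (U x)"
    using kernel_projection[OF sK] by blast
  have HF: "Re (cinner (H x) x) = M * Re (cinner (F x) x) + c * (norm x)\<^sup>2" for x
    using M by (simp add: F_def cinner_simps Re_cinner_self)
  show ?thesis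
  proof (rule that[OF P(1)])
    fix x assume "P x = x"
    then have "F x = - R x" using P(2)[of x] by (simp add: K_def add_eq_0_iff)
    then have "Re (cinner (F x) x) \<le> 0" using R(2)[of x] by (simp add: cinner_simps)
    then show "Re (cinner (H x) x) \<le> c * (norm x)\<^sup>2"
      using M mult_nonneg_nonpos[of M "Re (cinner (F x) x)"] by (simp add: HF)
  next
    fix x assume x: "P x = 0"
    have "cinner (R x - F x) y = 0" for y
    proof -
      have "K (R y - F y) = 0" by (simp add: K_def linR linF R(3) FR)
      then have "P (R y - F y) = R y - F y" by (rule P(3))
      then have "cinner x (R y - F y) = cinner (P x) (R y - F y)"
        by (metis adjoint_pairD[OF is_projD(1)[OF P(1)]])
      then have "cinner x (R y - F y) = 0" using x by simp
      then show ?thesis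
        by (simp add: cinner_simps adjoint_pairD[OF R(1)] adjoint_pairD[OF sF])
    qed
    then have "R x - F x = 0" using eq_if_cinner_eq[of "R x - F x" 0] by simp
    then have "0 \<le> Re (cinner (F x) x)" using R(2)[of x] by simp
    then show "Re (cinner (H x) x) \<ge> c * (norm x)\<^sup>2" using M by (simp add: HF)
  next
    fix U U' x assume U: "adjoint_pair U U'" and UH: "\<And>x. U (H x) = H (U x)"
    note linU = adjoint_pair_linear[OF U]
    have UF: "U (F x) = F (U x)" for x by (simp add: F_def linU UH)
    then have "U (K x) = K (U x)" for x using R(4)[OF U UF] by (simp add: K_def linU)
    then show "U (P x) = P (U x)" by (rule P(4)[OF U])
  qed
qed

section \<open>Resolutions of the identity\<close>

text \<open>Completeness is expressed by a trivial common kernel rather than by convergence of the sums: in this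
  form it is inherited by refinements at once, and convergence is a consequence.\<close>

definition resolution :: "(nat \<Rightarrow> 'a::complex_hilbert_space \<Rightarrow> 'a) \<Rightarrow> bool" where
  "resolution P \<longleftrightarrow> (\<forall>k. is_proj (P k)) \<and> (\<forall>i j x. i \<noteq> j \<longrightarrow> P i (P j x) = 0) \<and>
     (\<forall>x. (\<forall>k. P k x = 0) \<longrightarrow> x = 0)"

lemma resolutionD:
  assumes "resolution P"
  shows "is_proj (P k)" "i \<noteq> j \<Longrightarrow> P i (P j x) = 0" "(\<And>k. P k x = 0) \<Longrightarrow> x = 0"
  using assms by (auto simp: resolution_def)

lemma resolution_cinner:
  "resolution P \<Longrightarrow> i \<noteq> j \<Longrightarrow> cinner (P i x) (P j y) = 0"
  using resolutionD(2)[of P i j y] adjoint_pairD[OF is_projD(1)[OF resolutionD(1)[of P i]], of x "P j y"]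
  by simp

lemma norm_sum_orthogonal:
  fixes f :: "'i \<Rightarrow> 'a::complex_inner_space"
  assumes "finite S" "\<And>i j. i \<in> S \<Longrightarrow> j \<in> S \<Longrightarrow> i \<noteq> j \<Longrightarrow> cinner (f i) (f j) = 0"
  shows "(norm (\<Sum>i\<in>S. f i))\<^sup>2 = (\<Sum>i\<in>S. (norm (f i))\<^sup>2)"
  using assms
proof (induction S rule: finite_induct)
  case (insert i S)
  have "cinner (\<Sum>j\<in>S. f j) (f i) = (\<Sum>j\<in>S. cinner (f j) (f i))" by (rule cinner_sum_left)
  also have "\<dots> = 0" using insert by (intro sum.neutral) auto
  finally have "Re (cinner (f i) (\<Sum>j\<in>S. f j)) = 0" by (metis Re_cinner_commute zero_complex.sel(1))
  then show ?case using insert by (simp add: norm_add_sq)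
qed simp

lemma norm_resolution_sum:
  "resolution P \<Longrightarrow> finite S \<Longrightarrow> (norm (\<Sum>k\<in>S. P k x))\<^sup>2 = (\<Sum>k\<in>S. (norm (P k x))\<^sup>2)"
  by (rule norm_sum_orthogonal) (auto intro: resolution_cinner)

lemma resolution_sum_component:
  assumes P: "resolution P" and "finite S"
  shows "P k (\<Sum>j\<in>S. P j x) = (if k \<in> S then P k x else 0)"
proof -
  have "P k (\<Sum>j\<in>S. P j x) = (\<Sum>j\<in>S. P k (P j x))"
    using bounded_linear_proj[OF resolutionD(1)[OF P]] by (rule bounded_linear.linear[THEN linear_sum])
  also have "\<dots> = (\<Sum>j\<in>S. if j = k then P k x else 0)"
    using resolutionD(2)[OF P] is_projD(2)[OF resolutionD(1)[OF P]] by (intro sum.cong) auto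
  finally show ?thesis using assms(2) by simp
qed

lemma is_proj_resolution_sum:
  assumes P: "resolution P" and S: "finite S" shows "is_proj (\<lambda>x. \<Sum>k\<in>S. P k x)"
proof -
  have "cinner (\<Sum>k\<in>S. P k x) y = cinner x (\<Sum>k\<in>S. P k y)" for x y
  proof -
    have "cinner (\<Sum>k\<in>S. P k x) y = (\<Sum>k\<in>S. cinner x (P k y))"
      by (simp add: cinner_sum_left adjoint_pairD[OF is_projD(1)[OF resolutionD(1)[OF P]]])
    also have "\<dots> = cnj (cinner (\<Sum>k\<in>S. P k y) x)"
      by (simp add: cinner_sum_left) (metis cinner_commute)
    finally show ?thesis by (metis cinner_commute)
  qed
  then show ?thesis
    by (simp add: is_proj_def adjoint_pair_def resolution_sum_component[OF P S])
qed

text \<open>By Pythagoras the increments of the partial sums are controlled by those of the bounded, increasing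
  sums of squares.\<close>

lemma orthogonal_series_convergent:
  fixes f :: "nat \<Rightarrow> 'a::complex_hilbert_space"
  assumes orth: "\<And>i j. i \<noteq> j \<Longrightarrow> cinner (f i) (f j) = 0"
    and bound: "\<And>n. (\<Sum>k<n. (norm (f k))\<^sup>2) \<le> M"
  obtains s where "(\<lambda>n. \<Sum>k<n. f k) \<longlonglongrightarrow> s"
proof -
  define F where "F n = (\<Sum>k<n. f k)" for n
  define q where "q n = (\<Sum>k<n. (norm (f k))\<^sup>2)" for n
  have "0 \<le> q n" for n by (simp add: q_def sum_nonneg)
  then have "convergent q"
    by (intro Bseq_monoseq_convergent BseqI'[where K = M] incseq_imp_monoseq incseq_SucI)
       (use bound in \<open>auto simp: q_def\<close>)
  then have cq: "Cauchy q" by (simp add: Cauchy_convergent_iff)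
  have d: "(norm (F m - F n))\<^sup>2 = q m - q n" if "n \<le> m" for m n
  proof -
    have s: "{..<m} = {..<n} \<union> {n..<m}" using that by auto
    have "F m - F n = (\<Sum>k\<in>{n..<m}. f k)" unfolding F_def s by (subst sum.union_disjoint) auto
    moreover have "q m - q n = (\<Sum>k\<in>{n..<m}. (norm (f k))\<^sup>2)"
      unfolding q_def s by (subst sum.union_disjoint) auto
    ultimately show ?thesis by (simp add: norm_sum_orthogonal orth)
  qed
  have "Cauchy F"
  proof (rule metric_CauchyI)
    fix e :: real assume e: "0 < e"
    then obtain N where N: "\<And>m n. m \<ge> N \<Longrightarrow> n \<ge> N \<Longrightarrow> dist (q m) (q n) < e\<^sup>2"
      using metric_CauchyD[OF cq, of "e\<^sup>2"] by auto
    have *: "dist (F m) (F n) < e" if "N \<le> n" "n \<le> m" for m n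
    proof -
      have "(norm (F m - F n))\<^sup>2 < e\<^sup>2" using N[of m n] that d[of n m] by (simp add: dist_real_def)
      then show ?thesis using e by (simp add: dist_norm power_less_imp_less_base)
    qed
    then have "dist (F m) (F n) < e" if "m \<ge> N" "n \<ge> N" for m n
      using that *[of n m] *[of m n] by (cases "n \<le> m") (auto simp: dist_commute)
    then show "\<exists>N. \<forall>m\<ge>N. \<forall>n\<ge>N. dist (F m) (F n) < e" by blast
  qed
  then obtain s where "F \<longlonglongrightarrow> s" using Cauchy_convergent_iff convergent_def by blast
  then show ?thesis using that by (simp add: F_def[abs_def])
qed

lemma bessel:
  assumes P: "resolution P" shows "(\<Sum>k<n. (norm (P k x))\<^sup>2) \<le> (norm x)\<^sup>2"
  using norm_proj_le[OF is_proj_resolution_sum[OF P, of "{..<n}"], of x]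
  by (simp flip: norm_resolution_sum[OF P])

text \<open>The partial sums converge by Bessel's inequality, and the components of the limit are those of \<open>x\<close>.\<close>

lemma resolution_sums:
  fixes P :: "nat \<Rightarrow> 'a::complex_hilbert_space \<Rightarrow> 'a"
  assumes P: "resolution P" shows "(\<lambda>n. \<Sum>k<n. P k x) \<longlonglongrightarrow> x"
proof -
  define F where "F n = (\<Sum>k<n. P k x)" for n
  obtain u where u: "F \<longlonglongrightarrow> u"
    using orthogonal_series_convergent[of "\<lambda>k. P k x", OF resolution_cinner[OF P] bessel[OF P]]
    by (auto simp: F_def[abs_def])
  have "P k (x - u) = 0" for k
  proof -
    have "(\<lambda>n. P k (F n)) \<longlonglongrightarrow> P k u"
      using u bounded_linear_proj[OF resolutionD(1)[OF P]] by (metis bounded_linear.tendsto)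
    moreover have "P k (F n) = P k x" if "n > k" for n
      using that by (simp add: F_def resolution_sum_component[OF P])
    then have "(\<lambda>n. P k (F n)) \<longlonglongrightarrow> P k x"
      by (intro tendsto_eventually eventually_mono[OF eventually_gt_at_top[of k]]) auto
    ultimately show ?thesis
      using LIMSEQ_unique is_proj_linear(2)[OF resolutionD(1)[OF P]] by (metis cancel_comm_monoid_add_class.diff_cancel)
  qed
  then have "x - u = 0" by (rule resolutionD(3)[OF P])
  then show ?thesis using u by (simp add: F_def[abs_def])
qed

lemma resolution_component_tendsto_0:
  assumes "resolution P" shows "(\<lambda>k. P k x) \<longlonglongrightarrow> 0"
  using tendsto_diff[OF LIMSEQ_Suc[OF resolution_sums[OF assms, of x]] resolution_sums[OF assms, of x]]
  by simp

lemma resolution_refine: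
  assumes P: "resolution P" and Q: "\<And>j. resolution (Q j)"
    and comm: "\<And>i j x. Q j i (P j x) = P j (Q j i x)"
  shows "resolution (\<lambda>n x. Q (fst (prod_decode n)) (snd (prod_decode n)) (P (fst (prod_decode n)) x))"
  unfolding resolution_def
proof (intro conjI allI impI)
  note p = resolutionD[OF P] and q = resolutionD[OF Q]
  show "is_proj (\<lambda>x. Q (fst (prod_decode k)) (snd (prod_decode k)) (P (fst (prod_decode k)) x))" for k
  proof -
    obtain j i where ji: "prod_decode k = (j, i)" by fastforce
    have "adjoint_pair (\<lambda>x. Q j i (P j x)) (\<lambda>x. P j (Q j i x))"
      by (rule adjoint_pair_compose[OF is_projD(1)[OF q(1)] is_projD(1)[OF p(1)]])
    then show ?thesis
      by (simp add: ji is_proj_def comm is_projD(2)[OF p(1)] is_projD(2)[OF q(1)])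
  qed
  fix m n x assume "m \<noteq> (n::nat)"
  then have ne: "prod_decode m \<noteq> prod_decode n" by (metis prod_decode_inverse)
  obtain j i j' i' where ji: "prod_decode m = (j, i)" "prod_decode n = (j', i')" by fastforce
  have "Q j i (P j (Q j' i' (P j' x))) = 0"
  proof (cases "j = j'")
    case True
    then have "Q j i (Q j i' (P j (P j x))) = 0" using ne ji by (intro q(2)) auto
    then show ?thesis using True by (simp add: comm)
  next
    case False
    then have "P j (Q j' i' (P j' x)) = 0" unfolding comm by (rule p(2))
    then show ?thesis by (simp add: is_proj_linear(6)[OF q(1)])
  qed
  then show "Q (fst (prod_decode m)) (snd (prod_decode m)) (P (fst (prod_decode m))
      (Q (fst (prod_decode n)) (snd (prod_decode n)) (P (fst (prod_decode n)) x))) = 0"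
    by (simp add: ji)
next
  fix x assume z: "\<forall>k. Q (fst (prod_decode k)) (snd (prod_decode k)) (P (fst (prod_decode k)) x) = 0"
  have "Q j i (P j x) = 0" for j i using z[rule_format, of "prod_encode (j, i)"] by simp
  then have "P j x = 0" for j using resolutionD(3)[OF Q] by blast
  then show "x = 0" by (rule resolutionD(3)[OF P])
qed

text \<open>\<open>E\<^sub>i\<close> is the difference of the spectral projections of \<open>H\<close> at \<open>c\<^sub>i\<close> and \<open>c\<^sub>i\<^sub>+\<^sub>1\<close>.  These projections
  decrease because a vector in the range for the smaller threshold and the kernel for the larger one
  would give the form of \<open>H\<close> two contradictory bounds.\<close>

lemma spectral_slices:
  fixes H :: "'a::complex_hilbert_space \<Rightarrow> 'a" and c :: "nat \<Rightarrow> real"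
  assumes H: "adjoint_pair H H" and bd: "\<And>x. norm (H x) \<le> L * norm x"
    and dec: "\<And>i. c (Suc i) < c i"
    and top: "\<And>x. c 0 * (norm x)\<^sup>2 \<le> Re (cinner (H x) x) \<Longrightarrow> x = 0"
    and bot: "\<And>x. (\<And>i. Re (cinner (H x) x) \<le> c i * (norm x)\<^sup>2) \<Longrightarrow> x = 0"
  obtains E where "resolution E"
    "\<And>U U' i x. adjoint_pair U U' \<Longrightarrow> (\<And>x. U (H x) = H (U x)) \<Longrightarrow> U (E i x) = E i (U x)"
    "\<And>i x. E i x = x \<Longrightarrow> c (Suc i) * (norm x)\<^sup>2 \<le> Re (cinner (H x) x)"
    "\<And>i x. E i x = x \<Longrightarrow> Re (cinner (H x) x) \<le> c i * (norm x)\<^sup>2"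
proof -
  define good where "good i P \<longleftrightarrow> is_proj P \<and> (\<forall>x. P x = x \<longrightarrow> Re (cinner (H x) x) \<le> c i * (norm x)\<^sup>2) \<and>
    (\<forall>x. P x = 0 \<longrightarrow> Re (cinner (H x) x) \<ge> c i * (norm x)\<^sup>2) \<and>
    (\<forall>U U' x. adjoint_pair U U' \<longrightarrow> (\<forall>x. U (H x) = H (U x)) \<longrightarrow> U (P x) = P (U x))" for i P
  have "\<exists>P. good i P" for i
    by (rule spectral_projection_exists[OF H bd, of "c i"]) (unfold good_def, blast)
  then obtain G where G: "\<And>i. good i (G i)" by metis
  have proj: "is_proj (G i)" for i using G unfolding good_def by blast
  have upper: "Re (cinner (H x) x) \<le> c i * (norm x)\<^sup>2" if "G i x = x" for i x
    using G[of i] that unfolding good_def by blast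
  have lower: "Re (cinner (H x) x) \<ge> c i * (norm x)\<^sup>2" if "G i x = 0" for i x
    using G[of i] that unfolding good_def by blast
  have comm: "U (G i x) = G i (U x)"
    if "adjoint_pair U U'" "\<And>x. U (H x) = H (U x)" for U U' i x
    using G[of i] that unfolding good_def by blast
  note lin = is_proj_linear[OF proj] and sa = is_projD(1)[OF proj] and idem = is_projD(2)[OF proj]
  have GH: "G i (H x) = H (G i x)" for i x by (rule comm[OF H refl, symmetric])
  have GG: "G i (G j x) = G j (G i x)" for i j x by (rule comm[OF sa GH])
  have mono: "G i (G j x) = G j x" if "i \<le> j" for i j x
  proof (cases "i = j")
    case False
    define w where "w = G j x - G i (G j x)"
    have lt: "c j < c i"
      using lift_Suc_mono_less[of "\<lambda>i. - c i" i j] dec that False by simp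
    have "G i w = 0" "G j w = w" by (simp_all add: w_def lin idem GG[of j i])
    then have "c i * (norm w)\<^sup>2 \<le> c j * (norm w)\<^sup>2" using lower upper by (meson order_trans)
    then have "w = 0" using lt by (simp add: mult_le_cancel_right)
    then show ?thesis by (simp add: w_def)
  qed (simp add: idem)
  have mono': "G j (G i x) = G j x" if "i \<le> j" for i j x using mono[OF that] GG by metis
  have G0: "G 0 x = x" for x
  proof -
    have "G 0 (x - G 0 x) = 0" by (simp add: lin idem)
    then have "x - G 0 x = 0" using lower top by blast
    then show ?thesis by simp
  qed
  define E where "E i x = G i x - G (Suc i) x" for i x
  have "resolution E" unfolding resolution_def
  proof (intro conjI allI impI)
    show "is_proj (E i)" for i
      using sa by (auto simp: is_proj_def adjoint_pair_def E_def cinner_simps lin idem mono mono')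
    show "E i (E j x) = 0" if "i \<noteq> j" for i j x
    proof (cases "i < j")
      case True
      then show ?thesis by (simp add: E_def lin mono)
    next
      case False
      then show ?thesis using that by (simp add: E_def lin mono')
    qed
    fix x assume "\<forall>i. E i x = 0"
    then have "G (Suc i) x = G i x" for i by (simp add: E_def)
    then have "G i x = x" for i by (induction i) (simp_all add: G0)
    then show "x = 0" using upper by (intro bot) blast
  qed
  moreover have "U (E i x) = E i (U x)"
    if "adjoint_pair U U'" "\<And>x. U (H x) = H (U x)" for U U' i x
    using comm[OF that] adjoint_pair_linear(2)[OF that(1)] by (simp add: E_def)
  moreover have "c (Suc i) * (norm x)\<^sup>2 \<le> Re (cinner (H x) x)" if "E i x = x" for i x
  proof (rule lower)
    show "G (Suc i) x = 0" by (subst that[symmetric]) (simp add: E_def lin idem mono')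
  qed
  moreover have "Re (cinner (H x) x) \<le> c i * (norm x)\<^sup>2" if "E i x = x" for i x
  proof (rule upper)
    show "G i x = x" by (subst (1 2) that[symmetric]) (simp add: E_def lin idem mono)
  qed
  ultimately show ?thesis using that by blast
qed

text \<open>On a slice the form of \<open>H - c\<close> is small, hence so is \<open>H - c\<close> in norm.\<close>

lemma norm_slice_le:
  assumes H: "adjoint_pair H H" and E: "is_proj E" and comm: "\<And>x. E (H x) = H (E x)"
    and lo: "\<And>x. E x = x \<Longrightarrow> (c - d) * (norm x)\<^sup>2 \<le> Re (cinner (H x) x)"
    and up: "\<And>x. E x = x \<Longrightarrow> Re (cinner (H x) x) \<le> c * (norm x)\<^sup>2"
    and d: "0 < d" and x: "E x = x"
  shows "norm (H x - c *\<^sub>R x) \<le> d * norm x"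
proof -
  define K where "K x = c *\<^sub>R E x - H (E x)" for x
  note lin = is_proj_linear[OF E]
  have "cinner (H (E x)) y = cinner x (H (E y))" for x y
    by (simp add: adjoint_pairD[OF is_projD(1)[OF E]] adjoint_pairD[OF H] flip: comm)
  then have K: "adjoint_pair K K"
    by (simp add: adjoint_pair_def K_def cinner_simps adjoint_pairD[OF is_projD(1)[OF E]])
  have form: "Re (cinner (K y) y) = c * (norm (E y))\<^sup>2 - Re (cinner (H (E y)) (E y))" for y
  proof -
    have "E (K y) = K y" by (simp add: K_def lin comm is_projD(2)[OF E])
    then have "cinner (K y) y = cinner (K y) (E y)"
      by (metis adjoint_pairD[OF is_projD(1)[OF E]])
    then show ?thesis by (simp add: K_def cinner_simps Re_cinner_self)
  qed
  have "norm (K x) \<le> d * norm x"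
  proof (rule norm_le_if_form_le[OF K d])
    fix y
    show "0 \<le> Re (cinner (K y) y)" using up[of "E y"] by (simp add: form is_projD(2)[OF E])
    have "(c - d) * (norm (E y))\<^sup>2 \<le> Re (cinner (H (E y)) (E y))"
      using lo[of "E y"] by (simp add: is_projD(2)[OF E])
    then have "Re (cinner (K y) y) \<le> d * (norm (E y))\<^sup>2" by (simp add: form algebra_simps)
    also have "\<dots> \<le> d * (norm y)\<^sup>2"
      using d norm_proj_le[OF E, of y] by (intro mult_left_mono power_mono) auto
    finally show "Re (cinner (K y) y) \<le> d * (norm y)\<^sup>2" .
  qed
  then show ?thesis by (simp add: K_def x norm_minus_commute)
qed

section \<open>Approximate diagonalisation of a normal operator\<close>

context normal_pair
begin

definition commutes :: "('a \<Rightarrow> 'a) \<Rightarrow> bool" where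
  "commutes U \<longleftrightarrow> (\<forall>x\<in>D. U x \<in> D \<and> A (U x) = U (A x))"

lemma commutesD: "commutes U \<Longrightarrow> x \<in> D \<Longrightarrow> U x \<in> D" "commutes U \<Longrightarrow> x \<in> D \<Longrightarrow> A (U x) = U (A x)"
  by (simp_all add: commutes_def)

lemma commutes_B:
  assumes U: "adjoint_pair U U" and c: "commutes U" and x: "x \<in> D"
  shows "B (U x) = U (B x)"
proof (rule in_D_if_B(2))
  fix f assume f: "f \<in> D"
  have "cinner (A f) (U x) = cinner (A (U f)) x"
    using commutesD(2)[OF c f] adjoint_pairD[OF U, of "A f" x] by simp
  also have "\<dots> = cinner f (U (B x))"
    using cinner_A[OF commutesD(1)[OF c f] x] adjoint_pairD[OF U, of f "B x"] by simp
  finally show "cinner (A f) (U x) = cinner f (U (B x))" .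
qed

text \<open>The operator \<open>(1 + A\<^sup>* A)\<^sup>-\<^sup>1\<close> is bounded and selfadjoint, and spectral projections of it cut the
  space into parts on which \<open>A\<close> is bounded.\<close>

definition T :: "'a \<Rightarrow> 'a" where
  "T x = (SOME u. u \<in> D \<and> A u \<in> D \<and> u + B (A u) = x)"

lemma T: "T x \<in> D" "A (T x) \<in> D" "T x + B (A (T x)) = x"
proof -
  obtain u where "u \<in> D \<and> A u \<in> D \<and> u + B (A u) = x" using mutual_adjoint_solve[OF adj] by metis
  then have "T x \<in> D \<and> A (T x) \<in> D \<and> T x + B (A (T x)) = x" unfolding T_def by (rule someI)
  then show "T x \<in> D" "A (T x) \<in> D" "T x + B (A (T x)) = x" by auto
qed

lemma BAT: "B (A (T x)) = x - T x"
  using T(3)[of x] by (metis add_diff_cancel_left')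

lemma T_eqI:
  assumes u: "u \<in> D" "A u \<in> D" "u + B (A u) = x" shows "T x = u"
proof -
  define w where "w = T x - u"
  have w: "w \<in> D" "A w \<in> D" "w + B (A w) = 0"
    using T[of x] u by (simp_all add: w_def A_lin B_lin algebra_simps)
  have "cinner (w + B (A w)) w = cinner w w + cinner (A w) (A w)"
    using cinner_B[OF w(1) w(2)] by (simp add: cinner_simps)
  then have "Re (cinner w w + cinner (A w) (A w)) = 0" using w(3) by simp
  then have "(norm w)\<^sup>2 + (norm (A w))\<^sup>2 = 0" by (simp only: plus_complex.sel Re_cinner_self)
  then show ?thesis by (simp add: sum_power2_eq_zero_iff w_def)
qed

lemma T_cinner: "cinner (T x) y = cinner (T x) (T y) + cinner (A (T x)) (A (T y))"
proof -
  have "cinner (T x) y = cinner (T x) (T y + B (A (T y)))" by (simp only: T(3))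
  then show ?thesis using cinner_A[OF T(1) T(2), of x y] by (simp add: cinner_simps)
qed

lemma T_selfadjoint: "adjoint_pair T T"
  unfolding adjoint_pair_def by (metis T_cinner cinner_commute complex_cnj_add)

lemma T_form: "Re (cinner (T x) x) = (norm (T x))\<^sup>2 + (norm (A (T x)))\<^sup>2"
  by (simp add: T_cinner[of x x] Re_cinner_self)

lemma T_form_le: "Re (cinner (T x) x) \<le> (norm x)\<^sup>2"
proof -
  have "cinner (T x) (B (A (T x))) = cinner (A (T x)) (A (T x))"
    using cinner_A[OF T(1) T(2), of x x] by simp
  then have "(norm (T x + B (A (T x))))\<^sup>2 = (norm (T x))\<^sup>2 + 2 * (norm (A (T x)))\<^sup>2 + (norm (B (A (T x))))\<^sup>2"
    by (simp add: norm_add_sq Re_cinner_self)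
  then show ?thesis by (simp add: T(3) T_form)
qed

lemma norm_T_le: "norm (T x) \<le> norm x"
proof -
  have "(norm (T x))\<^sup>2 \<le> (norm x)\<^sup>2"
    using T_form_le[of x] zero_le_power2[of "norm (A (T x))"] unfolding T_form by linarith
  then show ?thesis by (rule power2_le_imp_le) simp
qed

lemma T_zero_imp: "T x = 0 \<Longrightarrow> x = 0"
  using T(3)[of x] by (simp add: A_lin B_lin)

lemma T_A: assumes x: "x \<in> D" shows "T (A x) = A (T x)"
proof (rule T_eqI)
  have "B (A (T x)) \<in> D" using x T(1) by (simp add: BAT A_lin)
  then show d: "A (A (T x)) \<in> D" using dom_iff T(2) by blast
  have "B (A (A (T x))) = A x - A (T x)"
    using AB[OF T(2) d] x T(1) by (simp add: BAT A_lin)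
  then show "A (T x) + B (A (A (T x))) = A x" by simp
qed (rule T)

lemma AT_adjoint: "adjoint_pair (\<lambda>x. A (T x)) (\<lambda>x. B (T x))"
  unfolding adjoint_pair_def
proof (intro allI)
  fix x y
  have BT: "B (T y) \<in> D" using dom_iff T(1,2) by blast
  have "cinner (A (T x)) (B (A (T y))) = cinner (B (A (T x))) (B (T y))"
    using cinner_B[OF BT T(2)[of x]] AB[OF T(1)[of y] T(2)[of y]] by simp
  moreover have "cinner (A (T x)) (T y) = cinner (T x) (B (T y))" by (rule cinner_A[OF T(1) T(1)])
  ultimately have "cinner (A (T x)) (T y + B (A (T y))) = cinner (T x + B (A (T x))) (B (T y))"
    by (simp add: cinner_add_left cinner_add_right)
  then show "cinner (A (T x)) y = cinner x (B (T y))" by (simp only: T(3))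
qed

lemma T_commute:
  assumes U: "adjoint_pair U U" and c: "commutes U" shows "U (T x) = T (U x)"
proof (rule T_eqI[symmetric])
  note cD = commutesD[OF c]
  show "U (T x) \<in> D" "A (U (T x)) \<in> D" using T cD by simp_all
  have "U (T x) + B (A (U (T x))) = U (T x + B (A (T x)))"
    using T(1,2) cD commutes_B[OF U c] by (simp add: adjoint_pair_linear[OF U])
  then show "U (T x) + B (A (U (T x))) = U x" by (simp add: T(3))
qed

text \<open>The range of \<open>T\<close> is a core for \<open>A\<close>, so commutation with \<open>T\<close> and \<open>A T\<close> extends by closedness to
  all of \<open>D\<close>.\<close>

lemma commutes_if_commutes_T:
  assumes E: "is_proj E" and ET: "\<And>x. E (T x) = T (E x)" and EAT: "\<And>x. E (A (T x)) = A (T (E x))"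
  shows "commutes E"
  unfolding commutes_def
proof (intro ballI)
  fix x assume x: "x \<in> D"
  obtain u where u: "\<And>n::nat. u n \<in> D" "\<And>n. A (u n) \<in> D" "u \<longlonglongrightarrow> x" "(\<lambda>n. A (u n)) \<longlonglongrightarrow> A x"
    using mutual_adjoint_core[OF adj x] by blast
  have "T (u n + B (A (u n))) = u n" for n using u by (intro T_eqI) auto
  then have e: "E (u n) \<in> D \<and> A (E (u n)) = E (A (u n))" for n
    using ET[of "u n + B (A (u n))"] EAT[of "u n + B (A (u n))"] T(1)[of "E (u n + B (A (u n)))"] by simp
  have "(\<lambda>n. E (u n)) \<longlonglongrightarrow> E x" "(\<lambda>n. A (E (u n))) \<longlonglongrightarrow> E (A x)"
    using e u(3,4) bounded_linear.tendsto[OF bounded_linear_proj[OF E]] by auto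
  then show "E x \<in> D \<and> A (E x) = E (A x)" using A_limit[of "\<lambda>n. E (u n)"] e by blast
qed

text \<open>Where \<open>T \<ge> \<epsilon>\<close>, the equation \<open>T v = x\<close> is solved by the contraction \<open>v \<mapsto> x + v - T v\<close>.\<close>

lemma bounded_part:
  assumes E: "is_proj E" and ET: "\<And>x. E (T x) = T (E x)"
    and e: "0 < e" "e < 1" and lower: "\<And>x. E x = x \<Longrightarrow> e * (norm x)\<^sup>2 \<le> Re (cinner (T x) x)"
    and x: "E x = x"
  shows "x \<in> D" "norm (A x) \<le> norm x / sqrt e"
proof -
  note linE = is_proj_linear[OF E] and linT = adjoint_pair_linear[OF T_selfadjoint]
  define S where "S = {v. E v = v}"
  have contr: "norm (T v - v) \<le> (1 - e) * norm v" if "E v = v" for v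
    using norm_slice_le[OF T_selfadjoint E ET, of 1 "1 - e" v] lower T_form_le that e by simp
  have "continuous_on UNIV E"
    by (simp add: bounded_linear.linear linear_continuous_on bounded_linear_proj[OF E])
  then have "closed S" unfolding S_def by (intro closed_Collect_eq) auto
  then have "complete S" by (simp add: complete_eq_closed)
  moreover have "S \<noteq> {}" using x by (auto simp: S_def)
  moreover have "(\<lambda>v. x + v - T v) ` S \<subseteq> S" using x by (auto simp: S_def linE ET)
  moreover have "dist (x + v - T v) (x + w - T w) \<le> (1 - e) * dist v w" if "v \<in> S" "w \<in> S" for v w
  proof -
    have "norm (T (v - w) - (v - w)) \<le> (1 - e) * norm (v - w)"
      using that by (intro contr) (simp add: S_def linE)
    moreover have "x + v - T v - (x + w - T w) = (v - w) - T (v - w)" by (simp add: linT algebra_simps)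
    ultimately show ?thesis unfolding dist_norm by (metis norm_minus_commute)
  qed
  ultimately have "\<exists>!v\<in>S. x + v - T v = v"
    using e by (intro Banach_fix[where c = "1 - e"]) auto
  then obtain v where v: "E v = v" "T v = x" unfolding S_def by auto
  show "x \<in> D" using T(1)[of v] v(2) by simp
  have "e * norm v \<le> norm x"
    using contr[OF v(1)] norm_triangle_ineq4[of "T v" "T v - v"] v(2)
    by (simp add: algebra_simps)
  then have nv: "norm v \<le> norm x / e" using e by (simp add: field_simps)
  have "(norm (A x))\<^sup>2 \<le> Re (cinner x v)" using T_form[of v] v(2) by simp
  also have "\<dots> \<le> norm x * norm v" by (rule Re_cinner_le)
  also have "\<dots> \<le> norm x * (norm x / e)" by (intro mult_left_mono nv) simp
  also have "\<dots> = (norm x / sqrt e)\<^sup>2" using e by (simp add: power2_eq_square)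
  finally show "norm (A x) \<le> norm x / sqrt e" by (rule power2_le_imp_le) (use e in simp)
qed

text \<open>On a block where \<open>A\<close> is bounded, slice its real and imaginary parts, which commute.\<close>

lemma block_resolution:
  assumes E: "is_proj E" and c: "commutes E" and ED: "\<And>x. E x \<in> D"
    and bd: "\<And>x. norm (A (E x)) \<le> M * norm x" and d: "0 < d"
  obtains Q z where "resolution Q" "\<And>i x. Q i (E x) = E (Q i x)"
    "\<And>i x. Q i (A (E x)) = A (E (Q i x))"
    "\<And>U i x. adjoint_pair U U \<Longrightarrow> commutes U \<Longrightarrow> (\<And>x. U (E x) = E (U x)) \<Longrightarrow> U (Q i x) = Q i (U x)"
    "\<And>i x. E x = x \<Longrightarrow> Q i x = x \<Longrightarrow> norm (A x - z i *\<^sub>C x) \<le> d * norm x"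
proof -
  note sE = is_projD(1)[OF E] and EE = is_projD(2)[OF E]
  define N N' where "N x = A (E x)" and "N' x = B (E x)" for x
  have EN: "E (N x) = N x" "N (E x) = N x" and EN': "E (N' x) = N' x" "N' (E x) = N' x" for x
    using commutesD(2)[OF c ED[of x]] commutes_B[OF sE c ED[of x]] EE by (simp_all add: N_def N'_def)
  have NN': "adjoint_pair N N'"
    unfolding adjoint_pair_def
  proof (intro allI)
    fix x y
    have "cinner (N x) y = cinner (N x) (E y)" using EN(1) adjoint_pairD[OF sE] by metis
    also have "\<dots> = cinner (E x) (N' y)" unfolding N_def N'_def by (rule cinner_A[OF ED ED])
    also have "\<dots> = cinner x (N' y)" using EN'(1) adjoint_pairD[OF sE] by metis
    finally show "cinner (N x) y = cinner x (N' y)" .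
  qed
  note linN = adjoint_pair_linear[OF NN'] and linN' = adjoint_pair_linear[OF adjoint_pair_sym[OF NN']]
  have comm: "N (N' x) = N' (N x)" for x
  proof -
    have "A (E x) \<in> D" using EN(1)[of x] ED[of "N x"] by (simp add: N_def)
    then have "A (B (E x)) = B (A (E x))" by (intro AB ED)
    then show ?thesis using EN(1)[of x] EN'(1)[of x] by (simp add: N_def N'_def)
  qed
  have nN: "norm (N x) \<le> M * norm x" and nN': "norm (N' x) \<le> M * norm x" for x
    using bd[of x] norm_B[OF ED[of x]] by (simp_all add: N_def N'_def)
  define H1 H2 where "H1 x = (1/2) *\<^sub>R (N x + N' x)" and "H2 x = (- \<i> / 2) *\<^sub>C (N x - N' x)" for x
  have sa: "adjoint_pair H1 H1" "adjoint_pair H2 H2"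
    using adjoint_pairD[OF NN'] adjoint_pairD[OF adjoint_pair_sym[OF NN']]
    by (simp_all add: adjoint_pair_def H1_def H2_def cinner_simps algebra_simps)
  have split: "N x = H1 x + \<i> *\<^sub>C H2 x" for x
  proof -
    have "\<i> *\<^sub>C H2 x = (1/2) *\<^sub>R (N x - N' x)"
      using scaleC_of_real[of "1/2" "N x - N' x"] by (simp add: H2_def scaleC_scaleC)
    then show ?thesis by (simp add: H1_def flip: scaleR_add_right)
  qed
  have bd1: "norm (H1 x) \<le> M * norm x" and bd2: "norm (H2 x) \<le> M * norm x" for x
    using norm_triangle_ineq[of "N x" "N' x"] norm_triangle_ineq4[of "N x" "N' x"] nN[of x] nN'[of x]
    by (simp_all add: H1_def H2_def norm_scaleC norm_divide)
  have H12: "H2 (H1 x) = H1 (H2 x)" for x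
    by (simp add: H1_def H2_def linN linN' comm scaleC_scaleR scaleC_diff_right scaleC_add_right algebra_simps)
  \<comment> \<open>Starting above the norm \<open>M\<close> makes the first threshold exceed the form; each of the two parts may
    contribute \<open>d / 2\<close> to the error.\<close>
  define th where "th i = M + 1 - real i * (d / 2)" for i
  have slices: "\<exists>Q. resolution Q \<and>
      (\<forall>U U' i x. adjoint_pair U U' \<longrightarrow> (\<forall>x. U (H x) = H (U x)) \<longrightarrow> U (Q i x) = Q i (U x)) \<and>
      (\<forall>i x. Q i x = x \<longrightarrow> norm (H x - th i *\<^sub>R x) \<le> d / 2 * norm x)"
    if H: "adjoint_pair H H" and Hb: "\<And>x. norm (H x) \<le> M * norm x" for H
  proof -
    have form: "\<bar>Re (cinner (H x) x)\<bar> \<le> M * (norm x)\<^sup>2" for x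
    proof -
      have "\<bar>Re (cinner (H x) x)\<bar> \<le> norm (H x) * norm x"
        using norm_cinner_le[of "H x" x] abs_Re_le_cmod order_trans by blast
      also have "\<dots> \<le> M * norm x * norm x" using Hb by (intro mult_right_mono) auto
      finally show ?thesis by (simp add: power2_eq_square mult.assoc)
    qed
    have dec: "th (Suc i) < th i" for i using d by (simp add: th_def field_simps)
    have top: "x = 0" if "th 0 * (norm x)\<^sup>2 \<le> Re (cinner (H x) x)" for x
    proof -
      have "(M + 1) * (norm x)\<^sup>2 \<le> M * (norm x)\<^sup>2"
        using that form[of x] by (simp add: th_def)
      then have "(norm x)\<^sup>2 \<le> 0" by (simp add: algebra_simps)
      then show ?thesis by simp
    qed
    have bot: "x = 0" if le: "\<And>i. Re (cinner (H x) x) \<le> th i * (norm x)\<^sup>2" for x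
    proof (rule ccontr)
      assume "x \<noteq> 0"
      then have pos: "0 < (norm x)\<^sup>2" by simp
      obtain i where i: "2 * M + 1 < real i * (d / 2)"
        using reals_Archimedean3[of "d / 2"] d half_gt_zero by blast
      have "- M * (norm x)\<^sup>2 \<le> th i * (norm x)\<^sup>2" using le[of i] form[of x] by linarith
      then have "- M \<le> th i" by (rule mult_right_le_imp_le[OF _ pos])
      then show False using i by (simp add: th_def)
    qed
    obtain Q where Q: "resolution Q"
      "\<And>U U' i x. adjoint_pair U U' \<Longrightarrow> (\<And>x. U (H x) = H (U x)) \<Longrightarrow> U (Q i x) = Q i (U x)"
      "\<And>i x. Q i x = x \<Longrightarrow> th (Suc i) * (norm x)\<^sup>2 \<le> Re (cinner (H x) x)"
      "\<And>i x. Q i x = x \<Longrightarrow> Re (cinner (H x) x) \<le> th i * (norm x)\<^sup>2"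
      using spectral_slices[of H M th, OF H Hb dec top bot] by blast
    have QH: "Q i (H x) = H (Q i x)" for i x by (rule Q(2)[OF H refl, symmetric])
    have "norm (H x - th i *\<^sub>R x) \<le> d / 2 * norm x" if x: "Q i x = x" for i x
    proof (rule norm_slice_le[OF H resolutionD(1)[OF Q(1)] QH _ Q(4) _ x])
      show "(th i - d / 2) * (norm x)\<^sup>2 \<le> Re (cinner (H x) x)" if "Q i x = x" for x
        using Q(3)[OF that] by (simp add: th_def algebra_simps add_divide_distrib)
    qed (use d in auto)
    with Q(1,2) show ?thesis by blast
  qed
  obtain Q1 where Q1: "resolution Q1"
    "\<forall>U U' i x. adjoint_pair U U' \<longrightarrow> (\<forall>x. U (H1 x) = H1 (U x)) \<longrightarrow> U (Q1 i x) = Q1 i (U x)"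
    "\<forall>i x. Q1 i x = x \<longrightarrow> norm (H1 x - th i *\<^sub>R x) \<le> d / 2 * norm x"
    using slices[OF sa(1) bd1] by blast
  obtain Q2 where Q2: "resolution Q2"
    "\<forall>U U' i x. adjoint_pair U U' \<longrightarrow> (\<forall>x. U (H2 x) = H2 (U x)) \<longrightarrow> U (Q2 i x) = Q2 i (U x)"
    "\<forall>i x. Q2 i x = x \<longrightarrow> norm (H2 x - th i *\<^sub>R x) \<le> d / 2 * norm x"
    using slices[OF sa(2) bd2] by blast
  note p1 = resolutionD(1)[OF Q1(1)] and p2 = resolutionD(1)[OF Q2(1)]
  have H2Q1: "H2 (Q1 i x) = Q1 i (H2 x)" for i x using Q1(2) sa(2) H12 by blast
  have Q12: "Q2 j (Q1 i x) = Q1 i (Q2 j x)" for i j x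
    using Q2(2) is_projD(1)[OF p1] H2Q1 by metis
  have H1Q1: "H1 (Q1 i x) = Q1 i (H1 x)" for i x using Q1(2) sa(1) by blast
  have H2Q2: "H2 (Q2 i x) = Q2 i (H2 x)" for i x using Q2(2) sa(2) by blast
  have H1Q2: "H1 (Q2 i x) = Q2 i (H1 x)" for i x using Q2(2) sa(1) H12 by metis
  define Q where "Q n x = Q2 (snd (prod_decode n)) (Q1 (fst (prod_decode n)) x)" for n x
  define z where "z n = Complex (th (fst (prod_decode n))) (th (snd (prod_decode n)))" for n
  have res: "resolution Q"
    using resolution_refine[of Q1 "\<lambda>_. Q2", OF Q1(1) Q2(1) Q12] by (simp add: Q_def[abs_def])
  have UQ: "U (Q i x) = Q i (U x)"
    if "adjoint_pair U U'" "\<And>x. U (H1 x) = H1 (U x)" "\<And>x. U (H2 x) = H2 (U x)" for U U' i x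
    using that Q1(2) Q2(2) unfolding Q_def by metis
  have H1E: "E (H1 x) = H1 (E x)" and H2E: "E (H2 x) = H2 (E x)" for x
    using EN EN' by (simp_all add: H1_def H2_def adjoint_pair_linear[OF sE])
  have QE: "Q i (E x) = E (Q i x)" for i x by (rule UQ[OF sE H1E H2E, symmetric])
  have QN: "Q i (N x) = N (Q i x)" for i x
    unfolding split Q_def
    by (simp add: is_proj_linear[OF p1] is_proj_linear[OF p2] H1Q1 H1Q2 H2Q1 H2Q2)
  show ?thesis
  proof (rule that[of Q z, OF res QE])
    show "Q i (A (E x)) = A (E (Q i x))" for i x using QN by (simp add: N_def)
  next
    fix U i x assume U: "adjoint_pair U U" "commutes U" and UE: "\<And>x. U (E x) = E (U x)"
    have "U (N x) = N (U x)" "U (N' x) = N' (U x)" for x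
      using commutesD(2)[OF U(2) ED[of x]] commutes_B[OF U ED[of x]] UE by (simp_all add: N_def N'_def)
    then have "U (H1 x) = H1 (U x)" "U (H2 x) = H2 (U x)" for x
      by (simp_all add: H1_def H2_def adjoint_pair_linear[OF U(1)])
    then show "U (Q i x) = Q i (U x)" by (rule UQ[OF U(1)])
  next
    fix i x assume x: "E x = x" "Q i x = x"
    let ?a = "fst (prod_decode i)" and ?b = "snd (prod_decode i)"
    have x2: "Q2 ?b x = x" by (subst (1 2) x(2)[symmetric]) (simp add: Q_def is_projD(2)[OF p2])
    have x1: "Q1 ?a x = x"
      by (subst (1 2) x(2)[symmetric]) (simp add: Q_def is_projD(2)[OF p1] flip: Q12)
    have z: "z i *\<^sub>C x = th ?a *\<^sub>R x + \<i> *\<^sub>C (th ?b *\<^sub>R x)"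
      by (simp add: z_def Complex_eq scaleC_add_left scaleC_of_real scaleC_scaleC[symmetric])
    have "A x - z i *\<^sub>C x = (H1 x - th ?a *\<^sub>R x) + \<i> *\<^sub>C (H2 x - th ?b *\<^sub>R x)"
      using split[of x] x(1) by (simp add: N_def z scaleC_diff_right)
    also have "norm \<dots> \<le> d / 2 * norm x + d / 2 * norm x"
      using Q1(3) x1 Q2(3) x2 by (intro order_trans[OF norm_triangle_ineq] add_mono) (auto simp: norm_scaleC)
    finally show "norm (A x - z i *\<^sub>C x) \<le> d * norm x" by simp
  qed
qed

text \<open>An orthogonal decomposition into reducing subspaces on each of which \<open>A\<close> is a scalar up to \<open>d\<close>.
  The last condition lets projections from decompositions with different \<open>d\<close> commute.\<close>

definition scalar_resolution :: "real \<Rightarrow> (nat \<Rightarrow> 'a \<Rightarrow> 'a) \<Rightarrow> (nat \<Rightarrow> complex) \<Rightarrow> bool" where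
  "scalar_resolution d P z \<longleftrightarrow> resolution P \<and> (\<forall>k x. P k x \<in> D) \<and> (\<forall>k. commutes (P k)) \<and>
     (\<forall>k x. norm (A (P k x) - z k *\<^sub>C P k x) \<le> d * norm (P k x)) \<and>
     (\<forall>U k x. adjoint_pair U U \<longrightarrow> commutes U \<longrightarrow> U (P k x) = P k (U x))"

text \<open>Slicing \<open>T\<close> at the thresholds \<open>2 / 2\<^sup>j\<close> gives blocks where \<open>A\<close> is bounded; they exhaust the space
  because \<open>T\<close> is injective.  The start \<open>2\<close> is chosen strictly above \<open>\<parallel>T\<parallel> \<le> 1\<close>.\<close>

theorem scalar_resolution_exists:
  assumes d: "0 < d" obtains P z where "scalar_resolution d P z"
proof -
  have nT: "norm (T x) \<le> 1 * norm x" for x using norm_T_le by simp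
  have top: "x = 0" if "2 / 2 ^ 0 * (norm x)\<^sup>2 \<le> Re (cinner (T x) x)" for x
  proof -
    have "2 * (norm x)\<^sup>2 \<le> Re (cinner (T x) x)" using that by simp
    then have "(norm x)\<^sup>2 \<le> 0" using T_form_le[of x] by linarith
    then show ?thesis by simp
  qed
  have bot: "x = 0" if le: "\<And>i::nat. Re (cinner (T x) x) \<le> 2 / 2 ^ i * (norm x)\<^sup>2" for x
  proof -
    have "(\<lambda>i. 2 * (1/2) ^ i * (norm x)\<^sup>2) \<longlonglongrightarrow> 2 * 0 * (norm x)\<^sup>2"
      by (intro tendsto_intros LIMSEQ_power_zero) simp
    then have "Re (cinner (T x) x) \<le> 2 * 0 * (norm x)\<^sup>2"
      by (rule LIMSEQ_le_const) (use le in \<open>auto simp: power_divide\<close>)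
    then have "(norm (T x))\<^sup>2 \<le> 0" using zero_le_power2[of "norm (A (T x))"] unfolding T_form by linarith
    then show ?thesis by (simp add: T_zero_imp)
  qed
  obtain E where E: "resolution E"
    and EU: "\<And>U U' i x. adjoint_pair U U' \<Longrightarrow> (\<And>x. U (T x) = T (U x)) \<Longrightarrow> U (E i x) = E i (U x)"
    and El: "\<And>i x. E i x = x \<Longrightarrow> 2 / 2 ^ Suc i * (norm x)\<^sup>2 \<le> Re (cinner (T x) x)"
  proof (rule spectral_slices[OF T_selfadjoint nT, of "\<lambda>i. 2 / 2 ^ i"])
    show "2 / 2 ^ Suc i < (2::real) / 2 ^ i" for i by (simp add: field_simps)
  qed (use top bot in blast)+
  note pE = resolutionD(1)[OF E]
  have ET: "E i (T x) = T (E i x)" for i x by (rule EU[OF T_selfadjoint refl, symmetric])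
  have EAT: "E i (A (T x)) = A (T (E i x))" for i x
    by (rule EU[OF AT_adjoint, symmetric]) (rule T_A[OF T(1), symmetric])
  have cE: "commutes (E i)" for i by (rule commutes_if_commutes_T[OF pE ET EAT])
  have low: "1 / 2 ^ Suc i * (norm x)\<^sup>2 \<le> Re (cinner (T x) x)" if "E i x = x" for i x
  proof -
    have "1 / 2 ^ Suc i * (norm x)\<^sup>2 \<le> 2 / 2 ^ Suc i * (norm x)\<^sup>2"
      by (intro mult_right_mono divide_right_mono) auto
    then show ?thesis using El[OF that] by linarith
  qed
  have e: "0 < (1::real) / 2 ^ Suc i" "(1::real) / 2 ^ Suc i < 1" for i
    using one_less_power[of "2::real" "Suc i"] by auto
  have ED: "E i x \<in> D" for i x
    using bounded_part(1)[of "E i" "1 / 2 ^ Suc i" "E i x", OF pE ET e low] is_projD(2)[OF pE] by simp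
  have EA: "norm (A (E i x)) \<le> 1 / sqrt (1 / 2 ^ Suc i) * norm x" for i x
  proof -
    have "norm (A (E i x)) \<le> norm (E i x) / sqrt (1 / 2 ^ Suc i)"
      using bounded_part(2)[of "E i" "1 / 2 ^ Suc i" "E i x", OF pE ET e low] is_projD(2)[OF pE] by simp
    also have "\<dots> \<le> norm x / sqrt (1 / 2 ^ Suc i)"
      using norm_proj_le[OF pE] by (intro divide_right_mono) auto
    finally show ?thesis by simp
  qed
  define good where "good j Q z \<longleftrightarrow> resolution Q \<and> (\<forall>i x. Q i (E j x) = E j (Q i x)) \<and>
    (\<forall>i x. Q i (A (E j x)) = A (E j (Q i x))) \<and>
    (\<forall>U i x. adjoint_pair U U \<longrightarrow> commutes U \<longrightarrow> U (Q i x) = Q i (U x)) \<and>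
    (\<forall>i x. E j x = x \<longrightarrow> Q i x = x \<longrightarrow> norm (A x - z i *\<^sub>C x) \<le> d * norm x)" for j Q and z :: "nat \<Rightarrow> complex"
  have "\<exists>Q z. good j Q z" for j
  proof -
    have UE: "U (E j x) = E j (U x)" if "adjoint_pair U U" "commutes U" for U x
      by (rule EU[OF that(1) T_commute[OF that]])
    show ?thesis
      by (rule block_resolution[OF pE[of j] cE ED EA d]) (use UE in \<open>unfold good_def, blast\<close>)
  qed
  then obtain Q z where "\<And>j. good j (Q j) (z j)" by metis
  then have Q: "resolution (Q j)" and QE: "Q j i (E j x) = E j (Q j i x)"
    and QA: "Q j i (A (E j x)) = A (E j (Q j i x))"
    and QU: "adjoint_pair U U \<Longrightarrow> commutes U \<Longrightarrow> U (Q j i x) = Q j i (U x)"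
    and Qz: "E j x = x \<Longrightarrow> Q j i x = x \<Longrightarrow> norm (A x - z j i *\<^sub>C x) \<le> d * norm x" for i j x U
    unfolding good_def by blast+
  define P where "P n x = Q (fst (prod_decode n)) (snd (prod_decode n)) (E (fst (prod_decode n)) x)" for n x
  define w where "w n = z (fst (prod_decode n)) (snd (prod_decode n))" for n
  have "resolution P" using resolution_refine[of E Q, OF E Q QE] by (simp add: P_def[abs_def])
  moreover have "P n x \<in> D" for n x by (simp add: P_def QE ED)
  moreover have "commutes (P n)" for n
    unfolding commutes_def
  proof (intro ballI conjI)
    fix x assume x: "x \<in> D"
    show "P n x \<in> D" by (simp add: P_def QE ED)
    show "A (P n x) = P n (A x)"
      using QA[of "fst (prod_decode n)" "snd (prod_decode n)" x] commutesD(2)[OF cE x]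
      by (simp add: P_def QE)
  qed
  moreover have "norm (A (P n x) - w n *\<^sub>C P n x) \<le> d * norm (P n x)" for n x
    unfolding w_def
  proof (rule Qz)
    show "E (fst (prod_decode n)) (P n x) = P n x" by (simp add: P_def is_projD(2)[OF pE] flip: QE)
    show "Q (fst (prod_decode n)) (snd (prod_decode n)) (P n x) = P n x"
      by (simp add: P_def is_projD(2)[OF resolutionD(1)[OF Q]])
  qed
  moreover have "U (P n x) = P n (U x)" if "adjoint_pair U U" "commutes U" for U n x
    using QU[OF that] EU[OF that(1) T_commute[OF that]] by (simp add: P_def)
  ultimately show ?thesis using that[of P w] unfolding scalar_resolution_def by blast
qed

end

section \<open>Block scalars and the spectrum\<close>

lemma resolution_norm_le:
  assumes P: "resolution P" and c: "0 \<le> c" and le: "\<And>k. c * norm (P k x) \<le> norm (P k y)"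
  shows "c * norm x \<le> norm y"
proof -
  have "c * norm (\<Sum>k<n. P k x) \<le> norm (\<Sum>k<n. P k y)" for n
  proof -
    have "(c * norm (\<Sum>k<n. P k x))\<^sup>2 = (\<Sum>k<n. (c * norm (P k x))\<^sup>2)"
      by (simp add: power_mult_distrib norm_resolution_sum[OF P] sum_distrib_left)
    also have "\<dots> \<le> (\<Sum>k<n. (norm (P k y))\<^sup>2)" using le c by (intro sum_mono power_mono) auto
    also have "\<dots> = (norm (\<Sum>k<n. P k y))\<^sup>2" by (simp add: norm_resolution_sum[OF P])
    finally show ?thesis by (rule power2_le_imp_le) simp
  qed
  moreover have "(\<lambda>n. c * norm (\<Sum>k<n. P k x)) \<longlonglongrightarrow> c * norm x"
    "(\<lambda>n. norm (\<Sum>k<n. P k y)) \<longlonglongrightarrow> norm y"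
    by (intro tendsto_intros resolution_sums[OF P])+
  ultimately show ?thesis by (intro LIMSEQ_le) auto
qed

context normal_pair
begin

lemma bounded_below_if_resolvent:
  assumes "z \<notin> spectrum D A"
  obtains c where "0 < c" "\<And>x. x \<in> D \<Longrightarrow> c * norm x \<le> norm (A x - z *\<^sub>C x)"
proof -
  define N where "N x = A x - z *\<^sub>C x" for x
  have bij: "bij_betw N D UNIV" and bl: "bounded_linear (inv_into D N)"
    using assms by (simp_all add: spectrum_def resolvent_set_def N_def[abs_def])
  obtain K where K: "0 < K" "\<And>y. norm (inv_into D N y) \<le> norm y * K"
    using bounded_linear.pos_bounded[OF bl] by blast
  have "1 / K * norm x \<le> norm (A x - z *\<^sub>C x)" if x: "x \<in> D" for x
  proof -
    have "inv_into D N (N x) = x" using bij x by (simp add: bij_betw_def inv_into_f_f)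
    then have "norm x \<le> norm (N x) * K" using K(2)[of "N x"] by simp
    then show ?thesis using K(1) by (simp add: N_def field_simps)
  qed
  then show ?thesis using that[of "1 / K"] K(1) by simp
qed

text \<open>If the normal operator \<open>A - z\<close> is bounded below, its range is closed; a vector orthogonal to the
  range lies in the kernel of the adjoint, which is the kernel of \<open>A - z\<close>.\<close>

lemma resolvent_if_bounded_below:
  assumes c: "0 < c" and below: "\<And>x. x \<in> D \<Longrightarrow> c * norm x \<le> norm (A x - z *\<^sub>C x)"
  shows "z \<notin> spectrum D A"
proof -
  define N where "N x = A x - z *\<^sub>C x" for x
  have lin: "N (x + y) = N x + N y" "N (x - y) = N x - N y" "N (a *\<^sub>C x) = a *\<^sub>C N x"
    if "x \<in> D" "y \<in> D" for x y a
    using that by (simp_all add: N_def A_lin scaleC_add_right scaleC_diff_right scaleC_scaleC mult.commute)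
  have linR: "N (r *\<^sub>R x) = r *\<^sub>R N x" if "x \<in> D" for x r
    using that by (simp add: N_def A_lin scaleC_scaleR scaleR_diff_right)
  have N0: "N 0 = 0" by (simp add: N_def A_lin)
  have inj: "inj_on N D"
  proof (rule inj_onI)
    fix x y assume xy: "x \<in> D" "y \<in> D" "N x = N y"
    have "c * norm (x - y) \<le> norm (N (x - y))" unfolding N_def using xy by (intro below A_lin)
    then have "c * norm (x - y) \<le> 0" using lin(2)[OF xy(1,2)] xy(3) by simp
    then show "x = y" using c by (simp add: mult_le_0_iff)
  qed
  have sub: "subspace (N ` D)"
    unfolding subspace_def
  proof (intro conjI ballI allI)
    show "0 \<in> N ` D" using N0 A_lin(1) image_eqI[of 0 N 0 D] by simp
    show "x + y \<in> N ` D" if "x \<in> N ` D" "y \<in> N ` D" for x y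
    proof -
      from that obtain u v where "u \<in> D" "v \<in> D" "x = N u" "y = N v" by blast
      then show ?thesis using lin(1)[of u v] A_lin(2)[of u v] by (intro image_eqI[of _ _ "u + v"]) simp_all
    qed
    show "r *\<^sub>R x \<in> N ` D" if "x \<in> N ` D" for x r
    proof -
      from that obtain u where "u \<in> D" "x = N u" by blast
      then show ?thesis using linR[of u r] A_lin(6)[of u r] by (intro image_eqI[of _ _ "r *\<^sub>R u"]) simp_all
    qed
  qed
  have subC: "a *\<^sub>C x \<in> N ` D" if "x \<in> N ` D" for x a
  proof -
    from that obtain u where "u \<in> D" "x = N u" by blast
    then show ?thesis using lin(3)[of u u a] A_lin(4)[of u a] by (intro image_eqI[of _ _ "a *\<^sub>C u"]) simp_all
  qed
  have "closed (N ` D)"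
    unfolding closed_sequential_limits
  proof (intro allI impI, elim conjE)
    fix f l assume f: "\<forall>n. f n \<in> N ` D" and l: "f \<longlonglongrightarrow> l"
    from f have "\<forall>n. \<exists>u. u \<in> D \<and> f n = N u" by blast
    from choice[OF this] obtain u where u: "\<And>n. u n \<in> D" "\<And>n. f n = N (u n)" by blast
    have "Cauchy u"
    proof (rule metric_CauchyI)
      fix e :: real assume "0 < e"
      then obtain M where M: "\<And>m n. m \<ge> M \<Longrightarrow> n \<ge> M \<Longrightarrow> dist (f m) (f n) < c * e"
        using metric_CauchyD[OF LIMSEQ_imp_Cauchy[OF l], of "c * e"] c by auto
      have "dist (u m) (u n) < e" if "m \<ge> M" "n \<ge> M" for m n
      proof -
        have "c * norm (u m - u n) \<le> norm (N (u m - u n))"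
          unfolding N_def using u(1) by (intro below A_lin)
        also have "\<dots> < c * e" using M[OF that] u lin(2) by (simp add: dist_norm)
        finally show ?thesis using c by (simp add: dist_norm)
      qed
      then show "\<exists>M. \<forall>m\<ge>M. \<forall>n\<ge>M. dist (u m) (u n) < e" by blast
    qed
    then obtain x where x: "u \<longlonglongrightarrow> x" using Cauchy_convergent_iff convergent_def by blast
    have "(\<lambda>n. f n + z *\<^sub>C u n) \<longlonglongrightarrow> l + z *\<^sub>C x"
      by (intro tendsto_add l bounded_linear.tendsto[OF bounded_linear_scaleC x])
    then have "(\<lambda>n. A (u n)) \<longlonglongrightarrow> l + z *\<^sub>C x" by (simp add: u(2) N_def)
    from A_limit[OF u(1) x this] show "l \<in> N ` D" by (auto simp: N_def intro!: image_eqI[of _ _ x])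
  qed
  have surj: "y \<in> N ` D" for y
  proof -
    obtain g where g: "g \<in> N ` D" "\<And>v. v \<in> N ` D \<Longrightarrow> cinner (y - g) v = 0"
      using projection_on_subspace[OF sub \<open>closed (N ` D)\<close> subC, of y] by blast
    have "cinner (A f) (y - g) = cinner f (cnj z *\<^sub>C (y - g))" if "f \<in> D" for f
    proof -
      have "cinner (N f) (y - g) = 0" using g(2)[of "N f"] that by (metis cinner_commute complex_cnj_zero imageI)
      then show ?thesis by (simp add: N_def cinner_simps algebra_simps)
    qed
    from in_D_if_B[OF this] have w: "y - g \<in> D" "B (y - g) = cnj z *\<^sub>C (y - g)" by blast+
    then have "norm (A (y - g) - z *\<^sub>C (y - g)) = 0"
      using norm_A_minus_scalar[OF w(1), of z] by simp
    then have "c * norm (y - g) \<le> 0" using below[OF w(1)] by simp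
    then have "y = g" using c by (simp add: mult_le_0_iff)
    then show ?thesis using g(1) by simp
  qed
  have bij: "bij_betw N D UNIV" using inj surj by (auto simp: bij_betw_def)
  have inv: "inv_into D N y \<in> D" "N (inv_into D N y) = y" for y
    using surj[of y] by (auto intro: inv_into_into f_inv_into_f)
  have invI: "inv_into D N y = x" if "x \<in> D" "N x = y" for x y
    using inj that by (auto simp: inv_into_f_f)
  have "bounded_linear (inv_into D N)"
  proof (rule bounded_linear_intro[where K = "1 / c"])
    show "inv_into D N (x + y) = inv_into D N x + inv_into D N y" for x y
      using inv lin(1) A_lin(2) by (simp add: invI)
    show "inv_into D N (r *\<^sub>R x) = r *\<^sub>R inv_into D N x" for x r
      using inv linR A_lin(6) by (simp add: invI)
    show "norm (inv_into D N x) \<le> norm x * (1 / c)" for x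
      using below[OF inv(1)[of x]] inv(2)[of x] c by (simp add: N_def field_simps)
  qed
  with bij show ?thesis by (simp add: spectrum_def resolvent_set_def N_def[abs_def])
qed

text \<open>A lower bound for \<open>A - z\<close> survives, halved, in a small disc around \<open>z\<close>; finitely many discs cover
  a compact set.\<close>

lemma uniformly_bounded_below:
  assumes K: "compact K" "K \<inter> spectrum D A = {}"
  obtains c where "0 < c" "\<And>z x. z \<in> K \<Longrightarrow> x \<in> D \<Longrightarrow> c * norm x \<le> norm (A x - z *\<^sub>C x)"
proof -
  have "\<exists>c. 0 < c \<and> (\<forall>x\<in>D. c * norm x \<le> norm (A x - z *\<^sub>C x))" if z: "z \<in> K" for z
  proof -
    have "z \<notin> spectrum D A" using K(2) z by blast
    then obtain c where "0 < c" "\<And>x. x \<in> D \<Longrightarrow> c * norm x \<le> norm (A x - z *\<^sub>C x)"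
      by (rule bounded_below_if_resolvent) blast
    then show ?thesis by blast
  qed
  then have "\<forall>z\<in>K. \<exists>c. 0 < c \<and> (\<forall>x\<in>D. c * norm x \<le> norm (A x - z *\<^sub>C x))" by blast
  from bchoice[OF this] obtain c where c: "\<And>z. z \<in> K \<Longrightarrow> 0 < c z"
    "\<And>z x. z \<in> K \<Longrightarrow> x \<in> D \<Longrightarrow> c z * norm x \<le> norm (A x - z *\<^sub>C x)" by blast
  obtain K' where K': "K' \<subseteq> K" "finite K'" "K \<subseteq> (\<Union>z\<in>K'. ball z (c z / 2))"
  proof (rule compactE_image[OF K(1), of K "\<lambda>z. ball z (c z / 2)"])
    show "K \<subseteq> (\<Union>z\<in>K. ball z (c z / 2))"
    proof
      fix z assume "z \<in> K"
      then show "z \<in> (\<Union>z\<in>K. ball z (c z / 2))" using c(1)[of z] by (intro UN_I[of z]) auto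
    qed
  qed auto
  define m where "m = Min (insert 1 ((\<lambda>z. c z / 2) ` K'))"
  have m: "0 < m" using K'(1,2) c(1) by (auto simp: m_def)
  have m2: "m \<le> c z / 2" if "z \<in> K'" for z
    unfolding m_def using that K'(2) by (intro Min_le) auto
  have "m * norm x \<le> norm (A x - w *\<^sub>C x)" if w: "w \<in> K" and x: "x \<in> D" for w x
  proof -
    obtain z where z: "z \<in> K'" "dist z w < c z / 2" using K'(3) w by (auto simp: mem_ball)
    have "A x - z *\<^sub>C x = (A x - w *\<^sub>C x) + (w - z) *\<^sub>C x" by (simp add: scaleC_diff_left)
    then have "norm (A x - z *\<^sub>C x) \<le> norm (A x - w *\<^sub>C x) + norm (w - z) * norm x"
      by (metis norm_scaleC norm_triangle_ineq)
    moreover have "norm (w - z) * norm x \<le> c z / 2 * norm x"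
      using z(2) by (intro mult_right_mono) (auto simp: dist_norm norm_minus_commute)
    moreover have "c z * norm x \<le> norm (A x - z *\<^sub>C x)" using c(2) z(1) K'(1) x by blast
    moreover have "m * norm x \<le> c z / 2 * norm x" using m2[OF z(1)] by (intro mult_right_mono) auto
    ultimately show ?thesis by linarith
  qed
  with m that show ?thesis by blast
qed

lemma scalar_resolutionD:
  assumes "scalar_resolution d P z"
  shows "resolution P" "P k x \<in> D" "commutes (P k)"
    "norm (A (P k x) - z k *\<^sub>C P k x) \<le> d * norm (P k x)"
    "adjoint_pair U U \<Longrightarrow> commutes U \<Longrightarrow> U (P k x) = P k (U x)"
  using assms by (simp_all add: scalar_resolution_def)

text \<open>If a disc around \<open>z\<^sub>k\<close> were free of spectrum, \<open>A - w\<close> would be bounded below uniformly for \<open>w\<close> in it.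
  A resolution finer than that bound then has no block meeting the range of \<open>P\<^sub>k\<close>.\<close>

lemma spectrum_near_block:
  assumes sr: "scalar_resolution d P z" and d: "0 < d" and nz: "P k x \<noteq> 0"
  obtains w where "w \<in> spectrum D A" "norm (w - z k) \<le> 2 * d"
proof (rule ccontr)
  assume contra: "\<not> thesis"
  then have "cball (z k) (2 * d) \<inter> spectrum D A = {}"
    using that by (auto simp: dist_norm norm_minus_commute)
  then obtain c where c: "0 < c"
    "\<And>w x. w \<in> cball (z k) (2 * d) \<Longrightarrow> x \<in> D \<Longrightarrow> c * norm x \<le> norm (A x - w *\<^sub>C x)"
    using uniformly_bounded_below[OF compact_cball] by blast
  define e where "e = min d (c / 2)"
  have e: "0 < e" "e \<le> d" "e < c" using d c(1) by (auto simp: e_def min_def)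
  obtain P' z' where sr': "scalar_resolution e P' z'" using scalar_resolution_exists[OF e(1)] .
  note P = scalar_resolutionD[OF sr] and P' = scalar_resolutionD[OF sr']
  have "P' j (P k x) = 0" for j
  proof (rule ccontr)
    define v where "v = P' j (P k x)"
    assume "P' j (P k x) \<noteq> 0"
    then have v: "0 < norm v" by (simp add: v_def)
    have v': "v = P k (P' j x)"
      unfolding v_def by (rule P(5)[OF is_projD(1)[OF resolutionD(1)[OF P'(1)]] P'(3)])
    have 1: "norm (A v - z k *\<^sub>C v) \<le> d * norm v" unfolding v' by (rule P(4))
    have 2: "norm (A v - z' j *\<^sub>C v) \<le> e * norm v" unfolding v_def by (rule P'(4))
    have "(z k - z' j) *\<^sub>C v = (A v - z' j *\<^sub>C v) - (A v - z k *\<^sub>C v)" by (simp add: scaleC_diff_left)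
    then have "norm (z k - z' j) * norm v \<le> norm (A v - z' j *\<^sub>C v) + norm (A v - z k *\<^sub>C v)"
      by (metis norm_scaleC norm_triangle_ineq4)
    also have "\<dots> \<le> (e + d) * norm v" using 1 2 by (simp add: algebra_simps)
    finally have "norm (z k - z' j) \<le> e + d" using v by simp
    then have "z' j \<in> cball (z k) (2 * d)" using e(2) by (simp add: dist_norm)
    then have "c * norm v \<le> e * norm v" using c(2)[of "z' j" v] 2 P'(2)[of j "P k x"] v_def by force
    then show False using e(3) v by simp
  qed
  then have "P k x = 0" by (rule resolutionD(3)[OF P'(1)])
  then show False using nz by simp
qed

text \<open>If every nonzero block had its scalar far from \<open>w\<close>, then \<open>A - w\<close> would be bounded below on each
  block with the same constant, hence on the whole space.\<close>

lemma block_near_spectrum: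
  assumes sr: "scalar_resolution d P z" and d: "0 < d" and w: "w \<in> spectrum D A"
  obtains k x where "P k x \<noteq> 0" "norm (z k - w) \<le> 2 * d"
proof (rule ccontr)
  assume contra: "\<not> thesis"
  note P = scalar_resolutionD[OF sr]
  note lin = is_proj_linear[OF resolutionD(1)[OF P(1)]]
  have far: "2 * d < norm (z k - w)" if "P k x \<noteq> 0" for k x
    using contra that \<open>\<And>k x. P k x \<noteq> 0 \<Longrightarrow> norm (z k - w) \<le> 2 * d \<Longrightarrow> thesis\<close> by (meson not_less)
  have "d * norm x \<le> norm (A x - w *\<^sub>C x)" if x: "x \<in> D" for x
  proof (rule resolution_norm_le[OF P(1)])
    show "0 \<le> d" using d by simp
    fix k
    show "d * norm (P k x) \<le> norm (P k (A x - w *\<^sub>C x))"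
    proof (cases "P k x = 0")
      case False
      have "P k (A x - w *\<^sub>C x) = A (P k x) - w *\<^sub>C P k x"
        using commutesD(2)[OF P(3) x] by (simp add: lin)
      also have "\<dots> = (A (P k x) - z k *\<^sub>C P k x) + (z k - w) *\<^sub>C P k x"
        by (simp add: scaleC_diff_left)
      finally have "norm (z k - w) * norm (P k x) \<le> norm (P k (A x - w *\<^sub>C x)) + norm (A (P k x) - z k *\<^sub>C P k x)"
        by (metis add_diff_cancel_left' norm_scaleC norm_triangle_ineq4)
      moreover have "2 * d * norm (P k x) \<le> norm (z k - w) * norm (P k x)"
        using far[OF False] by (intro mult_right_mono) auto
      ultimately show ?thesis using P(4)[of k x] by linarith
    qed (simp add: lin)
  qed
  then show False using resolvent_if_bounded_below[OF d] w by blast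
qed

end

section \<open>The logarithmic region as a growth bound\<close>

lemma log_region_iff:
  assumes "0 < bm" "0 < bp"
  shows "z \<in> log_region bm bp \<longleftrightarrow>
    Re z \<le> 0 \<and> (Im z = 0 \<or> Re z \<le> - (bm * ln \<bar>Im z\<bar>)) \<or>
    0 \<le> Re z \<and> (Im z = 0 \<or> bp * ln \<bar>Im z\<bar> \<le> Re z)"
  using assms by (auto simp: log_region_def ext_ln_def)

text \<open>In terms of growth, the logarithmic region is \<open>|Im z| \<le> exp (|Re z| / b)\<close>, where the sign of \<open>Re z\<close>
  decides between the two values of \<open>b\<close>; halving \<open>b\<close> absorbs a constant factor up to a bounded set.\<close>

lemma log_region_exponential:
  "(\<exists>bp>0. \<exists>bm>0. bounded (S - log_region bm bp)) \<longleftrightarrow>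
   (\<exists>C T. \<forall>z\<in>S. norm z \<le> C * exp (T * \<bar>Re z\<bar>))" (is "?L \<longleftrightarrow> ?R")
proof
  assume ?L
  then obtain bp bm R where b: "0 < bp" "0 < bm" and R: "\<And>z. z \<in> S - log_region bm bp \<Longrightarrow> norm z \<le> R"
    unfolding bounded_iff by blast
  define T where "T = Max {1, 1 / bp, 1 / bm}"
  have T: "1 \<le> T" "1 / bp \<le> T" "1 / bm \<le> T" by (simp_all add: T_def)
  have "norm z \<le> (\<bar>R\<bar> + 2) * exp (T * \<bar>Re z\<bar>)" if z: "z \<in> S" for z
  proof -
    have e1: "1 \<le> exp (T * \<bar>Re z\<bar>)" using T(1) by simp
    show ?thesis
    proof (cases "z \<in> log_region bm bp")
      case False
      then have "norm z \<le> \<bar>R\<bar> * 1" using R[of z] z by simp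
      also have "\<dots> \<le> (\<bar>R\<bar> + 2) * exp (T * \<bar>Re z\<bar>)" using e1 by (intro mult_mono) auto
      finally show ?thesis .
    next
      case True
      have Imle: "\<bar>Im z\<bar> \<le> exp (T * \<bar>Re z\<bar>)"
      proof (cases "Im z = 0")
        case False
        then obtain b where b': "0 < b" "1 / b \<le> T" "b * ln \<bar>Im z\<bar> \<le> \<bar>Re z\<bar>"
          using True b T by (auto simp: log_region_iff)
        then have "ln \<bar>Im z\<bar> \<le> 1 / b * \<bar>Re z\<bar>" by (simp add: field_simps)
        also have "\<dots> \<le> T * \<bar>Re z\<bar>" using b'(2) by (intro mult_right_mono) auto
        finally have "exp (ln \<bar>Im z\<bar>) \<le> exp (T * \<bar>Re z\<bar>)" by simp
        then show ?thesis using False by simp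
      qed simp
      have "\<bar>Re z\<bar> \<le> 1 * \<bar>Re z\<bar>" by simp
      also have "\<dots> \<le> T * \<bar>Re z\<bar>" using T(1) by (intro mult_right_mono) auto
      also have "\<dots> \<le> exp (T * \<bar>Re z\<bar>)" using exp_ge_add_one_self[of "T * \<bar>Re z\<bar>"] by linarith
      finally have "norm z \<le> 2 * exp (T * \<bar>Re z\<bar>)" using cmod_le[of z] Imle by linarith
      also have "\<dots> \<le> (\<bar>R\<bar> + 2) * exp (T * \<bar>Re z\<bar>)" by (intro mult_right_mono) auto
      finally show ?thesis .
    qed
  qed
  then show ?R by blast
next
  assume ?R
  then obtain C0 T0 where CT0: "\<And>z. z \<in> S \<Longrightarrow> norm z \<le> C0 * exp (T0 * \<bar>Re z\<bar>)" by blast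
  define C T where "C = max 1 C0" and "T = max 1 T0"
  have C: "1 \<le> C" "C0 \<le> C" and T: "1 \<le> T" "T0 \<le> T" by (simp_all add: C_def T_def)
  have CT: "norm z \<le> C * exp (T * \<bar>Re z\<bar>)" if "z \<in> S" for z
  proof -
    have "C0 * exp (T0 * \<bar>Re z\<bar>) \<le> C * exp (T0 * \<bar>Re z\<bar>)" using C by (intro mult_right_mono) auto
    also have "\<dots> \<le> C * exp (T * \<bar>Re z\<bar>)"
      using C T by (intro mult_left_mono) (auto intro: mult_right_mono)
    finally show ?thesis using CT0[OF that] by linarith
  qed
  define b where "b = 1 / (2 * T)"
  have b: "0 < b" using T by (simp add: b_def)
  have "norm z \<le> C * exp (T * ln C)" if z: "z \<in> S" "z \<notin> log_region b b" for z
  proof -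
    have Im: "Im z \<noteq> 0" and r: "\<bar>Re z\<bar> < b * ln \<bar>Im z\<bar>"
      using z(2) b unfolding log_region_iff[OF b b] by (auto simp: not_le abs_if)
    have "\<bar>Im z\<bar> \<le> C * exp (T * \<bar>Re z\<bar>)" using CT[OF z(1)] abs_Im_le_cmod[of z] by linarith
    then have "ln \<bar>Im z\<bar> \<le> ln (C * exp (T * \<bar>Re z\<bar>))" using Im by (intro ln_mono) auto
    also have "\<dots> = ln C + T * \<bar>Re z\<bar>" using C by (simp add: ln_mult)
    finally have "b * ln \<bar>Im z\<bar> \<le> b * (ln C + T * \<bar>Re z\<bar>)" using b by (intro mult_left_mono) auto
    also have "\<dots> = b * ln C + \<bar>Re z\<bar> / 2" using T by (simp add: b_def algebra_simps)
    finally have "\<bar>Re z\<bar> < 2 * b * ln C" using r by linarith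
    also have "\<dots> = ln C / T" using T by (simp add: b_def)
    also have "\<dots> \<le> ln C" using T C by (simp add: divide_le_eq mult_le_cancel_left1)
    finally have "exp (T * \<bar>Re z\<bar>) \<le> exp (T * ln C)" using T by simp
    then have "C * exp (T * \<bar>Re z\<bar>) \<le> C * exp (T * ln C)" using C by (intro mult_left_mono) auto
    then show ?thesis using CT[OF z(1)] by linarith
  qed
  then have "bounded (S - log_region b b)" unfolding bounded_iff by blast
  then show ?L using b by blast
qed

section \<open>Smoothness from the growth bound\<close>

text \<open>Weak derivatives tested on a dense set, with a continuous candidate, are strong: apply the mean
  value inequality to \<open>\<langle>f, g\<rangle>\<close>, with a bound proportional to \<open>\<parallel>g\<parallel>\<close>.\<close>

lemma strong_derivative_if_weak:
  fixes f w :: "real \<Rightarrow> 'a::complex_inner_space"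
  assumes S: "closure S = UNIV" and w: "continuous_on UNIV w"
    and weak: "\<And>g s. g \<in> S \<Longrightarrow> ((\<lambda>s. cinner (f s) g) has_vector_derivative cinner (w s) g) (at s)"
  shows "(f has_vector_derivative w t) (at t)"
  unfolding has_vector_derivative_def has_derivative_at_alt
proof (intro conjI allI impI)
  show "bounded_linear (\<lambda>h. h *\<^sub>R w t)" by (rule bounded_linear_scaleR_left)
  fix e :: real assume e: "0 < e"
  have "isCont w t" using w by (simp add: continuous_on_eq_continuous_at)
  then obtain r where r: "0 < r" "\<And>s. dist s t < r \<Longrightarrow> dist (w s) (w t) < e"
    using e unfolding continuous_at_eps_delta by (auto simp: dist_norm)
  have "norm (f s - f t - (s - t) *\<^sub>R w t) \<le> e * norm (s - t)" if s: "norm (s - t) < r" for s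
  proof -
    let ?q = "f s - f t - (s - t) *\<^sub>R w t"
    have "norm (cinner ?q g) \<le> e * norm (s - t) * norm g" if g: "g \<in> S" for g
    proof -
      have "norm (cinner (f s) g - cinner (f t) g - (s - t) *\<^sub>R cinner (w t) g) \<le> norm (s - t) * (e * norm g)"
      proof (rule vector_differentiable_bound_linearization)
        show "((\<lambda>s. cinner (f s) g) has_vector_derivative cinner (w u) g) (at u within ball t r)" for u
          by (rule has_vector_derivative_at_within[OF weak[OF g]])
        show "closed_segment t s \<subseteq> ball t r"
          using s r(1) by (intro closed_segment_subset) (auto simp: dist_norm norm_minus_commute)
        show "norm (cinner (w u) g - cinner (w t) g) \<le> e * norm g" if "u \<in> ball t r" for u
        proof -
          have "norm (w u - w t) \<le> e" using r(2)[of u] that by (simp add: dist_norm abs_minus_commute)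
          then have "norm (w u - w t) * norm g \<le> e * norm g" by (intro mult_right_mono) auto
          then show ?thesis
            using norm_cinner_le[of "w u - w t" g] by (simp add: cinner_diff_left)
        qed
      qed (use r(1) in auto)
      then show ?thesis by (simp add: cinner_simps scaleR_conv_of_real mult_ac)
    qed
    from norm_le_if_cinner_le_dense[OF S this] show ?thesis
      using e by (auto simp: algebra_simps)
  qed
  then show "\<exists>d>0. \<forall>s. norm (s - t) < d \<longrightarrow> norm (f s - f t - (s - t) *\<^sub>R w t) \<le> e * norm (s - t)"
    using r(1) by blast
qed

text \<open>Gronwall's inequality: \<open>t \<mapsto> exp (- a t) p(t)\<close> increases.\<close>

lemma exponential_lower_bound:
  fixes p p' :: "real \<Rightarrow> real"
  assumes der: "\<And>t. (p has_real_derivative p' t) (at t)" and ge: "\<And>t. a * p t \<le> p' t" and st: "s \<le> t"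
  shows "exp (a * (t - s)) * p s \<le> p t"
proof -
  have "exp (- a * s) * p s \<le> exp (- a * t) * p t"
  proof (rule DERIV_nonneg_imp_nondecreasing[OF st])
    fix x
    have "((\<lambda>x. exp (- a * x) * p x) has_real_derivative
        exp (- a * x) * (- a) * p x + exp (- a * x) * p' x) (at x)"
      by (auto intro!: derivative_eq_intros der)
    moreover have "exp (- a * x) * (- a) * p x + exp (- a * x) * p' x = exp (- a * x) * (p' x - a * p x)"
      by (simp add: algebra_simps)
    ultimately show "\<exists>y. ((\<lambda>x. exp (- a * x) * p x) has_real_derivative y) (at x) \<and> 0 \<le> y"
      using ge[of x] by (metis diff_ge_0_iff_ge exp_ge_zero mult_nonneg_nonneg)
  qed
  then have "exp (a * t) * (exp (- a * s) * p s) \<le> exp (a * t) * (exp (- a * t) * p t)"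
    by (intro mult_left_mono) auto
  then show ?thesis
    by (simp only: mult.assoc[symmetric] exp_add[symmetric]) (simp add: algebra_simps)
qed

text \<open>Where the generator is within \<open>d\<close> of the scalar \<open>z\<close>, the logarithmic derivative of
  \<open>\<parallel>v\<parallel>\<^sup>2\<close> is within \<open>2 d\<close> of \<open>2 Re z\<close>.\<close>

lemma solution_growth:
  fixes v v' :: "real \<Rightarrow> 'a::complex_inner_space"
  assumes der: "\<And>t. (v has_vector_derivative v' t) (at t)"
    and near: "\<And>t. norm (v' t - z *\<^sub>C v t) \<le> d * norm (v t)" and st: "s \<le> t"
  shows "exp ((Re z - d) * (t - s)) * norm (v s) \<le> norm (v t)"
    and "norm (v t) \<le> exp ((Re z + d) * (t - s)) * norm (v s)"
proof -
  define p p' where "p t = (norm (v t))\<^sup>2" and "p' t = 2 * Re (cinner (v' t) (v t))" for t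
  have derp: "(p has_real_derivative p' t) (at t)" for t
  proof -
    have "((\<lambda>s. Re (cinner (v s) (v s))) has_vector_derivative
        Re (cinner (v t) (v' t) + cinner (v' t) (v t))) (at t)"
      by (intro bounded_linear.has_vector_derivative[OF bounded_linear_Re]
          has_vector_derivative_cinner der)
    then show ?thesis
      using Re_cinner_commute[of "v t" "v' t"]
      by (simp add: Re_cinner_self p_def[abs_def] p'_def has_real_derivative_iff_has_vector_derivative)
  qed
  have close: "\<bar>p' t - 2 * Re z * p t\<bar> \<le> 2 * d * p t" for t
  proof -
    have "p' t - 2 * Re z * p t = 2 * Re (cinner (v' t - z *\<^sub>C v t) (v t))"
      by (simp add: p_def p'_def cinner_simps cinner_self algebra_simps)
    also have "\<bar>\<dots>\<bar> \<le> 2 * (norm (v' t - z *\<^sub>C v t) * norm (v t))"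
      using abs_Re_le_cmod norm_cinner_le order_trans by (simp add: abs_mult) blast
    also have "\<dots> \<le> 2 * (d * norm (v t) * norm (v t))"
      using near[of t] by (intro mult_left_mono mult_right_mono) auto
    finally show ?thesis by (simp add: p_def power2_eq_square mult_ac)
  qed
  have sq: "(exp (a * (t - s)) * norm (v s))\<^sup>2 = exp (2 * a * (t - s)) * p s" for a
    by (simp add: power_mult_distrib p_def exp_double[symmetric] mult_ac)
  have "exp (2 * (Re z - d) * (t - s)) * p s \<le> p t"
    using close by (intro exponential_lower_bound[OF derp _ st]) (simp add: abs_le_iff algebra_simps)
  then have "(exp ((Re z - d) * (t - s)) * norm (v s))\<^sup>2 \<le> (norm (v t))\<^sup>2"
    unfolding sq by (simp add: p_def)
  then show "exp ((Re z - d) * (t - s)) * norm (v s) \<le> norm (v t)" by (rule power2_le_imp_le) simp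
  have "exp (2 * (Re z + d) * (t - s)) * (- p s) \<le> - p t"
    using close by (intro exponential_lower_bound[OF _ _ st, of "\<lambda>t. - p t" "\<lambda>t. - p' t"] DERIV_minus derp)
      (simp add: abs_le_iff algebra_simps)
  then have "(norm (v t))\<^sup>2 \<le> (exp ((Re z + d) * (t - s)) * norm (v s))\<^sup>2"
    unfolding sq by (simp add: p_def)
  then show "norm (v t) \<le> exp ((Re z + d) * (t - s)) * norm (v s)" by (rule power2_le_imp_le) simp
qed

context normal_pair
begin

lemma adjoint_dom_eq: "adjoint_dom D A = D"
proof (intro equalityI subsetI)
  fix g assume "g \<in> adjoint_dom D A"
  then obtain h where "\<forall>f\<in>D. cinner (A f) g = cinner f h" unfolding adjoint_dom_def by blast
  then show "g \<in> D" using in_D_if_B(1)[of g h] by blast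
next
  fix g assume "g \<in> D"
  then have "\<forall>f\<in>D. cinner (A f) g = cinner f (B g)" using cinner_A by blast
  then show "g \<in> adjoint_dom D A" unfolding adjoint_dom_def by blast
qed

lemma adjoint_op_eq:
  assumes g: "g \<in> D" shows "adjoint_op D A g = B g"
  unfolding adjoint_op_def
proof (rule the_equality)
  show "\<forall>f\<in>D. cinner (A f) g = cinner f (B g)" using cinner_A g by blast
  show "h = B g" if "\<forall>f\<in>D. cinner (A f) g = cinner f h" for h
    using in_D_if_B(2)[of g h] that by metis
qed

lemma weak_solution_iff:
  "weak_solution D A y \<longleftrightarrow> continuous_on UNIV y \<and>
     (\<forall>g\<in>D. \<forall>t. ((\<lambda>s. cinner (y s) g) has_vector_derivative cinner (y t) (B g)) (at t))"
  by (simp add: weak_solution_def adjoint_dom_eq adjoint_op_eq)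

lemma norm_block_le:
  assumes "scalar_resolution d P z"
  shows "norm (A (P k x)) \<le> (norm (z k) + d) * norm (P k x)"
  using scalar_resolutionD(4)[OF assms, of k x]
    norm_triangle_ineq[of "A (P k x) - z k *\<^sub>C P k x" "z k *\<^sub>C P k x"]
  by (simp add: norm_scaleC algebra_simps)

lemma bounded_linear_block:
  assumes sr: "scalar_resolution d P z" and d: "0 < d"
  shows "bounded_linear (\<lambda>x. A (P k x))"
proof (rule bounded_linear_intro[where K = "norm (z k) + d"])
  note P = scalar_resolutionD[OF sr]
  note proj = resolutionD(1)[OF P(1)]
  show "A (P k (x + y)) = A (P k x) + A (P k y)" "A (P k (r *\<^sub>R x)) = r *\<^sub>R A (P k x)" for x y r
    by (simp_all add: is_proj_linear[OF proj] A_lin P(2))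
  have "(norm (z k) + d) * norm (P k x) \<le> (norm (z k) + d) * norm x" for x
    using norm_proj_le[OF proj] d by (intro mult_left_mono) auto
  then show "norm (A (P k x)) \<le> norm x * (norm (z k) + d)" for x
    using norm_block_le[OF sr, of k x] by (metis mult.commute order_trans)
qed

text \<open>The blockwise form of the equation, which, unlike the weak form, visibly passes from \<open>y\<close> to
  \<open>A y\<close>.\<close>

definition block_solution :: "(nat \<Rightarrow> 'a \<Rightarrow> 'a) \<Rightarrow> (real \<Rightarrow> 'a) \<Rightarrow> bool" where
  "block_solution P y \<longleftrightarrow> continuous_on UNIV y \<and>
     (\<forall>k t. ((\<lambda>s. P k (y s)) has_vector_derivative A (P k (y t))) (at t))"

lemma block_solution_if_weak:
  assumes sr: "scalar_resolution d P z" and d: "0 < d" and y: "weak_solution D A y"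
  shows "block_solution P y"
proof -
  note P = scalar_resolutionD[OF sr]
  note proj = resolutionD(1)[OF P(1)]
  note y' = y[unfolded weak_solution_iff]
  have "((\<lambda>s. P k (y s)) has_vector_derivative A (P k (y t))) (at t)" for k t
  proof (rule strong_derivative_if_weak[where S = UNIV])
    show "continuous_on UNIV (\<lambda>s. A (P k (y s)))"
      using y' bounded_linear.continuous_on[OF bounded_linear_block[OF sr d]] by blast
    fix g s
    have "cinner (A (P k (y s))) g = cinner (y s) (B (P k g))"
    proof -
      have "A (P k (y s)) = P k (A (P k (y s)))"
        using commutesD(2)[OF P(3) P(2)] is_projD(2)[OF proj] by metis
      then have "cinner (A (P k (y s))) g = cinner (A (P k (y s))) (P k g)"
        by (metis adjoint_pairD[OF is_projD(1)[OF proj]])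
      also have "\<dots> = cinner (P k (y s)) (B (P k g))" by (rule cinner_A[OF P(2) P(2)])
      also have "\<dots> = cinner (y s) (B (P k g))"
        using commutes_B[OF is_projD(1)[OF proj] P(3) P(2)[of k g]] is_projD(2)[OF proj]
          adjoint_pairD[OF is_projD(1)[OF proj]] by metis
      finally show ?thesis .
    qed
    moreover have "((\<lambda>s. cinner (y s) (P k g)) has_vector_derivative cinner (y s) (B (P k g))) (at s)"
      using y' P(2) by blast
    ultimately show "((\<lambda>s. cinner (P k (y s)) g) has_vector_derivative cinner (A (P k (y s))) g) (at s)"
      by (simp add: adjoint_pairD[OF is_projD(1)[OF proj]])
  qed simp
  then show ?thesis using y' by (simp add: block_solution_def)
qed

text \<open>The growth condition on the spectrum says that \<open>\<parallel>A v(t)\<parallel>\<close> is controlled by \<open>v\<close> at the times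
  \<open>t + \<tau>\<close> (if \<open>Re z \<ge> 0\<close>) or \<open>t - \<tau>\<close> (if not).\<close>

lemma block_estimate:
  assumes growth: "\<And>w. w \<in> spectrum D A \<Longrightarrow> norm w \<le> C * exp (\<tau> * \<bar>Re w\<bar>)"
    and C: "0 \<le> C" and \<tau>: "0 \<le> \<tau>"
    and sr: "scalar_resolution 1 P z" and y: "block_solution P y"
  shows "(norm (A (P k (y t))))\<^sup>2 \<le>
    ((C * exp (2 * \<tau>) + 3) * exp \<tau>)\<^sup>2 * ((norm (P k (y (t + \<tau>))))\<^sup>2 + (norm (P k (y (t - \<tau>))))\<^sup>2)"
proof (cases "\<forall>x. P k x = 0")
  case True
  then show ?thesis by (simp add: A_lin)
next
  case False
  then obtain x where "P k x \<noteq> 0" by blast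
  from spectrum_near_block[OF sr zero_less_one this] obtain w
    where w: "w \<in> spectrum D A" "norm (w - z k) \<le> 2" by auto
  note P = scalar_resolutionD[OF sr]
  define v where "v t = P k (y t)" for t
  \<comment> \<open>The block scalar is within \<open>2\<close> of the spectrum and \<open>A\<close> within \<open>1\<close> of the block scalar.\<close>
  define K where "K = C * exp (2 * \<tau>) + 3"
  have K: "0 \<le> K" using C by (simp add: K_def)
  have "norm (z k) \<le> norm w + 2" using w(2) norm_triangle_ineq2[of "z k" w] by (simp add: norm_minus_commute)
  also have "norm w \<le> C * exp (\<tau> * \<bar>Re w\<bar>)" by (rule growth[OF w(1)])
  also have "\<dots> \<le> C * exp (2 * \<tau> + \<tau> * \<bar>Re (z k)\<bar>)"
  proof -
    have "\<bar>Re w\<bar> \<le> 2 + \<bar>Re (z k)\<bar>" using w(2) abs_Re_le_cmod[of "w - z k"] by simp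
    then have "\<tau> * \<bar>Re w\<bar> \<le> \<tau> * (2 + \<bar>Re (z k)\<bar>)" using \<tau> by (rule mult_left_mono)
    then show ?thesis using C by (intro mult_left_mono) (auto simp: algebra_simps)
  qed
  also have "\<dots> = C * exp (2 * \<tau>) * exp (\<tau> * \<bar>Re (z k)\<bar>)" by (simp add: exp_add)
  finally have "norm (z k) + 1 \<le> C * exp (2 * \<tau>) * exp (\<tau> * \<bar>Re (z k)\<bar>) + 3" by simp
  also have "\<dots> \<le> K * exp (\<tau> * \<bar>Re (z k)\<bar>)" using \<tau> by (simp add: K_def algebra_simps)
  finally have z: "norm (z k) + 1 \<le> K * exp (\<tau> * \<bar>Re (z k)\<bar>)" .
  have Av: "norm (A (v t)) \<le> K * (exp (\<tau> * \<bar>Re (z k)\<bar>) * norm (v t))"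
  proof -
    have "norm (A (v t)) \<le> (norm (z k) + 1) * norm (v t)" using norm_block_le[OF sr] by (simp add: v_def)
    also have "\<dots> \<le> K * exp (\<tau> * \<bar>Re (z k)\<bar>) * norm (v t)" by (intro mult_right_mono z) simp
    finally show ?thesis by (simp add: mult.assoc)
  qed
  have der: "(v has_vector_derivative A (v t)) (at t)" for t
    using y unfolding block_solution_def v_def[abs_def] by blast
  have near: "norm (A (v t) - z k *\<^sub>C v t) \<le> 1 * norm (v t)" for t
    unfolding v_def by (rule P(4))
  note growth = solution_growth[OF der near]
  have "\<exists>u\<in>{t + \<tau>, t - \<tau>}. exp (\<tau> * \<bar>Re (z k)\<bar>) * norm (v t) \<le> exp \<tau> * norm (v u)"
  proof (cases "0 \<le> Re (z k)")
    case True
    have "exp \<tau> * (exp ((Re (z k) - 1) * \<tau>) * norm (v t)) \<le> exp \<tau> * norm (v (t + \<tau>))"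
      using growth(1)[of t "t + \<tau>"] \<tau> by (intro mult_left_mono) auto
    moreover have "exp \<tau> * (exp ((Re (z k) - 1) * \<tau>) * norm (v t)) = exp (\<tau> * \<bar>Re (z k)\<bar>) * norm (v t)"
      using True
      by (simp only: mult.assoc[symmetric] exp_add[symmetric]) (simp add: algebra_simps)
    ultimately show ?thesis by auto
  next
    case False
    have "exp (- Re (z k) * \<tau>) * norm (v t) \<le> exp (- Re (z k) * \<tau>) * (exp ((Re (z k) + 1) * \<tau>) * norm (v (t - \<tau>)))"
      using growth(2)[of "t - \<tau>" t] \<tau> by (intro mult_left_mono) auto
    also have "\<dots> = exp \<tau> * norm (v (t - \<tau>))"
      by (simp only: mult.assoc[symmetric] exp_add[symmetric]) (simp add: algebra_simps)
    finally show ?thesis using False by (auto simp: mult.commute)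
  qed
  then obtain u where u: "u \<in> {t + \<tau>, t - \<tau>}" "exp (\<tau> * \<bar>Re (z k)\<bar>) * norm (v t) \<le> exp \<tau> * norm (v u)" by blast
  have "norm (A (v t)) \<le> K * (exp \<tau> * norm (v u))"
    using Av mult_left_mono[OF u(2) K] by linarith
  then have "(norm (A (v t)))\<^sup>2 \<le> (K * exp \<tau>)\<^sup>2 * (norm (v u))\<^sup>2"
    using power_mono[of "norm (A (v t))" "K * exp \<tau> * norm (v u)" 2]
    by (simp add: power_mult_distrib mult.assoc)
  also have "\<dots> \<le> (K * exp \<tau>)\<^sup>2 * ((norm (v (t + \<tau>)))\<^sup>2 + (norm (v (t - \<tau>)))\<^sup>2)"
    using u(1) by (intro mult_left_mono) auto
  finally show ?thesis by (simp add: v_def K_def)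
qed

text \<open>By Bessel's inequality the block estimates make \<open>\<Sum> A P\<^sub>k y(t)\<close> converge, and \<open>A\<close> is closed.\<close>

lemma block_solution_in_D:
  assumes sr: "scalar_resolution d P z" and y: "block_solution P y"
    and est: "\<And>k t. (norm (A (P k (y t))))\<^sup>2 \<le>
      K\<^sup>2 * ((norm (P k (y (t + \<tau>))))\<^sup>2 + (norm (P k (y (t - \<tau>))))\<^sup>2)"
  shows "y t \<in> D" "norm (A (y t)) \<le> \<bar>K\<bar> * (norm (y (t + \<tau>)) + norm (y (t - \<tau>)))"
proof -
  note P = scalar_resolutionD[OF sr]
  note proj = resolutionD(1)[OF P(1)]
  define M where "M = K\<^sup>2 * ((norm (y (t + \<tau>)))\<^sup>2 + (norm (y (t - \<tau>)))\<^sup>2)"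
  have AP: "A (P k x) = P k (A (P k x))" for k x
    using commutesD(2)[OF P(3) P(2)] is_projD(2)[OF proj] by metis
  have orth: "cinner (A (P i (y t))) (A (P j (y t))) = 0" if "i \<noteq> j" for i j
    using resolution_cinner[OF P(1) that] AP by metis
  have bound: "(\<Sum>k<n. (norm (A (P k (y t))))\<^sup>2) \<le> M" for n
  proof -
    have "(\<Sum>k<n. (norm (A (P k (y t))))\<^sup>2) \<le>
        K\<^sup>2 * ((\<Sum>k<n. (norm (P k (y (t + \<tau>))))\<^sup>2) + (\<Sum>k<n. (norm (P k (y (t - \<tau>))))\<^sup>2))"
      by (simp only: sum.distrib[symmetric] sum_distrib_left) (intro sum_mono est)
    also have "\<dots> \<le> M" unfolding M_def
      by (intro mult_left_mono add_mono bessel[OF P(1)]) auto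
    finally show ?thesis .
  qed
  obtain s where s: "(\<lambda>n. \<Sum>k<n. A (P k (y t))) \<longlonglongrightarrow> s"
    using orthogonal_series_convergent[of "\<lambda>k. A (P k (y t))", OF orth bound] by blast
  have F: "(\<Sum>k<n. P k (y t)) \<in> D \<and> A (\<Sum>k<n. P k (y t)) = (\<Sum>k<n. A (P k (y t)))" for n
    by (induction n) (simp_all add: A_lin P(2))
  from s F have s': "(\<lambda>n. A (\<Sum>k<n. P k (y t))) \<longlonglongrightarrow> s" by simp
  have yt: "y t \<in> D" "A (y t) = s"
    using A_limit[OF _ resolution_sums[OF P(1)] s'] F by blast+
  then show "y t \<in> D" by simp
  have "(norm s)\<^sup>2 \<le> M"
  proof (rule LIMSEQ_le_const2[OF tendsto_power[OF tendsto_norm[OF s]]], intro exI allI impI)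
    show "(norm (\<Sum>k<n. A (P k (y t))))\<^sup>2 \<le> M" for n
      using bound[of n] by (simp add: norm_sum_orthogonal orth)
  qed
  also have "M \<le> (\<bar>K\<bar> * (norm (y (t + \<tau>)) + norm (y (t - \<tau>))))\<^sup>2"
    unfolding M_def power_mult_distrib power2_abs by (intro mult_left_mono) (auto simp: power2_sum)
  finally show "norm (A (y t)) \<le> \<bar>K\<bar> * (norm (y (t + \<tau>)) + norm (y (t - \<tau>)))"
    unfolding yt(2) by (rule power2_le_imp_le) simp
qed

lemma block_solution_increment:
  assumes "scalar_resolution d P z" and y: "block_solution P y"
  shows "block_solution P (\<lambda>s. y (s + h) - y s)"
  unfolding block_solution_def
proof (intro conjI allI)
  note P = scalar_resolutionD[OF assms(1)]
  note y' = y[unfolded block_solution_def]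
  have "continuous_on UNIV (\<lambda>s. y (s + h))"
    using y' by (intro continuous_on_compose2[of UNIV y UNIV "\<lambda>s. s + h"] continuous_intros) auto
  then show "continuous_on UNIV (\<lambda>s. y (s + h) - y s)" using y' by (intro continuous_on_diff) auto
  fix k t
  have "((\<lambda>s. s + h) has_vector_derivative 1) (at t)" by (auto intro!: derivative_eq_intros)
  from vector_diff_chain_at[OF this, of "\<lambda>s. P k (y s)" "A (P k (y (t + h)))"] y'
  have "((\<lambda>s. P k (y (s + h))) has_vector_derivative A (P k (y (t + h)))) (at t)"
    by (simp add: o_def)
  then have "((\<lambda>s. P k (y (s + h)) - P k (y s)) has_vector_derivative
      A (P k (y (t + h))) - A (P k (y t))) (at t)"
    using y' by (intro has_vector_derivative_diff) auto
  then show "((\<lambda>s. P k (y (s + h) - y s)) has_vector_derivative A (P k (y (t + h) - y t))) (at t)"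
    by (simp add: is_proj_linear[OF resolutionD(1)[OF P(1)]] A_lin P(2))
qed

lemma closure_resolution_sums:
  assumes "resolution P"
  shows "closure {\<Sum>k<n. P k g | n g. True} = UNIV"
proof -
  have "x \<in> closure {\<Sum>k<n. P k g | n g. True}" for x
    unfolding closure_sequential
    by (rule exI[of _ "\<lambda>n. \<Sum>k<n. P k x"]) (use resolution_sums[OF assms, of x] in blast)
  then show ?thesis by blast
qed

text \<open>Applied to increments of \<open>y\<close>, the estimate shows that \<open>A y\<close> is continuous; being the blockwise
  derivative of \<open>y\<close>, it is then the strong derivative, and again a block solution.\<close>

lemma block_solution_derivative:
  assumes sr: "scalar_resolution d P z" and d: "0 < d" and y: "block_solution P y"
    and est: "\<And>y k t. block_solution P y \<Longrightarrow> (norm (A (P k (y t))))\<^sup>2 \<le>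
      K\<^sup>2 * ((norm (P k (y (t + \<tau>))))\<^sup>2 + (norm (P k (y (t - \<tau>))))\<^sup>2)"
  shows "(y has_vector_derivative A (y t)) (at t)" and "block_solution P (\<lambda>t. A (y t))"
proof -
  note P = scalar_resolutionD[OF sr]
  note proj = resolutionD(1)[OF P(1)]
  note y' = y[unfolded block_solution_def]
  have yD: "y t \<in> D" for t by (rule block_solution_in_D(1)[OF sr y est[OF y]])
  have "((\<lambda>h. A (y (t + h)) - A (y t)) \<longlongrightarrow> 0) (at 0)" for t
  proof (rule Lim_null_comparison[OF always_eventually])
    show "\<forall>h. norm (A (y (t + h)) - A (y t)) \<le>
        \<bar>K\<bar> * (norm (y (t + \<tau> + h) - y (t + \<tau>)) + norm (y (t - \<tau> + h) - y (t - \<tau>)))"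
      using block_solution_in_D(2)[OF sr block_solution_increment[OF sr y] est[OF block_solution_increment[OF sr y]], of t]
      by (simp add: A_lin yD)
    have "((\<lambda>h. y (u + h)) \<longlongrightarrow> y u) (at 0)" for u
    proof -
      have "isCont y u" using y' by (simp add: continuous_on_eq_continuous_at)
      then show ?thesis unfolding isCont_iff .
    qed
    then have "((\<lambda>h. norm (y (u + h) - y u)) \<longlongrightarrow> 0) (at 0)" for u
      by (simp add: LIM_zero tendsto_norm_zero)
    then show "((\<lambda>h. \<bar>K\<bar> * (norm (y (t + \<tau> + h) - y (t + \<tau>)) + norm (y (t - \<tau> + h) - y (t - \<tau>)))) \<longlongrightarrow> 0) (at 0)"
      by (intro tendsto_mult_right_zero tendsto_add_zero)
  qed
  then have "isCont (\<lambda>t. A (y t)) t" for t unfolding isCont_iff by (rule LIM_zero_cancel)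
  then have cont: "continuous_on UNIV (\<lambda>t. A (y t))" by (simp add: continuous_on_eq_continuous_at)
  have comm: "P k (A (y t)) = A (P k (y t))" for k t using commutesD(2)[OF P(3) yD] by simp
  show "(y has_vector_derivative A (y t)) (at t)"
  proof (rule strong_derivative_if_weak[OF closure_resolution_sums[OF P(1)] cont])
    fix g s assume "g \<in> {\<Sum>k<n. P k g | n g. True}"
    then obtain n h where g: "g = (\<Sum>k<n. P k h)" by blast
    have eq: "cinner x g = (\<Sum>k<n. cinner (P k x) h)" for x
      using adjoint_pairD[OF is_projD(1)[OF is_proj_resolution_sum[OF P(1), of "{..<n}"]], of x h]
      by (simp add: g cinner_sum_left)
    have "((\<lambda>s. \<Sum>k<n. cinner (P k (y s)) h) has_vector_derivative (\<Sum>k<n. cinner (A (P k (y s))) h)) (at s)"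
      using y' by (intro has_vector_derivative_sum bounded_linear.has_vector_derivative[OF bounded_linear_cinner_left]) auto
    then show "((\<lambda>s. cinner (y s) g) has_vector_derivative cinner (A (y s)) g) (at s)"
      by (simp add: eq comm)
  qed
  have "((\<lambda>s. P k (A (y s))) has_vector_derivative A (P k (A (y t)))) (at t)" for k t
  proof -
    have "((\<lambda>s. A (P k (P k (y s)))) has_vector_derivative A (P k (A (P k (y t))))) (at t)"
      using y' by (intro bounded_linear.has_vector_derivative[OF bounded_linear_block[OF sr d]]) auto
    then show ?thesis by (simp add: is_projD(2)[OF proj] flip: comm)
  qed
  then show "block_solution P (\<lambda>t. A (y t))" using cont by (simp add: block_solution_def)
qed

text \<open>Each differentiation replaces the block solution \<open>y\<close> by the block solution \<open>A y\<close>.\<close>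

theorem smooth_if_spectrum_growth:
  assumes growth: "\<forall>w\<in>spectrum D A. norm w \<le> C * exp (\<tau> * \<bar>Re w\<bar>)" and y: "weak_solution D A y"
  shows "strongly_smooth y"
proof -
  have growth': "norm w \<le> \<bar>C\<bar> * exp (\<bar>\<tau>\<bar> * \<bar>Re w\<bar>)" if "w \<in> spectrum D A" for w
  proof -
    have "C * exp (\<tau> * \<bar>Re w\<bar>) \<le> \<bar>C\<bar> * exp (\<tau> * \<bar>Re w\<bar>)" by (intro mult_right_mono) auto
    also have "\<dots> \<le> \<bar>C\<bar> * exp (\<bar>\<tau>\<bar> * \<bar>Re w\<bar>)"
      by (intro mult_left_mono) (auto intro: mult_right_mono)
    finally show ?thesis using growth that by fastforce
  qed
  obtain P z where sr: "scalar_resolution 1 P z" using scalar_resolution_exists[OF zero_less_one] .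
  note est = block_estimate[OF growth' abs_ge_zero abs_ge_zero sr]
  note der = block_solution_derivative[OF sr zero_less_one _ est]
  have deriv_eq: "strong_deriv u = (\<lambda>t. A (u t))" if "block_solution P u" for u
    by (rule ext) (simp add: strong_deriv_def vector_derivative_at der(1)[OF that])
  have sol: "block_solution P ((strong_deriv ^^ n) y)" for n
  proof (induction n)
    case 0
    show ?case using block_solution_if_weak[OF sr zero_less_one y] by simp
  next
    case (Suc n)
    then show ?case using der(2)[OF Suc] by (simp add: deriv_eq)
  qed
  show ?thesis
    unfolding strongly_smooth_def using der(1)[OF sol] differentiableI_vector by blast
qed

end

section \<open>The growth bound from smoothness\<close>

text \<open>The majorant makes the series of derivatives converge uniformly near \<open>t\<close>.\<close>

lemma has_vector_derivative_series:
  fixes f d :: "nat \<Rightarrow> real \<Rightarrow> 'b::banach"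
  assumes der: "\<And>n t. (f n has_vector_derivative d n t) (at t)"
    and maj: "\<And>R. 0 \<le> R \<Longrightarrow> \<exists>M. summable M \<and> (\<forall>n t. \<bar>t\<bar> \<le> R \<longrightarrow> norm (f n t) \<le> M n \<and> norm (d n t) \<le> M n)"
  shows "((\<lambda>t. \<Sum>n. f n t) has_vector_derivative (\<Sum>n. d n t)) (at t)"
proof -
  define S where "S = ball (0::real) (\<bar>t\<bar> + 1)"
  have tS: "t \<in> S" by (simp add: S_def)
  obtain M where M: "summable M" "\<And>n s. s \<in> S \<Longrightarrow> norm (f n s) \<le> M n" "\<And>n s. s \<in> S \<Longrightarrow> norm (d n s) \<le> M n"
    using maj[of "\<bar>t\<bar> + 1"] by (fastforce simp: S_def)
  have unif: "uniform_limit S (\<lambda>n s. \<Sum>i<n. d i s) (\<lambda>s. \<Sum>i. d i s) sequentially"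
    by (rule Weierstrass_m_test[OF M(3,1)])
  have sf: "summable (\<lambda>n. f n s)" if "s \<in> S" for s
    by (rule summable_comparison_test'[OF M(1), of 0]) (use M(2)[OF that] in auto)
  have "\<exists>g. \<forall>s\<in>S. (\<lambda>n. f n s) sums g s \<and> (g has_derivative (\<lambda>h. h *\<^sub>R (\<Sum>i. d i s))) (at s within S)"
  proof (rule has_derivative_series[where f = f and f' = "\<lambda>n s h. h *\<^sub>R d n s", OF _ _ _ tS summable_sums[OF sf[OF tS]]])
    show "convex S" by (simp add: S_def)
    show "(f n has_derivative (\<lambda>h. h *\<^sub>R d n s)) (at s within S)" for n s
      using has_vector_derivative_at_within[OF der] by (simp add: has_vector_derivative_def)
    fix e :: real assume e: "0 < e"
    have "\<forall>\<^sub>F n in sequentially. \<forall>s\<in>S. dist (\<Sum>i<n. d i s) (\<Sum>i. d i s) < e"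
      by (rule uniform_limitD[OF unif e])
    then show "\<forall>\<^sub>F n in sequentially. \<forall>s\<in>S. \<forall>h. norm ((\<Sum>i<n. h *\<^sub>R d i s) - h *\<^sub>R (\<Sum>i. d i s)) \<le> e * norm h"
    proof (rule eventually_mono, intro ballI allI)
      fix n s and h :: real
      assume "\<forall>s\<in>S. dist (\<Sum>i<n. d i s) (\<Sum>i. d i s) < e" and "s \<in> S"
      then have "norm h * norm ((\<Sum>i<n. d i s) - (\<Sum>i. d i s)) \<le> norm h * e"
        by (intro mult_left_mono) (auto simp: dist_norm less_imp_le)
      then show "norm ((\<Sum>i<n. h *\<^sub>R d i s) - h *\<^sub>R (\<Sum>i. d i s)) \<le> e * norm h"
        by (simp add: mult.commute flip: scaleR_sum_right scaleR_diff_right)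
    qed
  qed
  then obtain g where g: "\<And>s. s \<in> S \<Longrightarrow> (\<lambda>n. f n s) sums g s"
    "\<And>s. s \<in> S \<Longrightarrow> (g has_derivative (\<lambda>h. h *\<^sub>R (\<Sum>i. d i s))) (at s within S)" by blast
  have "open S" by (simp add: S_def)
  have "(g has_derivative (\<lambda>h. h *\<^sub>R (\<Sum>i. d i t))) (at t)"
    using g(2)[OF tS] unfolding at_within_open[OF tS \<open>open S\<close>] .
  moreover have "g s = (\<Sum>n. f n s)" if "s \<in> S" for s using g(1)[OF that] by (simp add: sums_iff)
  ultimately have "((\<lambda>t. \<Sum>n. f n t) has_derivative (\<lambda>h. h *\<^sub>R (\<Sum>i. d i t))) (at t)"
    by (rule has_derivative_transform_within_open[OF _ \<open>open S\<close> tS])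
  then show ?thesis by (simp add: has_vector_derivative_def)
qed

lemma continuous_on_series:
  fixes f :: "nat \<Rightarrow> real \<Rightarrow> 'b::banach"
  assumes cont: "\<And>n. continuous_on UNIV (f n)"
    and maj: "\<And>R. 0 \<le> R \<Longrightarrow> \<exists>M. summable M \<and> (\<forall>n t. \<bar>t\<bar> \<le> R \<longrightarrow> norm (f n t) \<le> M n)"
  shows "continuous_on UNIV (\<lambda>t. \<Sum>n. f n t)"
proof -
  have "isCont (\<lambda>t. \<Sum>n. f n t) t" for t
  proof -
    define S where "S = ball (0::real) (\<bar>t\<bar> + 1)"
    obtain M where M: "summable M" "\<And>n s. s \<in> S \<Longrightarrow> norm (f n s) \<le> M n"
      using maj[of "\<bar>t\<bar> + 1"] by (fastforce simp: S_def)
    have "uniform_limit S (\<lambda>n s. \<Sum>i<n. f i s) (\<lambda>s. \<Sum>i. f i s) sequentially"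
      by (rule Weierstrass_m_test[OF M(2,1)])
    then have "continuous_on S (\<lambda>s. \<Sum>i. f i s)"
      by (rule uniform_limit_theorem[OF always_eventually, rotated])
         (auto intro!: continuous_intros continuous_on_subset[OF cont])
    then show ?thesis
      by (simp add: S_def continuous_on_eq_continuous_at)
  qed
  then show ?thesis by (simp add: continuous_on_eq_continuous_at)
qed

text \<open>The solution is the exponential series \<open>\<Sum> t\<^sup>m N\<^sup>m e / m!\<close>.\<close>

lemma linear_ode_solution_exists:
  fixes N :: "'b::banach \<Rightarrow> 'b"
  assumes N: "bounded_linear N"
  obtains v where "v 0 = e" "\<And>t::real. (v has_vector_derivative N (v t)) (at t)"
proof -
  obtain K where K: "0 < K" "\<And>x. norm (N x) \<le> norm x * K" using bounded_linear.pos_bounded[OF N] by blast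
  define f where "f m t = (t ^ m / fact m) *\<^sub>R (N ^^ m) e" for m and t :: real
  define d where "d m t = (case m of 0 \<Rightarrow> 0 | Suc m' \<Rightarrow> N (f m' t))" for m and t :: real
  have NN: "norm ((N ^^ m) e) \<le> K ^ m * norm e" for m
  proof (induction m)
    case (Suc m)
    have "norm (N ((N ^^ m) e)) \<le> norm ((N ^^ m) e) * K" by (rule K(2))
    also have "\<dots> \<le> K ^ m * norm e * K" using Suc K(1) by (intro mult_right_mono) auto
    finally show ?case by (simp add: mult_ac)
  qed simp
  have fb: "norm (f m t) \<le> (R * K) ^ m / fact m * norm e" if "\<bar>t\<bar> \<le> R" for m t R
  proof -
    have "\<bar>t\<bar> ^ m / fact m * norm ((N ^^ m) e) \<le> R ^ m / fact m * (K ^ m * norm e)"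
      using that by (intro mult_mono divide_right_mono power_mono NN) auto
    then show ?thesis by (simp add: f_def power_mult_distrib power_abs)
  qed
  have der: "(f m has_vector_derivative d m t) (at t)" for m t
  proof (cases m)
    case 0
    then show ?thesis by (simp add: f_def[abs_def] d_def)
  next
    case (Suc k)
    have "((\<lambda>t::real. t ^ Suc k / fact (Suc k)) has_real_derivative
        (real (Suc k) * t ^ (Suc k - Suc 0) / fact (Suc k))) (at t)"
      by (intro DERIV_cdivide DERIV_pow)
    moreover have "real (Suc k) * t ^ (Suc k - Suc 0) / fact (Suc k) = t ^ k / fact k"
      by (simp del: of_nat_Suc)
    ultimately have "((\<lambda>t::real. t ^ Suc k / fact (Suc k)) has_real_derivative (t ^ k / fact k)) (at t)"
      by simp
    then have "((\<lambda>t. (t ^ Suc k / fact (Suc k)) *\<^sub>R (N ^^ Suc k) e) has_vector_derivative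
        (t ^ k / fact k) *\<^sub>R (N ^^ Suc k) e) (at t)"
      unfolding has_real_derivative_iff_has_vector_derivative
      by (rule bounded_linear.has_vector_derivative[OF bounded_linear_scaleR_left])
    then show ?thesis
      by (simp add: Suc f_def[abs_def] d_def bounded_linear.linear[OF N] linear_scale del: power_Suc fact_Suc)
  qed
  have maj: "\<exists>M. summable M \<and> (\<forall>m t. \<bar>t\<bar> \<le> R \<longrightarrow> norm (f m t) \<le> M m \<and> norm (d m t) \<le> M m)"
    if R: "0 \<le> R" for R
  proof -
    define a where "a m = (R * K) ^ m / fact m * norm e" for m
    define b where "b m = (case m of 0 \<Rightarrow> 0 | Suc m' \<Rightarrow> a m' * K)" for m
    have a: "summable a"
      using summable_exp[of "R * K"] unfolding a_def[abs_def]
      by (intro summable_mult2) (simp add: field_simps)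
    then have "summable (\<lambda>m. b (Suc m))" by (simp add: b_def summable_mult2)
    then have b: "summable b" by (simp add: summable_Suc_iff)
    have a0: "0 \<le> a m" and b0: "0 \<le> b m" for m
      using R K(1) by (auto simp: a_def b_def split: nat.split)
    have "norm (f m t) \<le> a m + b m" if "\<bar>t\<bar> \<le> R" for m t
      using fb[OF that, of m] b0[of m] by (simp add: a_def)
    moreover have "norm (d m t) \<le> a m + b m" if t: "\<bar>t\<bar> \<le> R" for m t
    proof (cases m)
      case (Suc k)
      have "norm (N (f k t)) \<le> a k * K"
        using K(2)[of "f k t"] mult_right_mono[OF fb[OF t, of k], of K] K(1) by (simp add: a_def)
      then show ?thesis using a0[of m] by (simp add: Suc d_def b_def)
    qed (use a0 b0 in \<open>simp add: d_def\<close>)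
    ultimately show ?thesis using summable_add[OF a b] by blast
  qed
  have sum: "summable (\<lambda>m. f m t)" for t
  proof -
    obtain M where M: "summable M" "\<And>m. norm (f m t) \<le> M m"
      using maj[OF abs_ge_zero[of t]] by blast
    show ?thesis by (rule summable_comparison_test'[OF M(1), of 0]) (rule M(2))
  qed
  define v where "v t = (\<Sum>m. f m t)" for t
  have "v 0 = (\<Sum>m\<in>{0}. f m 0)" unfolding v_def by (rule suminf_finite) (auto simp: f_def)
  then have "v 0 = e" by (simp add: f_def)
  moreover have "(v has_vector_derivative N (v t)) (at t)" for t
  proof -
    have "summable (\<lambda>m. d (Suc m) t)" using bounded_linear.summable[OF N sum] by (simp add: d_def)
    then have "summable (\<lambda>m. d m t)" by (subst (asm) summable_Suc_iff)
    then have "(\<Sum>m. d m t) = (\<Sum>m. d (Suc m) t)"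
      using suminf_split_head[of "\<lambda>m. d m t"] by (simp add: d_def[of 0])
    also have "\<dots> = N (v t)" by (simp add: d_def v_def bounded_linear.suminf[OF N sum])
    finally show ?thesis using has_vector_derivative_series[OF der maj, of t] by (simp add: v_def[abs_def])
  qed
  ultimately show ?thesis by (rule that)
qed

context normal_pair
begin

text \<open>On the range of \<open>P\<^sub>k\<close> the operator \<open>A\<close> is bounded, so the exponential \<open>e\<^bsup>t A\<^esup> e\<close> exists there; it stays
  in that range because \<open>P\<^sub>k\<close> commutes with \<open>A\<close>.\<close>

lemma block_flow_exists:
  assumes sr: "scalar_resolution d P z" and d: "0 < d" and e: "P k e = e"
  obtains v where "v 0 = e" "\<And>t. P k (v t) = v t" "\<And>t. (v has_vector_derivative A (v t)) (at t)"
    "\<And>t. norm (v t) \<le> exp ((\<bar>Re (z k)\<bar> + d) * \<bar>t\<bar>) * norm e"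
proof -
  note P = scalar_resolutionD[OF sr]
  note proj = resolutionD(1)[OF P(1)]
  obtain v where v: "v 0 = e" "\<And>t. (v has_vector_derivative A (P k (v t))) (at t)"
    using linear_ode_solution_exists[OF bounded_linear_block[OF sr d]] by blast
  obtain c where "\<And>t. t \<in> UNIV \<Longrightarrow> v t - P k (v t) = c"
  proof (rule has_vector_derivative_zero_constant)
    fix t
    have "((\<lambda>t. v t - P k (v t)) has_vector_derivative A (P k (v t)) - P k (A (P k (v t)))) (at t)"
      by (intro has_vector_derivative_diff v bounded_linear.has_vector_derivative[OF bounded_linear_proj[OF proj]])
    moreover have "P k (A (P k (v t))) = A (P k (v t))"
      using commutesD(2)[OF P(3)[of k] P(2)[of k "v t"]] is_projD(2)[OF proj] by simp
    ultimately show "((\<lambda>t. v t - P k (v t)) has_vector_derivative 0) (at t within UNIV)"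
      by simp
  qed auto
  then have inv: "P k (v t) = v t" for t
    using v(1) e by (metis UNIV_I eq_iff_diff_eq_0)
  have der: "(v has_vector_derivative A (v t)) (at t)" for t using v(2)[of t] inv by simp
  have near: "norm (A (v t) - z k *\<^sub>C v t) \<le> d * norm (v t)" for t using P(4)[of k "v t"] inv by simp
  note growth = solution_growth[OF der near]
  have "norm (v t) \<le> exp ((\<bar>Re (z k)\<bar> + d) * \<bar>t\<bar>) * norm e" for t
  proof (cases "0 \<le> t")
    case True
    have "norm (v t) \<le> exp ((Re (z k) + d) * t) * norm e" using growth(2)[OF True] v(1) by simp
    also have "\<dots> \<le> exp ((\<bar>Re (z k)\<bar> + d) * \<bar>t\<bar>) * norm e"
      using True by (intro mult_right_mono) (auto intro!: mult_right_mono)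
    finally show ?thesis .
  next
    case False
    have "exp ((Re (z k) - d) * (- t)) * norm (v t) \<le> norm e" using growth(1)[of t 0] False v(1) by simp
    then have "exp ((d - Re (z k)) * (- t)) * (exp ((Re (z k) - d) * (- t)) * norm (v t))
        \<le> exp ((d - Re (z k)) * (- t)) * norm e" by (intro mult_left_mono) auto
    then have "norm (v t) \<le> exp ((d - Re (z k)) * (- t)) * norm e"
      by (simp only: mult.assoc[symmetric] exp_add[symmetric]) (simp add: algebra_simps)
    also have "\<dots> \<le> exp ((\<bar>Re (z k)\<bar> + d) * \<bar>t\<bar>) * norm e"
    proof -
      have "(d - Re (z k)) * (- t) \<le> (\<bar>Re (z k)\<bar> + d) * (- t)" using False by (intro mult_right_mono) auto
      then show ?thesis using False by (intro mult_right_mono) (auto simp: abs_if)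
    qed
    finally show ?thesis .
  qed
  with v(1) inv der show ?thesis by (rule that)
qed

text \<open>Where growth fails, blocks can be picked one after another with \<open>|z\<^sub>k|\<close> beating every exponential
  of \<open>|Re z\<^sub>k|\<close>; \<open>|z\<^sub>k|\<close> strictly increases, so that they are different.\<close>

lemma fast_blocks_exist:
  assumes sr: "scalar_resolution 1 P z"
    and not: "\<And>C \<tau>. \<exists>w\<in>spectrum D A. C * exp (\<tau> * \<bar>Re w\<bar>) < norm w"
  obtains \<kappa> :: "nat \<Rightarrow> nat" where "inj \<kappa>" "\<And>n. \<exists>x. P (\<kappa> n) x \<noteq> 0"
    "\<And>n. 2 ^ n * exp (real n * \<bar>Re (z (\<kappa> n))\<bar>) \<le> norm (z (\<kappa> n))"
proof -
  define Q where "Q n k \<longleftrightarrow> (\<exists>x. P k x \<noteq> 0) \<and> 2 ^ n * exp (real n * \<bar>Re (z k)\<bar>) \<le> norm (z k)" for n k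
  have ex: "\<exists>k. Q n k" for n
  proof -
    \<comment> \<open>Passing from \<open>w\<close> to a block scalar within distance \<open>2\<close> costs the factor \<open>exp (2 n)\<close> on the real part
      and the summand \<open>2\<close> on the norm.\<close>
    obtain w where w: "w \<in> spectrum D A" "(2 ^ n + 2) * exp (2 * real n) * exp (real n * \<bar>Re w\<bar>) < norm w"
      using not by blast
    obtain k x where k: "P k x \<noteq> 0" "norm (z k - w) \<le> 2"
      using block_near_spectrum[OF sr zero_less_one w(1)] by auto
    have "\<bar>Re (z k)\<bar> \<le> 2 + \<bar>Re w\<bar>" using k(2) abs_Re_le_cmod[of "z k - w"] by simp
    then have "real n * \<bar>Re (z k)\<bar> \<le> real n * (2 + \<bar>Re w\<bar>)" by (intro mult_left_mono) auto
    then have "exp (real n * \<bar>Re (z k)\<bar>) \<le> exp (2 * real n) * exp (real n * \<bar>Re w\<bar>)"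
      by (simp add: exp_add[symmetric] algebra_simps)
    then have "(2 ^ n + 2) * exp (real n * \<bar>Re (z k)\<bar>) \<le> (2 ^ n + 2) * (exp (2 * real n) * exp (real n * \<bar>Re w\<bar>))"
      by (intro mult_left_mono) auto
    then have "2 ^ n * exp (real n * \<bar>Re (z k)\<bar>) + 2 * exp (real n * \<bar>Re (z k)\<bar>) < norm w"
      using w(2) by (simp only: distrib_right[symmetric] mult.assoc)
    moreover have "1 \<le> exp (real n * \<bar>Re (z k)\<bar>)" by simp
    moreover have "norm w \<le> norm (z k) + 2" using k(2) norm_triangle_ineq2[of w "z k"] by (simp add: norm_minus_commute)
    ultimately have "2 ^ n * exp (real n * \<bar>Re (z k)\<bar>) \<le> norm (z k)" by linarith
    then show ?thesis using k(1) by (auto simp: Q_def)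
  qed
  have "\<exists>k'. Q (Suc n) k' \<and> norm (z k) < norm (z k')" for n k
  proof -
    obtain m0 where "norm (z k) < 2 ^ m0" using real_arch_pow[of 2 "norm (z k)"] by auto
    define m where "m = max m0 (Suc n)"
    have m: "norm (z k) < 2 ^ m" "Suc n \<le> m"
    proof -
      have "(2::real) ^ m0 \<le> 2 ^ m" by (intro power_increasing) (auto simp: m_def)
      then show "norm (z k) < 2 ^ m" using \<open>norm (z k) < 2 ^ m0\<close> by linarith
    qed (simp add: m_def)
    obtain k' where k': "Q m k'" using ex by blast
    have "2 ^ Suc n * exp (real (Suc n) * \<bar>Re (z k')\<bar>) \<le> 2 ^ m * exp (real m * \<bar>Re (z k')\<bar>)"
      using m(2) by (intro mult_mono power_increasing) (auto intro!: mult_right_mono)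
    then have "Q (Suc n) k'" using k' by (auto simp: Q_def)
    have "2 ^ m * 1 \<le> (2 ^ m * exp (real m * \<bar>Re (z k')\<bar>) :: real)" by (intro mult_left_mono) auto
    moreover have "2 ^ m * exp (real m * \<bar>Re (z k')\<bar>) \<le> norm (z k')" using k' by (simp add: Q_def)
    ultimately have "norm (z k) < norm (z k')" using m(1) by linarith
    with \<open>Q (Suc n) k'\<close> show ?thesis by blast
  qed
  then obtain \<kappa> where \<kappa>: "\<And>n. Q n (\<kappa> n)" "\<And>n. norm (z (\<kappa> n)) < norm (z (\<kappa> (Suc n)))"
    using dependent_nat_choice[of Q "\<lambda>_ k k'. norm (z k) < norm (z k')"] ex by blast
  have "strict_mono (\<lambda>n. norm (z (\<kappa> n)))" using \<kappa>(2) by (rule strict_mono_Suc_iff[THEN iffD2, rule_format])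
  then have "inj \<kappa>" using strict_mono_imp_inj_on[of "\<lambda>n. norm (z (\<kappa> n))" UNIV]
    by (auto simp: inj_on_def)
  then show ?thesis using that \<kappa>(1) unfolding Q_def by blast
qed

text \<open>The series \<open>y(t) = \<Sum> e\<^bsup>t A\<^esup> e\<^sub>n / |z\<^sub>n|\<close> over such blocks is a weak solution.  If it were
  differentiable at \<open>0\<close>, the components \<open>A e\<^sub>n / |z\<^sub>n|\<close> of its derivative, of norm near \<open>1\<close>, would tend to
  \<open>0\<close>.\<close>

theorem spectrum_growth_if_smooth:
  assumes smooth: "\<And>y. weak_solution D A y \<Longrightarrow> y differentiable (at 0)"
  shows "\<exists>C \<tau>. \<forall>w\<in>spectrum D A. norm w \<le> C * exp (\<tau> * \<bar>Re w\<bar>)"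
proof (rule ccontr)
  assume "\<not> ?thesis"
  then have not: "\<exists>w\<in>spectrum D A. C * exp (\<tau> * \<bar>Re w\<bar>) < norm w" for C \<tau>
    by (meson not_less)
  obtain P z where sr: "scalar_resolution 1 P z" using scalar_resolution_exists[OF zero_less_one] .
  note P = scalar_resolutionD[OF sr]
  note proj = resolutionD(1)[OF P(1)]
  obtain \<kappa> where \<kappa>: "inj \<kappa>" "\<And>n. \<exists>x. P (\<kappa> n) x \<noteq> 0"
    "\<And>n. 2 ^ n * exp (real n * \<bar>Re (z (\<kappa> n))\<bar>) \<le> norm (z (\<kappa> n))"
    using fast_blocks_exist[OF sr not] by blast
  define \<zeta> where "\<zeta> n = z (\<kappa> n)" for n
  have big: "2 ^ n * exp (real n * \<bar>Re (\<zeta> n)\<bar>) \<le> norm (\<zeta> n)" for n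
    unfolding \<zeta>_def by (rule \<kappa>(3))
  have pos: "0 < norm (\<zeta> n)" for n
    using big[of n] by (rule less_le_trans[rotated]) simp
  have "\<exists>v. P (\<kappa> n) (v 0) = v 0 \<and> norm (v 0) = 1 \<and> (\<forall>t. P (\<kappa> n) (v t) = v t) \<and>
      (\<forall>t. (v has_vector_derivative A (v t)) (at t)) \<and>
      (\<forall>t. norm (v t) \<le> exp ((\<bar>Re (\<zeta> n)\<bar> + 1) * \<bar>t\<bar>))" for n
  proof -
    obtain x where x: "P (\<kappa> n) x \<noteq> 0" using \<kappa>(2) by blast
    define e where "e = (1 / norm (P (\<kappa> n) x)) *\<^sub>R P (\<kappa> n) x"
    have e: "P (\<kappa> n) e = e" "norm e = 1"
      using x by (simp_all add: e_def is_proj_linear[OF proj] is_projD(2)[OF proj])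
    obtain v where "v 0 = e" "\<And>t. P (\<kappa> n) (v t) = v t" "\<And>t. (v has_vector_derivative A (v t)) (at t)"
      "\<And>t. norm (v t) \<le> exp ((\<bar>Re (z (\<kappa> n))\<bar> + 1) * \<bar>t\<bar>) * norm e"
      using block_flow_exists[OF sr zero_less_one e(1)] by blast
    with e show ?thesis by (intro exI[of _ v]) (simp add: \<zeta>_def)
  qed
  then have "\<forall>n. \<exists>v. P (\<kappa> n) (v 0) = v 0 \<and> norm (v 0) = 1 \<and> (\<forall>t. P (\<kappa> n) (v t) = v t) \<and>
      (\<forall>t. (v has_vector_derivative A (v t)) (at t)) \<and>
      (\<forall>t. norm (v t) \<le> exp ((\<bar>Re (\<zeta> n)\<bar> + 1) * \<bar>t\<bar>))" by blast
  from choice[OF this] obtain v where v: "\<And>n. norm (v n 0) = 1" "\<And>n t. P (\<kappa> n) (v n t) = v n t"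
      "\<And>n t. (v n has_vector_derivative A (v n t)) (at t)"
      "\<And>n t. norm (v n t) \<le> exp ((\<bar>Re (\<zeta> n)\<bar> + 1) * \<bar>t\<bar>)"
    by blast
  define e where "e n = v n 0" for n
  have e: "P (\<kappa> n) (e n) = e n" "norm (e n) = 1" for n using v(1,2) by (simp_all add: e_def)
  have vD: "v n t \<in> D" for n t using P(2)[of "\<kappa> n" "v n t"] v(2) by simp
  define u where "u n t = (1 / norm (\<zeta> n)) *\<^sub>R v n t" for n t
  have maj: "\<exists>M. summable M \<and> (\<forall>n t. \<bar>t\<bar> \<le> R \<longrightarrow> norm (u n t) \<le> M n)" if R: "0 \<le> R" for R
  proof -
    define M where "M n = exp ((\<bar>Re (\<zeta> n)\<bar> + 1) * R) / norm (\<zeta> n)" for n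
    obtain N :: nat where N: "R \<le> real N" using real_arch_simple by blast
    have Mle: "norm (M n) \<le> exp R * (1 / 2) ^ n" if n: "N \<le> n" for n
    proof -
      have "\<bar>Re (\<zeta> n)\<bar> * R \<le> \<bar>Re (\<zeta> n)\<bar> * real n" using N n by (intro mult_left_mono) auto
      then have "exp ((\<bar>Re (\<zeta> n)\<bar> + 1) * R) \<le> exp (real n * \<bar>Re (\<zeta> n)\<bar>) * exp R"
        by (simp add: exp_add[symmetric] algebra_simps)
      then have "2 ^ n * exp ((\<bar>Re (\<zeta> n)\<bar> + 1) * R) \<le> 2 ^ n * (exp (real n * \<bar>Re (\<zeta> n)\<bar>) * exp R)"
        by (intro mult_left_mono) auto
      also have "\<dots> \<le> norm (\<zeta> n) * exp R" using mult_right_mono[OF big[of n], of "exp R"] by (simp add: mult.assoc)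
      finally have "2 ^ n * exp ((\<bar>Re (\<zeta> n)\<bar> + 1) * R) \<le> norm (\<zeta> n) * exp R" .
      then have "2 ^ n * exp ((\<bar>Re (\<zeta> n)\<bar> + 1) * R) / (2 ^ n * norm (\<zeta> n))
          \<le> norm (\<zeta> n) * exp R / (2 ^ n * norm (\<zeta> n))" by (intro divide_right_mono) auto
      then have "M n \<le> exp R / 2 ^ n" using pos[of n] unfolding M_def by simp
      moreover have "norm (M n) = M n" by (simp add: M_def)
      ultimately show ?thesis by (simp add: power_one_over)
    qed
    have "summable (\<lambda>n. exp R * (1 / 2) ^ n)" by (intro summable_mult summable_geometric) simp
    then have "summable M" by (rule summable_comparison_test'[OF _ Mle])
    moreover have "norm (u n t) \<le> M n" if t: "\<bar>t\<bar> \<le> R" for n t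
    proof -
      have "norm (v n t) \<le> exp ((\<bar>Re (\<zeta> n)\<bar> + 1) * R)"
        by (rule order_trans[OF v(4)]) (use t in \<open>simp add: mult_left_mono\<close>)
      then show ?thesis using pos[of n] by (simp add: u_def M_def divide_right_mono)
    qed
    ultimately show ?thesis by blast
  qed
  have sum: "summable (\<lambda>n. u n t)" for t
  proof -
    obtain M where M: "summable M" "\<And>n. norm (u n t) \<le> M n"
      using maj[OF abs_ge_zero[of t]] by blast
    show ?thesis by (rule summable_comparison_test'[OF M(1), of 0]) (rule M(2))
  qed
  define y where "y t = (\<Sum>n. u n t)" for t
  have der: "(u n has_vector_derivative A (u n t)) (at t)" for n t
    using bounded_linear.has_vector_derivative[OF bounded_linear_scaleR_right v(3), of "1 / norm (\<zeta> n)" n t]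
    by (simp add: u_def[abs_def] A_lin vD)
  have uD: "u n t \<in> D" for n t by (simp add: u_def A_lin vD)
  have weak: "((\<lambda>s. cinner (y s) g) has_vector_derivative cinner (y t) (B g)) (at t)" if g: "g \<in> D" for g t
  proof -
    have y_sum: "cinner (y t) h = (\<Sum>n. cinner (u n t) h)" for t h
      unfolding y_def by (rule bounded_linear.suminf[OF bounded_linear_cinner_left sum])
    have "((\<lambda>s. \<Sum>n. cinner (u n s) g) has_vector_derivative (\<Sum>n. cinner (u n t) (B g))) (at t)"
    proof (rule has_vector_derivative_series)
      show "((\<lambda>s. cinner (u n s) g) has_vector_derivative cinner (u n t) (B g)) (at t)" for n t
        using bounded_linear.has_vector_derivative[OF bounded_linear_cinner_left der, of n g t]
        by (simp add: cinner_A[OF uD g])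
      fix R :: real assume "0 \<le> R"
      then obtain M where M: "summable M" "\<And>n t. \<bar>t\<bar> \<le> R \<Longrightarrow> norm (u n t) \<le> M n" using maj by blast
      have c1: "norm (cinner (u n t) h) \<le> M n * norm h" if "\<bar>t\<bar> \<le> R" for n t h
        using norm_cinner_le[of "u n t" h] mult_right_mono[OF M(2)[OF that, of n], of "norm h"] by simp
      have c2: "M n * norm h \<le> M n * (norm g + norm (B g))" if "norm h \<le> norm g + norm (B g)" for n h
        using order_trans[OF norm_ge_zero M(2)[of 0 n]] \<open>0 \<le> R\<close> that by (intro mult_left_mono) auto
      have "norm (cinner (u n t) g) \<le> M n * (norm g + norm (B g)) \<and>
          norm (cinner (u n t) (B g)) \<le> M n * (norm g + norm (B g))" if "\<bar>t\<bar> \<le> R" for n t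
        by (intro conjI order_trans[OF c1[OF that] c2]) simp_all
      then show "\<exists>M. summable M \<and> (\<forall>n t. \<bar>t\<bar> \<le> R \<longrightarrow>
          norm (cinner (u n t) g) \<le> M n \<and> norm (cinner (u n t) (B g)) \<le> M n)"
        using summable_mult2[OF M(1)] by blast
    qed
    then show ?thesis by (simp add: y_sum)
  qed
  have "continuous_on UNIV (u n)" for n
    using has_vector_derivative_continuous[OF der] by (simp add: continuous_at_imp_continuous_on)
  then have "continuous_on UNIV y"
    unfolding y_def[abs_def] by (intro continuous_on_series maj)
  then have "weak_solution D A y" using weak by (simp add: weak_solution_iff)
  then have "y differentiable (at 0)" by (rule smooth)
  then obtain w where w: "(y has_vector_derivative w) (at 0)"
    using vector_derivative_works by blast
  have "cinner (B g) (y 0) = cinner g w" if g: "g \<in> D" for g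
  proof -
    have "((\<lambda>s. cinner (y s) g) has_vector_derivative cinner w g) (at 0)"
      by (rule bounded_linear.has_vector_derivative[OF bounded_linear_cinner_left w])
    then have "cinner w g = cinner (y 0) (B g)"
      using weak[OF g] vector_derivative_unique_at by blast
    then show ?thesis by (metis cinner_commute)
  qed
  from in_D_if_A[OF this] have y0: "y 0 \<in> D" "A (y 0) = w" by blast+
  have comp: "P (\<kappa> m) (y 0) = (1 / norm (\<zeta> m)) *\<^sub>R e m" for m
  proof -
    have other: "P (\<kappa> m) (e n) = 0" if "n \<noteq> m" for n
    proof -
      have "\<kappa> m \<noteq> \<kappa> n" using \<kappa>(1) that by (auto simp: inj_def)
      then show ?thesis using resolutionD(2)[OF P(1), of "\<kappa> m" "\<kappa> n" "e n"] e(1) by simp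
    qed
    have "P (\<kappa> m) (y 0) = (\<Sum>n. P (\<kappa> m) (u n 0))"
      unfolding y_def by (rule bounded_linear.suminf[OF bounded_linear_proj[OF proj] sum])
    also have "\<dots> = (\<Sum>n\<in>{m}. P (\<kappa> m) (u n 0))"
      by (rule suminf_finite) (auto simp: u_def e_def[symmetric] is_proj_linear[OF proj] other)
    finally show ?thesis by (simp add: u_def e_def[symmetric] is_proj_linear[OF proj] e(1))
  qed
  have large: "1 / 2 \<le> norm (P (\<kappa> m) w)" if m: "1 \<le> m" for m
  proof -
    have "2 ^ 1 * 1 \<le> (2::real) ^ m * exp (real m * \<bar>Re (\<zeta> m)\<bar>)"
      using m by (intro mult_mono power_increasing) auto
    then have two: "2 \<le> norm (\<zeta> m)" using big[of m] by simp
    have eD: "e m \<in> D" using P(2)[of "\<kappa> m" "e m"] e(1) by simp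
    have "norm (A (e m) - \<zeta> m *\<^sub>C e m) \<le> 1"
      using P(4)[of "\<kappa> m" "e m"] by (simp add: e \<zeta>_def)
    moreover have "norm (\<zeta> m *\<^sub>C e m) = norm (\<zeta> m)" by (simp add: norm_scaleC e(2))
    ultimately have "norm (\<zeta> m) - 1 \<le> norm (A (e m))"
      using norm_triangle_ineq2[of "\<zeta> m *\<^sub>C e m" "A (e m)"] by (simp add: norm_minus_commute)
    then have "(norm (\<zeta> m) - 1) / norm (\<zeta> m) \<le> norm (A (e m)) / norm (\<zeta> m)"
      by (intro divide_right_mono) auto
    moreover have "1 / 2 \<le> (norm (\<zeta> m) - 1) / norm (\<zeta> m)" using two pos[of m] by (simp add: pos_le_divide_eq)
    moreover have "P (\<kappa> m) w = (1 / norm (\<zeta> m)) *\<^sub>R A (e m)"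
      using commutesD(2)[OF P(3) y0(1), of "\<kappa> m"] y0(2) comp[of m] eD by (simp add: A_lin)
    then have "norm (P (\<kappa> m) w) = norm (A (e m)) / norm (\<zeta> m)" by simp
    ultimately show ?thesis by linarith
  qed
  have "\<forall>\<^sub>F k in sequentially. norm (P k w) < 1 / 2"
    using tendsto_norm[OF resolution_component_tendsto_0[OF P(1), of w]]
    by (rule order_tendstoD) simp
  then obtain k0 where k0: "\<And>k. k0 \<le> k \<Longrightarrow> norm (P k w) < 1 / 2" by (auto simp: eventually_sequentially)
  have "infinite (\<kappa> ` {1..})"
    using \<kappa>(1) infinite_Ici[of "1::nat"] by (simp add: finite_image_iff inj_on_subset)
  then obtain m where "1 \<le> m" "k0 \<le> \<kappa> m" by (auto simp: infinite_nat_iff_unbounded_le)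
  then show False using large k0 by (meson not_less)
qed

end

theorem corollary6p1:
  fixes D :: "'a::complex_hilbert_space set" and A :: "'a \<Rightarrow> 'a"
  assumes "normal_operator D A"
  shows "(\<forall>y. weak_solution D A y \<longrightarrow> strongly_smooth y) \<longleftrightarrow>
    (\<exists>b_plus > 0. \<exists>b_minus > 0. bounded (spectrum D A - log_region b_minus b_plus))"
proof -
  interpret normal_pair D A "adjoint_op D A" using assms by (rule normal_operator_pair)
  have diff: "y differentiable (at 0)" if "strongly_smooth y" for y :: "real \<Rightarrow> 'a"
    using that[unfolded strongly_smooth_def, rule_format, of 0 0] by simp
  have "(\<forall>y. weak_solution D A y \<longrightarrow> strongly_smooth y) \<longleftrightarrow>
      (\<exists>C \<tau>. \<forall>w\<in>spectrum D A. norm w \<le> C * exp (\<tau> * \<bar>Re w\<bar>))"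
    using spectrum_growth_if_smooth diff smooth_if_spectrum_growth by blast
  then show ?thesis by (simp only: log_region_exponential)
qed

end
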